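(* Let $\mathcal A=\langle A,T,Q,\gamma,\eta,\varepsilon\rangle$ be a skew monoidal monoid, $\mathcal A_Q$ its comodule category with the vertical tensor product, and $F=\mathcal A_Q(\delta,\delta)$ the associated left $A$-bialgebroid. The forgetful functor $\mathcal A_Q(-,\delta):\mathcal A_Q^{\mathrm{op}}\to{}_A\mathbf{Set}_A$ is strong monoidal and factors (through the forgetful functor of left $F$-modules) through a monoidal equivalence $\mathcal A_Q^{\mathrm{op}}\cong{}_F^{\mathrm{reg}}\mathbf{Set}$ of $\mathcal A_Q^{\mathrm{op}}$ with the category of source-regular left $F$-modules.
   Context: A skew monoidal monoid $\mathcal A=\langle A,T,Q,\gamma,\eta,\varepsilon\rangle$ consists of a monoid $A$, monoid endomorphisms $T,Q:A\to A$ and elements $\gamma,\eta,\varepsilon\in A$ such that for all $a,b\in A$: $T(a)Q(b)=Q(b)T(a)$, $\gamma T^2(a)=T(a)\gamma$, $\gamma TQ(a)=QT(a)\gamma$, $\gamma Q(a)=Q^2(a)\gamma$, $\eta a=T(a)\eta$, $a\varepsilon=\varepsilon Q(a)$, $Q(\gamma)\gamma T(\gamma)=\gamma^2$, $\gamma\eta=Q(\eta)$, $\varepsilon\gamma=T(\varepsilon)$, $Q(\varepsilon)\gamma T(\eta)=1$, $\varepsilon\eta=1$. Put $\mu:=Q(\varepsilon)\gamma$, $\delta:=\gamma T(\eta)$ (then $\gamma=\mu\delta$) and $S:A\to A^{\mathrm{op}}$, $S(a):=\mu T(Q(a)\eta)$, a monoid morphism. The comodule category $\mathcal A_Q$ has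 as objects the elements $u\in A$ with $Q(u)u=\delta u$ and $\varepsilon u=1$; its arrows $s:u\to v$ are the elements $s\in A$ with $Q(s)u=vs$; composition is multiplication in $A$. It is strict monoidal with the vertical tensor product $u\circledcirc v:=\mu T(v)u$ on objects, $s\otimes t:=s\,\varepsilon\,T(t)\,u_1$ on arrows $s:u_1\to v_1$, $t:u_2\to v_2$, and unit object $\eta$. In it $\langle\delta,\mu,\eta\rangle$ is a monoid, with multiplication $\mu:\delta\circledcirc\delta\to\delta$ and unit $\eta:\eta\to\delta$, which induces the monoidal structure $s\otimes_At\mapsto\mu\circ(s\otimes t)$ of the functor $\mathcal A_Q(-,\delta)$. One has $\mathcal A_Q(u,\delta)=Q(A)u$, with $A$-$A$-bimodule structure $a_1\cdot s\cdot a_2=Q(a_1)S(a_2)s$. ${}_A\mathbf{Set}_A$ is the monoidal category of $A$-$A$-bisets (bimodules) with tensor product $\otimes_A$ and unit $A$. The left $A$-bialgebroid $F$ has underlying monoid $F=\mathcal A_Q(\delta,\delta)=Q(A)\delta\subset A$, source $s_F(a)=Q(a)$, target $t_F(a)=S(a)$, bimodule structure $a_1\cdot f\cdot a_2=Q(a_1)S(a_2)f$, comultiplication $\Delta_F(f)=f_{(1)}\otimes f_{(2)}=Q(\varepsilon f\mu)\delta\otimes_A\delta$ and counit $\epsilon_F(f)=\varepsilon f\eta$. It acts on $\mathcal A_Q(u,\delta)$ by left multiplication. Left $F$-modules (left $F$-sets) form a monoidal category: $X$ is an $A$-bimodule by $a_1\cdot x\cdot a_2=s_F(a_1)t_F(a_2)x$,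 the tensor product is $X\otimes_AY$ with $f(x\otimes y)=f_{(1)}x\otimes f_{(2)}y$, and the unit is $A$ with $f\cdot a=\epsilon_F(fs_F(a))$. A left $F$-module is source-regular if its restriction along $s_F:A\to F$ is isomorphic to the left regular $A$-module ${}_AA$; ${}_F^{\mathrm{reg}}\mathbf{Set}$ is the full monoidal subcategory of such modules. *)

theory Defs
  imports "HOL-Algebra.Group"
begin

section \<open>Monoidal categories\<close>

text \<open>
  Categories are given by families of hom-sets. Hom-sets for different pairs of objects need not be
  disjoint, so identities, composition and the tensor product of arrows take the objects as
  arguments: \<open>Cmp C X Y Z g f\<close> is the composite of \<open>f : X \<rightarrow> Y\<close> and \<open>g : Y \<rightarrow> Z\<close>, and
  \<open>TenA C X X' Y Y' f g\<close> is the tensor product of \<open>f : X \<rightarrow> X'\<close> and \<open>g : Y \<rightarrow> Y'\<close>.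
\<close>

record ('o, 'm) cat =
  Ob :: "'o set"
  Hom :: "'o \<Rightarrow> 'o \<Rightarrow> 'm set"
  Id :: "'o \<Rightarrow> 'm"
  Cmp :: "'o \<Rightarrow> 'o \<Rightarrow> 'o \<Rightarrow> 'm \<Rightarrow> 'm \<Rightarrow> 'm"

record ('o, 'm) moncat = "('o, 'm) cat" +
  TenO :: "'o \<Rightarrow> 'o \<Rightarrow> 'o"
  TenA :: "'o \<Rightarrow> 'o \<Rightarrow> 'o \<Rightarrow> 'o \<Rightarrow> 'm \<Rightarrow> 'm \<Rightarrow> 'm"
  Unit :: "'o"
  Assoc :: "'o \<Rightarrow> 'o \<Rightarrow> 'o \<Rightarrow> 'm"
  LUnit :: "'o \<Rightarrow> 'm"
  RUnit :: "'o \<Rightarrow> 'm"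

locale category =
  fixes C :: "('o, 'm, 'z) cat_scheme" (structure)
  assumes Id_in: "X \<in> Ob C \<Longrightarrow> Id C X \<in> Hom C X X"
    and Cmp_in: "\<lbrakk>X \<in> Ob C; Y \<in> Ob C; Z \<in> Ob C; f \<in> Hom C X Y; g \<in> Hom C Y Z\<rbrakk>
      \<Longrightarrow> Cmp C X Y Z g f \<in> Hom C X Z"
    and Cmp_Id_left: "\<lbrakk>X \<in> Ob C; Y \<in> Ob C; f \<in> Hom C X Y\<rbrakk> \<Longrightarrow> Cmp C X Y Y (Id C Y) f = f"
    and Cmp_Id_right: "\<lbrakk>X \<in> Ob C; Y \<in> Ob C; f \<in> Hom C X Y\<rbrakk> \<Longrightarrow> Cmp C X X Y f (Id C X) = f"
    and Cmp_assoc: "\<lbrakk>W \<in> Ob C; X \<in> Ob C; Y \<in> Ob C; Z \<in> Ob C;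
        f \<in> Hom C W X; g \<in> Hom C X Y; h \<in> Hom C Y Z\<rbrakk>
      \<Longrightarrow> Cmp C W X Z (Cmp C X Y Z h g) f = Cmp C W Y Z h (Cmp C W X Y g f)"

definition inverse_arrows :: "('o, 'm, 'z) cat_scheme \<Rightarrow> 'o \<Rightarrow> 'o \<Rightarrow> 'm \<Rightarrow> 'm \<Rightarrow> bool" where
  "inverse_arrows C X Y f g \<longleftrightarrow> f \<in> Hom C X Y \<and> g \<in> Hom C Y X \<and>
     Cmp C X Y X g f = Id C X \<and> Cmp C Y X Y f g = Id C Y"

definition is_iso_arrow :: "('o, 'm, 'z) cat_scheme \<Rightarrow> 'o \<Rightarrow> 'o \<Rightarrow> 'm \<Rightarrow> bool" where
  "is_iso_arrow C X Y f \<longleftrightarrow> (\<exists>g. inverse_arrows C X Y f g)"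

definition arrow_inv :: "('o, 'm, 'z) cat_scheme \<Rightarrow> 'o \<Rightarrow> 'o \<Rightarrow> 'm \<Rightarrow> 'm" where
  "arrow_inv C X Y f = (THE g. inverse_arrows C X Y f g)"

locale monoidal_category = category C
  for C :: "('o, 'm, 'z) moncat_scheme" (structure) +
  assumes Unit_ob: "Unit C \<in> Ob C"
    and TenO_ob: "\<lbrakk>X \<in> Ob C; Y \<in> Ob C\<rbrakk> \<Longrightarrow> TenO C X Y \<in> Ob C"
    and TenA_in: "\<lbrakk>X \<in> Ob C; X' \<in> Ob C; Y \<in> Ob C; Y' \<in> Ob C; f \<in> Hom C X X'; g \<in> Hom C Y Y'\<rbrakk>
      \<Longrightarrow> TenA C X X' Y Y' f g \<in> Hom C (TenO C X Y) (TenO C X' Y')"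
    and TenA_Id: "\<lbrakk>X \<in> Ob C; Y \<in> Ob C\<rbrakk>
      \<Longrightarrow> TenA C X X Y Y (Id C X) (Id C Y) = Id C (TenO C X Y)"
    and TenA_Cmp: "\<lbrakk>X \<in> Ob C; X' \<in> Ob C; X'' \<in> Ob C; Y \<in> Ob C; Y' \<in> Ob C; Y'' \<in> Ob C;
        f \<in> Hom C X X'; f' \<in> Hom C X' X''; g \<in> Hom C Y Y'; g' \<in> Hom C Y' Y''\<rbrakk>
      \<Longrightarrow> TenA C X X'' Y Y'' (Cmp C X X' X'' f' f) (Cmp C Y Y' Y'' g' g) =
          Cmp C (TenO C X Y) (TenO C X' Y') (TenO C X'' Y'')
            (TenA C X' X'' Y' Y'' f' g') (TenA C X X' Y Y' f g)"
    and Assoc_iso: "\<lbrakk>X \<in> Ob C; Y \<in> Ob C; Z \<in> Ob C\<rbrakk>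
      \<Longrightarrow> is_iso_arrow C (TenO C (TenO C X Y) Z) (TenO C X (TenO C Y Z)) (Assoc C X Y Z)"
    and LUnit_iso: "X \<in> Ob C \<Longrightarrow> is_iso_arrow C (TenO C (Unit C) X) X (LUnit C X)"
    and RUnit_iso: "X \<in> Ob C \<Longrightarrow> is_iso_arrow C (TenO C X (Unit C)) X (RUnit C X)"
    and Assoc_nat: "\<lbrakk>X \<in> Ob C; X' \<in> Ob C; Y \<in> Ob C; Y' \<in> Ob C; Z \<in> Ob C; Z' \<in> Ob C;
        f \<in> Hom C X X'; g \<in> Hom C Y Y'; h \<in> Hom C Z Z'\<rbrakk>
      \<Longrightarrow> Cmp C (TenO C (TenO C X Y) Z) (TenO C (TenO C X' Y') Z') (TenO C X' (TenO C Y' Z'))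
            (Assoc C X' Y' Z')
            (TenA C (TenO C X Y) (TenO C X' Y') Z Z' (TenA C X X' Y Y' f g) h) =
          Cmp C (TenO C (TenO C X Y) Z) (TenO C X (TenO C Y Z)) (TenO C X' (TenO C Y' Z'))
            (TenA C X X' (TenO C Y Z) (TenO C Y' Z') f (TenA C Y Y' Z Z' g h))
            (Assoc C X Y Z)"
    and LUnit_nat: "\<lbrakk>X \<in> Ob C; X' \<in> Ob C; f \<in> Hom C X X'\<rbrakk>
      \<Longrightarrow> Cmp C (TenO C (Unit C) X) (TenO C (Unit C) X') X'
            (LUnit C X') (TenA C (Unit C) (Unit C) X X' (Id C (Unit C)) f) =
          Cmp C (TenO C (Unit C) X) X X' f (LUnit C X)"
    and RUnit_nat: "\<lbrakk>X \<in> Ob C; X' \<in> Ob C; f \<in> Hom C X X'\<rbrakk>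
      \<Longrightarrow> Cmp C (TenO C X (Unit C)) (TenO C X' (Unit C)) X'
            (RUnit C X') (TenA C X X' (Unit C) (Unit C) f (Id C (Unit C))) =
          Cmp C (TenO C X (Unit C)) X X' f (RUnit C X)"
    and pentagon: "\<lbrakk>W \<in> Ob C; X \<in> Ob C; Y \<in> Ob C; Z \<in> Ob C\<rbrakk>
      \<Longrightarrow> Cmp C (TenO C (TenO C (TenO C W X) Y) Z) (TenO C (TenO C W X) (TenO C Y Z))
            (TenO C W (TenO C X (TenO C Y Z)))
            (Assoc C W X (TenO C Y Z)) (Assoc C (TenO C W X) Y Z) =
          Cmp C (TenO C (TenO C (TenO C W X) Y) Z) (TenO C W (TenO C (TenO C X Y) Z))
            (TenO C W (TenO C X (TenO C Y Z)))
            (TenA C W W (TenO C (TenO C X Y) Z) (TenO C X (TenO C Y Z)) (Id C W) (Assoc C X Y Z))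
            (Cmp C (TenO C (TenO C (TenO C W X) Y) Z) (TenO C (TenO C W (TenO C X Y)) Z)
              (TenO C W (TenO C (TenO C X Y) Z))
              (Assoc C W (TenO C X Y) Z)
              (TenA C (TenO C (TenO C W X) Y) (TenO C W (TenO C X Y)) Z Z
                (Assoc C W X Y) (Id C Z)))"
    and triangle: "\<lbrakk>X \<in> Ob C; Y \<in> Ob C\<rbrakk>
      \<Longrightarrow> Cmp C (TenO C (TenO C X (Unit C)) Y) (TenO C X (TenO C (Unit C) Y)) (TenO C X Y)
            (TenA C X X (TenO C (Unit C) Y) Y (Id C X) (LUnit C Y)) (Assoc C X (Unit C) Y) =
          TenA C (TenO C X (Unit C)) X Y Y (RUnit C X) (Id C Y)"

text \<open>The opposite category with the same (not reversed) tensor product.\<close>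

definition op_moncat :: "('o, 'm) moncat \<Rightarrow> ('o, 'm) moncat" where
  "op_moncat C = \<lparr>
     Ob = Ob C,
     Hom = (\<lambda>X Y. Hom C Y X),
     Id = Id C,
     Cmp = (\<lambda>X Y Z g f. Cmp C Z Y X f g),
     TenO = TenO C,
     TenA = (\<lambda>X X' Y Y' f g. TenA C X' X Y' Y f g),
     Unit = Unit C,
     Assoc = (\<lambda>X Y Z. arrow_inv C (TenO C (TenO C X Y) Z) (TenO C X (TenO C Y Z)) (Assoc C X Y Z)),
     LUnit = (\<lambda>X. arrow_inv C (TenO C (Unit C) X) X (LUnit C X)),
     RUnit = (\<lambda>X. arrow_inv C (TenO C X (Unit C)) X (RUnit C X))\<rparr>"

definition full_subcat :: "('o, 'm) moncat \<Rightarrow> ('o \<Rightarrow> bool) \<Rightarrow> ('o, 'm) moncat" where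
  "full_subcat C P = C\<lparr>Ob := {X \<in> Ob C. P X}\<rparr>"


section \<open>Functors\<close>

text \<open>\<open>FArr F X Y f\<close> is the image of \<open>f : X \<rightarrow> Y\<close>; \<open>FTen F X Y : F X \<otimes> F Y \<rightarrow> F (X \<otimes> Y)\<close> and
  \<open>FUnit F : I \<rightarrow> F I\<close> are the structure maps of a monoidal functor.\<close>

record ('o, 'm, 'p, 'n) fctr =
  FOb :: "'o \<Rightarrow> 'p"
  FArr :: "'o \<Rightarrow> 'o \<Rightarrow> 'm \<Rightarrow> 'n"

record ('o, 'm, 'p, 'n) monfctr = "('o, 'm, 'p, 'n) fctr" +
  FTen :: "'o \<Rightarrow> 'o \<Rightarrow> 'n"
  FUnit :: "'n"

locale cat_functor = src: category C + tgt: category D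
  for C :: "('o, 'm, 'y) cat_scheme" and D :: "('p, 'n, 'z) cat_scheme" +
  fixes F :: "('o, 'm, 'p, 'n, 'w) fctr_scheme"
  assumes FOb_ob: "X \<in> Ob C \<Longrightarrow> FOb F X \<in> Ob D"
    and FArr_in: "\<lbrakk>X \<in> Ob C; Y \<in> Ob C; f \<in> Hom C X Y\<rbrakk>
      \<Longrightarrow> FArr F X Y f \<in> Hom D (FOb F X) (FOb F Y)"
    and FArr_Id: "X \<in> Ob C \<Longrightarrow> FArr F X X (Id C X) = Id D (FOb F X)"
    and FArr_Cmp: "\<lbrakk>X \<in> Ob C; Y \<in> Ob C; Z \<in> Ob C; f \<in> Hom C X Y; g \<in> Hom C Y Z\<rbrakk>
      \<Longrightarrow> FArr F X Z (Cmp C X Y Z g f) =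
          Cmp D (FOb F X) (FOb F Y) (FOb F Z) (FArr F Y Z g) (FArr F X Y f)"

definition id_fctr :: "('o, 'm, 'o, 'm) fctr" where
  "id_fctr = \<lparr>FOb = (\<lambda>X. X), FArr = (\<lambda>X Y f. f)\<rparr>"

definition comp_fctr ::
  "('p, 'n, 'q, 'k, 'y) fctr_scheme \<Rightarrow> ('o, 'm, 'p, 'n, 'z) fctr_scheme \<Rightarrow> ('o, 'm, 'q, 'k) fctr" where
  "comp_fctr G F = \<lparr>FOb = (\<lambda>X. FOb G (FOb F X)),
     FArr = (\<lambda>X Y f. FArr G (FOb F X) (FOb F Y) (FArr F X Y f))\<rparr>"

definition nat_iso ::
  "('o, 'm, 'y) cat_scheme \<Rightarrow> ('p, 'n, 'z) cat_scheme \<Rightarrow> ('o, 'm, 'p, 'n, 'v) fctr_scheme \<Rightarrow>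
     ('o, 'm, 'p, 'n, 'w) fctr_scheme \<Rightarrow> ('o \<Rightarrow> 'n) \<Rightarrow> bool" where
  "nat_iso C D F G \<theta> \<longleftrightarrow>
     (\<forall>X \<in> Ob C. is_iso_arrow D (FOb F X) (FOb G X) (\<theta> X)) \<and>
     (\<forall>X \<in> Ob C. \<forall>Y \<in> Ob C. \<forall>f \<in> Hom C X Y.
        Cmp D (FOb F X) (FOb G X) (FOb G Y) (FArr G X Y f) (\<theta> X) =
        Cmp D (FOb F X) (FOb F Y) (FOb G Y) (\<theta> Y) (FArr F X Y f))"

definition cat_equivalence ::
  "('o, 'm, 'y) cat_scheme \<Rightarrow> ('p, 'n, 'z) cat_scheme \<Rightarrow> ('o, 'm, 'p, 'n, 'v) fctr_scheme \<Rightarrow> bool" where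
  "cat_equivalence C D F \<longleftrightarrow> cat_functor C D F \<and>
     (\<exists>(G :: ('p, 'n, 'o, 'm) fctr) \<theta> \<psi>. cat_functor D C G \<and>
        nat_iso C C (comp_fctr G F) id_fctr \<theta> \<and> nat_iso D D (comp_fctr F G) id_fctr \<psi>)"

locale strong_monoidal_functor =
    src: monoidal_category C + tgt: monoidal_category D + cat_functor C D F
  for C :: "('o, 'm) moncat" and D :: "('p, 'n) moncat" and F :: "('o, 'm, 'p, 'n) monfctr" +
  assumes FTen_iso: "\<lbrakk>X \<in> Ob C; Y \<in> Ob C\<rbrakk>
      \<Longrightarrow> is_iso_arrow D (TenO D (FOb F X) (FOb F Y)) (FOb F (TenO C X Y)) (FTen F X Y)"
    and FUnit_iso: "is_iso_arrow D (Unit D) (FOb F (Unit C)) (FUnit F)"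
    and FTen_nat: "\<lbrakk>X \<in> Ob C; X' \<in> Ob C; Y \<in> Ob C; Y' \<in> Ob C; f \<in> Hom C X X'; g \<in> Hom C Y Y'\<rbrakk>
      \<Longrightarrow> Cmp D (TenO D (FOb F X) (FOb F Y)) (TenO D (FOb F X') (FOb F Y')) (FOb F (TenO C X' Y'))
            (FTen F X' Y')
            (TenA D (FOb F X) (FOb F X') (FOb F Y) (FOb F Y') (FArr F X X' f) (FArr F Y Y' g)) =
          Cmp D (TenO D (FOb F X) (FOb F Y)) (FOb F (TenO C X Y)) (FOb F (TenO C X' Y'))
            (FArr F (TenO C X Y) (TenO C X' Y') (TenA C X X' Y Y' f g))
            (FTen F X Y)"
    and FTen_assoc: "\<lbrakk>X \<in> Ob C; Y \<in> Ob C; Z \<in> Ob C\<rbrakk>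
      \<Longrightarrow> Cmp D (TenO D (TenO D (FOb F X) (FOb F Y)) (FOb F Z)) (FOb F (TenO C (TenO C X Y) Z))
            (FOb F (TenO C X (TenO C Y Z)))
            (FArr F (TenO C (TenO C X Y) Z) (TenO C X (TenO C Y Z)) (Assoc C X Y Z))
            (Cmp D (TenO D (TenO D (FOb F X) (FOb F Y)) (FOb F Z))
              (TenO D (FOb F (TenO C X Y)) (FOb F Z)) (FOb F (TenO C (TenO C X Y) Z))
              (FTen F (TenO C X Y) Z)
              (TenA D (TenO D (FOb F X) (FOb F Y)) (FOb F (TenO C X Y)) (FOb F Z) (FOb F Z)
                (FTen F X Y) (Id D (FOb F Z)))) =
          Cmp D (TenO D (TenO D (FOb F X) (FOb F Y)) (FOb F Z))
            (TenO D (FOb F X) (TenO D (FOb F Y) (FOb F Z))) (FOb F (TenO C X (TenO C Y Z)))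
            (Cmp D (TenO D (FOb F X) (TenO D (FOb F Y) (FOb F Z)))
              (TenO D (FOb F X) (FOb F (TenO C Y Z))) (FOb F (TenO C X (TenO C Y Z)))
              (FTen F X (TenO C Y Z))
              (TenA D (FOb F X) (FOb F X) (TenO D (FOb F Y) (FOb F Z)) (FOb F (TenO C Y Z))
                (Id D (FOb F X)) (FTen F Y Z)))
            (Assoc D (FOb F X) (FOb F Y) (FOb F Z))"
    and FTen_LUnit: "X \<in> Ob C
      \<Longrightarrow> Cmp D (TenO D (Unit D) (FOb F X)) (FOb F (TenO C (Unit C) X)) (FOb F X)
            (FArr F (TenO C (Unit C) X) X (LUnit C X))
            (Cmp D (TenO D (Unit D) (FOb F X)) (TenO D (FOb F (Unit C)) (FOb F X))
              (FOb F (TenO C (Unit C) X))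
              (FTen F (Unit C) X)
              (TenA D (Unit D) (FOb F (Unit C)) (FOb F X) (FOb F X) (FUnit F) (Id D (FOb F X)))) =
          LUnit D (FOb F X)"
    and FTen_RUnit: "X \<in> Ob C
      \<Longrightarrow> Cmp D (TenO D (FOb F X) (Unit D)) (FOb F (TenO C X (Unit C))) (FOb F X)
            (FArr F (TenO C X (Unit C)) X (RUnit C X))
            (Cmp D (TenO D (FOb F X) (Unit D)) (TenO D (FOb F X) (FOb F (Unit C)))
              (FOb F (TenO C X (Unit C)))
              (FTen F X (Unit C))
              (TenA D (FOb F X) (FOb F X) (Unit D) (FOb F (Unit C)) (Id D (FOb F X)) (FUnit F))) =
          RUnit D (FOb F X)"

definition monoidal_equivalence ::
  "('o, 'm) moncat \<Rightarrow> ('p, 'n) moncat \<Rightarrow> ('o, 'm, 'p, 'n) monfctr \<Rightarrow> bool" where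
  "monoidal_equivalence C D F \<longleftrightarrow> strong_monoidal_functor C D F \<and> cat_equivalence C D F"

definition comp_monfctr ::
  "('o, 'm) moncat \<Rightarrow> ('p, 'n) moncat \<Rightarrow> ('q, 'k) moncat \<Rightarrow>
     ('p, 'n, 'q, 'k) monfctr \<Rightarrow> ('o, 'm, 'p, 'n) monfctr \<Rightarrow> ('o, 'm, 'q, 'k) monfctr" where
  "comp_monfctr C D E G F = \<lparr>
     FOb = (\<lambda>X. FOb G (FOb F X)),
     FArr = (\<lambda>X Y f. FArr G (FOb F X) (FOb F Y) (FArr F X Y f)),
     FTen = (\<lambda>X Y. Cmp E (TenO E (FOb G (FOb F X)) (FOb G (FOb F Y)))
        (FOb G (TenO D (FOb F X) (FOb F Y))) (FOb G (FOb F (TenO C X Y)))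
        (FArr G (TenO D (FOb F X) (FOb F Y)) (FOb F (TenO C X Y)) (FTen F X Y))
        (FTen G (FOb F X) (FOb F Y))),
     FUnit = Cmp E (Unit E) (FOb G (Unit D)) (FOb G (FOb F (Unit C)))
        (FArr G (Unit D) (FOb F (Unit C)) (FUnit F)) (FUnit G)\<rparr>"

text \<open>Equality of monoidal functors on \<open>C\<close>, disregarding values outside the objects and arrows.\<close>

definition monfctr_eq ::
  "('o, 'm) moncat \<Rightarrow> ('o, 'm, 'p, 'n) monfctr \<Rightarrow> ('o, 'm, 'p, 'n) monfctr \<Rightarrow> bool" where
  "monfctr_eq C F G \<longleftrightarrow>
     (\<forall>X \<in> Ob C. FOb F X = FOb G X) \<and>
     (\<forall>X \<in> Ob C. \<forall>Y \<in> Ob C. \<forall>f \<in> Hom C X Y. FArr F X Y f = FArr G X Y f) \<and>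
     (\<forall>X \<in> Ob C. \<forall>Y \<in> Ob C. FTen F X Y = FTen G X Y) \<and>
     FUnit F = FUnit G"


section \<open>Bisets over a monoid\<close>

text \<open>
  Small sets are the sets of elements of a type \<open>'u\<close>; the monoid itself is small. Throughout,
  \<open>p :: 'u \<times> 'u \<Rightarrow> 'u\<close> is an injective pairing, which exists for every infinite \<open>'u\<close> and makes
  binary products of small sets small. Structure maps are extensional in the sense of
  \<open>HOL-Library.FuncSet\<close>, so that equality of objects and arrows is the mathematical one.
\<close>

record 'u biset = "'u partial_object" +
  lact :: "'u \<Rightarrow> 'u \<Rightarrow> 'u"
  ract :: "'u \<Rightarrow> 'u \<Rightarrow> 'u"

definition is_biset :: "('u, 'z) monoid_scheme \<Rightarrow> 'u biset \<Rightarrow> bool" where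
  "is_biset A X \<longleftrightarrow>
     lact X \<in> carrier A \<rightarrow>\<^sub>E carrier X \<rightarrow>\<^sub>E carrier X \<and>
     ract X \<in> carrier X \<rightarrow>\<^sub>E carrier A \<rightarrow>\<^sub>E carrier X \<and>
     (\<forall>x \<in> carrier X. lact X \<one>\<^bsub>A\<^esub> x = x \<and> ract X x \<one>\<^bsub>A\<^esub> = x) \<and>
     (\<forall>a \<in> carrier A. \<forall>b \<in> carrier A. \<forall>x \<in> carrier X.
        lact X (a \<otimes>\<^bsub>A\<^esub> b) x = lact X a (lact X b x) \<and>
        ract X x (a \<otimes>\<^bsub>A\<^esub> b) = ract X (ract X x a) b \<and>
        ract X (lact X a x) b = lact X a (ract X x b))"

definition biset_hom :: "('u, 'z) monoid_scheme \<Rightarrow> 'u biset \<Rightarrow> 'u biset \<Rightarrow> ('u \<Rightarrow> 'u) set" where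
  "biset_hom A X Y = {f \<in> carrier X \<rightarrow>\<^sub>E carrier Y. \<forall>a \<in> carrier A. \<forall>x \<in> carrier X.
     f (lact X a x) = lact Y a (f x) \<and> f (ract X x a) = ract Y (f x) a}"

text \<open>
  The tensor product over \<open>A\<close> is the quotient of the product by the equivalence relation generated
  by \<open>(x a, y) \<sim> (x, a y)\<close>. To stay inside \<open>'u\<close>, an equivalence class is encoded as the image
  under \<open>p\<close> of a chosen representative: \<open>tens A p X Y x y\<close> is the class of \<open>(x, y)\<close>.
\<close>

definition balance :: "('u, 'z) monoid_scheme \<Rightarrow> 'u biset \<Rightarrow> 'u biset \<Rightarrow> (('u \<times> 'u) \<times> ('u \<times> 'u)) set" where
  "balance A X Y = {((ract X x a, y), (x, lact Y a y)) | x a y.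
     x \<in> carrier X \<and> a \<in> carrier A \<and> y \<in> carrier Y}"

definition tens_rel :: "('u, 'z) monoid_scheme \<Rightarrow> 'u biset \<Rightarrow> 'u biset \<Rightarrow> (('u \<times> 'u) \<times> ('u \<times> 'u)) set" where
  "tens_rel A X Y = (balance A X Y \<union> (balance A X Y)\<inverse>)\<^sup>*"

definition tens ::
  "('u, 'z) monoid_scheme \<Rightarrow> ('u \<times> 'u \<Rightarrow> 'u) \<Rightarrow> 'u biset \<Rightarrow> 'u biset \<Rightarrow> 'u \<Rightarrow> 'u \<Rightarrow> 'u" where
  "tens A p X Y x y = p (SOME q. q \<in> tens_rel A X Y `` {(x, y)})"

definition tens_carrier ::
  "('u, 'z) monoid_scheme \<Rightarrow> ('u \<times> 'u \<Rightarrow> 'u) \<Rightarrow> 'u biset \<Rightarrow> 'u biset \<Rightarrow> 'u set" where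
  "tens_carrier A p X Y = {tens A p X Y x y | x y. x \<in> carrier X \<and> y \<in> carrier Y}"

text \<open>\<open>tens_map A p X Y h\<close> is the map \<open>x \<otimes> y \<mapsto> h x y\<close>, computed on representatives; it is
  meaningful for balanced \<open>h\<close>.\<close>

definition tens_map ::
  "('u, 'z) monoid_scheme \<Rightarrow> ('u \<times> 'u \<Rightarrow> 'u) \<Rightarrow> 'u biset \<Rightarrow> 'u biset \<Rightarrow> ('u \<Rightarrow> 'u \<Rightarrow> 'u) \<Rightarrow> 'u \<Rightarrow> 'u" where
  "tens_map A p X Y h = (\<lambda>z \<in> tens_carrier A p X Y. case the_inv p z of (x, y) \<Rightarrow> h x y)"

definition biset_tens ::
  "('u, 'z) monoid_scheme \<Rightarrow> ('u \<times> 'u \<Rightarrow> 'u) \<Rightarrow> 'u biset \<Rightarrow> 'u biset \<Rightarrow> 'u biset" where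
  "biset_tens A p X Y = \<lparr>
     carrier = tens_carrier A p X Y,
     lact = (\<lambda>a \<in> carrier A. tens_map A p X Y (\<lambda>x y. tens A p X Y (lact X a x) y)),
     ract = (\<lambda>z \<in> tens_carrier A p X Y. \<lambda>a \<in> carrier A.
        tens_map A p X Y (\<lambda>x y. tens A p X Y x (ract Y y a)) z)\<rparr>"

definition biset_unit :: "('u, 'z) monoid_scheme \<Rightarrow> 'u biset" where
  "biset_unit A = \<lparr>
     carrier = carrier A,
     lact = (\<lambda>a \<in> carrier A. \<lambda>x \<in> carrier A. a \<otimes>\<^bsub>A\<^esub> x),
     ract = (\<lambda>x \<in> carrier A. \<lambda>a \<in> carrier A. x \<otimes>\<^bsub>A\<^esub> a)\<rparr>"

definition biset_cat ::
  "('u, 'z) monoid_scheme \<Rightarrow> ('u \<times> 'u \<Rightarrow> 'u) \<Rightarrow> ('u biset, 'u \<Rightarrow> 'u) moncat" where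
  "biset_cat A p = \<lparr>
     Ob = {X. is_biset A X},
     Hom = biset_hom A,
     Id = (\<lambda>X. \<lambda>x \<in> carrier X. x),
     Cmp = (\<lambda>X Y Z g f. compose (carrier X) g f),
     TenO = biset_tens A p,
     TenA = (\<lambda>X X' Y Y' f g. tens_map A p X Y (\<lambda>x y. tens A p X' Y' (f x) (g y))),
     Unit = biset_unit A,
     Assoc = (\<lambda>X Y Z. tens_map A p (biset_tens A p X Y) Z
        (\<lambda>w z. tens_map A p X Y (\<lambda>x y. tens A p X (biset_tens A p Y Z) x (tens A p Y Z y z)) w)),
     LUnit = (\<lambda>X. tens_map A p (biset_unit A) X (\<lambda>a x. lact X a x)),
     RUnit = (\<lambda>X. tens_map A p X (biset_unit A) (\<lambda>x a. ract X x a))\<rparr>"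


section \<open>Modules over a left bialgebroid\<close>

text \<open>The data of a left \<open>A\<close>-bialgebroid in \<open>Set\<close>; \<open>comult B f\<close> is an element of the biset tensor
  product of the underlying bisets, i.e. an encoded class of pairs \<open>f\<^sub>(\<^sub>1\<^sub>) \<otimes> f\<^sub>(\<^sub>2\<^sub>)\<close>.\<close>

record 'u bialgebroid = "'u monoid" +
  source :: "'u \<Rightarrow> 'u"
  target :: "'u \<Rightarrow> 'u"
  comult :: "'u \<Rightarrow> 'u"
  counit :: "'u \<Rightarrow> 'u"

record 'u lset = "'u partial_object" +
  act :: "'u \<Rightarrow> 'u \<Rightarrow> 'u"

definition is_lset :: "('u, 'z) monoid_scheme \<Rightarrow> 'u lset \<Rightarrow> bool" where
  "is_lset B X \<longleftrightarrow>
     act X \<in> carrier B \<rightarrow>\<^sub>E carrier X \<rightarrow>\<^sub>E carrier X \<and>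
     (\<forall>x \<in> carrier X. act X \<one>\<^bsub>B\<^esub> x = x) \<and>
     (\<forall>f \<in> carrier B. \<forall>g \<in> carrier B. \<forall>x \<in> carrier X.
        act X (f \<otimes>\<^bsub>B\<^esub> g) x = act X f (act X g x))"

definition lset_hom :: "('u, 'z) monoid_scheme \<Rightarrow> 'u lset \<Rightarrow> 'u lset \<Rightarrow> ('u \<Rightarrow> 'u) set" where
  "lset_hom B X Y = {h \<in> carrier X \<rightarrow>\<^sub>E carrier Y. \<forall>f \<in> carrier B. \<forall>x \<in> carrier X.
     h (act X f x) = act Y f (h x)}"

definition lset_biset :: "('u, 'z) monoid_scheme \<Rightarrow> 'u bialgebroid \<Rightarrow> 'u lset \<Rightarrow> 'u biset" where
  "lset_biset A B X = \<lparr>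
     carrier = carrier X,
     lact = (\<lambda>a \<in> carrier A. \<lambda>x \<in> carrier X. act X (source B a) x),
     ract = (\<lambda>x \<in> carrier X. \<lambda>a \<in> carrier A. act X (target B a) x)\<rparr>"

definition lset_tens ::
  "('u, 'z) monoid_scheme \<Rightarrow> ('u \<times> 'u \<Rightarrow> 'u) \<Rightarrow> 'u bialgebroid \<Rightarrow> 'u lset \<Rightarrow> 'u lset \<Rightarrow> 'u lset" where
  "lset_tens A p B X Y = \<lparr>
     carrier = tens_carrier A p (lset_biset A B X) (lset_biset A B Y),
     act = (\<lambda>f \<in> carrier B. tens_map A p (lset_biset A B X) (lset_biset A B Y)
        (\<lambda>x y. case the_inv p (comult B f) of (f1, f2) \<Rightarrow>
           tens A p (lset_biset A B X) (lset_biset A B Y) (act X f1 x) (act Y f2 y)))\<rparr>"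

definition lset_unit :: "('u, 'z) monoid_scheme \<Rightarrow> 'u bialgebroid \<Rightarrow> 'u lset" where
  "lset_unit A B = \<lparr>
     carrier = carrier A,
     act = (\<lambda>f \<in> carrier B. \<lambda>a \<in> carrier A. counit B (f \<otimes>\<^bsub>B\<^esub> source B a))\<rparr>"

definition lset_cat ::
  "('u, 'z) monoid_scheme \<Rightarrow> ('u \<times> 'u \<Rightarrow> 'u) \<Rightarrow> 'u bialgebroid \<Rightarrow> ('u lset, 'u \<Rightarrow> 'u) moncat" where
  "lset_cat A p B = \<lparr>
     Ob = {X. is_lset B X},
     Hom = lset_hom B,
     Id = (\<lambda>X. \<lambda>x \<in> carrier X. x),
     Cmp = (\<lambda>X Y Z g f. compose (carrier X) g f),
     TenO = lset_tens A p B,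
     TenA = (\<lambda>X X' Y Y'. TenA (biset_cat A p)
        (lset_biset A B X) (lset_biset A B X') (lset_biset A B Y) (lset_biset A B Y')),
     Unit = lset_unit A B,
     Assoc = (\<lambda>X Y Z. Assoc (biset_cat A p)
        (lset_biset A B X) (lset_biset A B Y) (lset_biset A B Z)),
     LUnit = (\<lambda>X. LUnit (biset_cat A p) (lset_biset A B X)),
     RUnit = (\<lambda>X. RUnit (biset_cat A p) (lset_biset A B X))\<rparr>"

text \<open>The forgetful functor is strict monoidal: its structure maps are identities.\<close>

definition forgetful ::
  "('u, 'z) monoid_scheme \<Rightarrow> ('u \<times> 'u \<Rightarrow> 'u) \<Rightarrow> 'u bialgebroid \<Rightarrow>
     ('u lset, 'u \<Rightarrow> 'u, 'u biset, 'u \<Rightarrow> 'u) monfctr" where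
  "forgetful A p B = \<lparr>
     FOb = lset_biset A B,
     FArr = (\<lambda>X Y h. h),
     FTen = (\<lambda>X Y. Id (biset_cat A p) (biset_tens A p (lset_biset A B X) (lset_biset A B Y))),
     FUnit = Id (biset_cat A p) (biset_unit A)\<rparr>"

definition source_regular :: "('u, 'z) monoid_scheme \<Rightarrow> 'u bialgebroid \<Rightarrow> 'u lset \<Rightarrow> bool" where
  "source_regular A B X \<longleftrightarrow> (\<exists>h. bij_betw h (carrier A) (carrier X) \<and>
     (\<forall>a \<in> carrier A. \<forall>b \<in> carrier A. h (a \<otimes>\<^bsub>A\<^esub> b) = act X (source B a) (h b)))"

definition reg_lset_cat ::
  "('u, 'z) monoid_scheme \<Rightarrow> ('u \<times> 'u \<Rightarrow> 'u) \<Rightarrow> 'u bialgebroid \<Rightarrow> ('u lset, 'u \<Rightarrow> 'u) moncat" where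
  "reg_lset_cat A p B = full_subcat (lset_cat A p B) (source_regular A B)"


section \<open>Skew monoidal monoids\<close>

record 'u skew_monoid = "'u monoid" +
  T_end :: "'u \<Rightarrow> 'u" ("\<T>\<index>")
  Q_end :: "'u \<Rightarrow> 'u" ("\<Q>\<index>")
  gamma_el :: "'u" ("\<gamma>\<index>")
  eta_el :: "'u" ("\<eta>\<index>")
  eps_el :: "'u" ("\<epsilon>\<index>")

locale skew_monoidal_monoid = monoid A
  for A :: "('u, 'z) skew_monoid_scheme" (structure) +
  assumes T_hom: "\<T> \<in> hom A A" and T_one: "\<T> \<one> = \<one>"
    and Q_hom: "\<Q> \<in> hom A A" and Q_one: "\<Q> \<one> = \<one>"
    and gamma_closed: "\<gamma> \<in> carrier A"
    and eta_closed: "\<eta> \<in> carrier A"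
    and eps_closed: "\<epsilon> \<in> carrier A"
    and TQ_commute: "\<lbrakk>a \<in> carrier A; b \<in> carrier A\<rbrakk> \<Longrightarrow> \<T> a \<otimes> \<Q> b = \<Q> b \<otimes> \<T> a"
    and gamma_TT: "a \<in> carrier A \<Longrightarrow> \<gamma> \<otimes> \<T> (\<T> a) = \<T> a \<otimes> \<gamma>"
    and gamma_TQ: "a \<in> carrier A \<Longrightarrow> \<gamma> \<otimes> \<T> (\<Q> a) = \<Q> (\<T> a) \<otimes> \<gamma>"
    and gamma_Q: "a \<in> carrier A \<Longrightarrow> \<gamma> \<otimes> \<Q> a = \<Q> (\<Q> a) \<otimes> \<gamma>"
    and eta_T: "a \<in> carrier A \<Longrightarrow> \<eta> \<otimes> a = \<T> a \<otimes> \<eta>"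
    and eps_Q: "a \<in> carrier A \<Longrightarrow> a \<otimes> \<epsilon> = \<epsilon> \<otimes> \<Q> a"
    and gamma_pentagon: "\<Q> \<gamma> \<otimes> \<gamma> \<otimes> \<T> \<gamma> = \<gamma> \<otimes> \<gamma>"
    and gamma_eta: "\<gamma> \<otimes> \<eta> = \<Q> \<eta>"
    and eps_gamma: "\<epsilon> \<otimes> \<gamma> = \<T> \<epsilon>"
    and eps_gamma_eta: "\<Q> \<epsilon> \<otimes> \<gamma> \<otimes> \<T> \<eta> = \<one>"
    and eps_eta: "\<epsilon> \<otimes> \<eta> = \<one>"

definition mu_el :: "('u, 'z) skew_monoid_scheme \<Rightarrow> 'u" ("\<mu>\<index>") where
  "\<mu>\<^bsub>A\<^esub> = \<Q>\<^bsub>A\<^esub> \<epsilon>\<^bsub>A\<^esub> \<otimes>\<^bsub>A\<^esub> \<gamma>\<^bsub>A\<^esub>"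

definition delta_el :: "('u, 'z) skew_monoid_scheme \<Rightarrow> 'u" ("\<delta>\<index>") where
  "\<delta>\<^bsub>A\<^esub> = \<gamma>\<^bsub>A\<^esub> \<otimes>\<^bsub>A\<^esub> \<T>\<^bsub>A\<^esub> \<eta>\<^bsub>A\<^esub>"

definition S_map :: "('u, 'z) skew_monoid_scheme \<Rightarrow> 'u \<Rightarrow> 'u" ("\<S>\<index>") where
  "\<S>\<^bsub>A\<^esub> a = \<mu>\<^bsub>A\<^esub> \<otimes>\<^bsub>A\<^esub> \<T>\<^bsub>A\<^esub> (\<Q>\<^bsub>A\<^esub> a \<otimes>\<^bsub>A\<^esub> \<eta>\<^bsub>A\<^esub>)"

definition comod_hom :: "('u, 'z) skew_monoid_scheme \<Rightarrow> 'u \<Rightarrow> 'u \<Rightarrow> 'u set" where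
  "comod_hom A u v = {s \<in> carrier A. \<Q>\<^bsub>A\<^esub> s \<otimes>\<^bsub>A\<^esub> u = v \<otimes>\<^bsub>A\<^esub> s}"

definition comod_cat :: "('u, 'z) skew_monoid_scheme \<Rightarrow> ('u, 'u) moncat" where
  "comod_cat A = \<lparr>
     Ob = {u \<in> carrier A. \<Q>\<^bsub>A\<^esub> u \<otimes>\<^bsub>A\<^esub> u = \<delta>\<^bsub>A\<^esub> \<otimes>\<^bsub>A\<^esub> u \<and> \<epsilon>\<^bsub>A\<^esub> \<otimes>\<^bsub>A\<^esub> u = \<one>\<^bsub>A\<^esub>},
     Hom = comod_hom A,
     Id = (\<lambda>u. \<one>\<^bsub>A\<^esub>),
     Cmp = (\<lambda>u v w t s. t \<otimes>\<^bsub>A\<^esub> s),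
     TenO = (\<lambda>u v. \<mu>\<^bsub>A\<^esub> \<otimes>\<^bsub>A\<^esub> \<T>\<^bsub>A\<^esub> v \<otimes>\<^bsub>A\<^esub> u),
     TenA = (\<lambda>u1 v1 u2 v2 s t. s \<otimes>\<^bsub>A\<^esub> \<epsilon>\<^bsub>A\<^esub> \<otimes>\<^bsub>A\<^esub> \<T>\<^bsub>A\<^esub> t \<otimes>\<^bsub>A\<^esub> u1),
     Unit = \<eta>\<^bsub>A\<^esub>,
     Assoc = (\<lambda>u v w. \<one>\<^bsub>A\<^esub>),
     LUnit = (\<lambda>u. \<one>\<^bsub>A\<^esub>),
     RUnit = (\<lambda>u. \<one>\<^bsub>A\<^esub>)\<rparr>"

definition hom_biset :: "('u, 'z) skew_monoid_scheme \<Rightarrow> 'u \<Rightarrow> 'u biset" where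
  "hom_biset A u = \<lparr>
     carrier = comod_hom A u \<delta>\<^bsub>A\<^esub>,
     lact = (\<lambda>a \<in> carrier A. \<lambda>s \<in> comod_hom A u \<delta>\<^bsub>A\<^esub>. \<Q>\<^bsub>A\<^esub> a \<otimes>\<^bsub>A\<^esub> s),
     ract = (\<lambda>s \<in> comod_hom A u \<delta>\<^bsub>A\<^esub>. \<lambda>a \<in> carrier A. \<S>\<^bsub>A\<^esub> a \<otimes>\<^bsub>A\<^esub> s)\<rparr>"

definition assoc_bialgebroid ::
  "('u, 'z) skew_monoid_scheme \<Rightarrow> ('u \<times> 'u \<Rightarrow> 'u) \<Rightarrow> 'u bialgebroid" where
  "assoc_bialgebroid A p = \<lparr>
     carrier = comod_hom A \<delta>\<^bsub>A\<^esub> \<delta>\<^bsub>A\<^esub>,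
     mult = (\<otimes>\<^bsub>A\<^esub>),
     one = \<one>\<^bsub>A\<^esub>,
     source = \<Q>\<^bsub>A\<^esub>,
     target = \<S>\<^bsub>A\<^esub>,
     comult = (\<lambda>f. tens A p (hom_biset A \<delta>\<^bsub>A\<^esub>) (hom_biset A \<delta>\<^bsub>A\<^esub>)
        (\<Q>\<^bsub>A\<^esub> (\<epsilon>\<^bsub>A\<^esub> \<otimes>\<^bsub>A\<^esub> f \<otimes>\<^bsub>A\<^esub> \<mu>\<^bsub>A\<^esub>) \<otimes>\<^bsub>A\<^esub> \<delta>\<^bsub>A\<^esub>) \<delta>\<^bsub>A\<^esub>),
     counit = (\<lambda>f. \<epsilon>\<^bsub>A\<^esub> \<otimes>\<^bsub>A\<^esub> f \<otimes>\<^bsub>A\<^esub> \<eta>\<^bsub>A\<^esub>)\<rparr>"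

text \<open>
  The functor \<open>\<A>\<^sub>Q(-, \<delta>)\<close>, with the structure maps \<open>s \<otimes> t \<mapsto> \<mu> \<circ> (s \<otimes> t)\<close> and
  \<open>a \<mapsto> a \<cdot> \<eta>\<close> induced by the monoid \<open>(\<delta>, \<mu>, \<eta>)\<close>. As an arrow \<open>u \<rightarrow> v\<close> of the opposite category,
  \<open>s\<close> is an arrow \<open>v \<rightarrow> u\<close> and acts by precomposition.
\<close>

definition hom_functor ::
  "('u, 'z) skew_monoid_scheme \<Rightarrow> ('u \<times> 'u \<Rightarrow> 'u) \<Rightarrow> ('u, 'u, 'u biset, 'u \<Rightarrow> 'u) monfctr" where
  "hom_functor A p = \<lparr>
     FOb = hom_biset A,
     FArr = (\<lambda>u v s. \<lambda>t \<in> comod_hom A u \<delta>\<^bsub>A\<^esub>. t \<otimes>\<^bsub>A\<^esub> s),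
     FTen = (\<lambda>u v. tens_map A p (hom_biset A u) (hom_biset A v)
        (\<lambda>s t. \<mu>\<^bsub>A\<^esub> \<otimes>\<^bsub>A\<^esub> TenA (comod_cat A) u \<delta>\<^bsub>A\<^esub> v \<delta>\<^bsub>A\<^esub> s t)),
     FUnit = (\<lambda>a \<in> carrier A. \<Q>\<^bsub>A\<^esub> a \<otimes>\<^bsub>A\<^esub> \<eta>\<^bsub>A\<^esub>)\<rparr>"

definition hom_lset ::
  "('u, 'z) skew_monoid_scheme \<Rightarrow> 'u \<Rightarrow> 'u lset" where
  "hom_lset A u = \<lparr>
     carrier = comod_hom A u \<delta>\<^bsub>A\<^esub>,
     act = (\<lambda>f \<in> comod_hom A \<delta>\<^bsub>A\<^esub> \<delta>\<^bsub>A\<^esub>. \<lambda>s \<in> comod_hom A u \<delta>\<^bsub>A\<^esub>. f \<otimes>\<^bsub>A\<^esub> s)\<rparr>"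

definition hom_lset_functor ::
  "('u, 'z) skew_monoid_scheme \<Rightarrow> ('u \<times> 'u \<Rightarrow> 'u) \<Rightarrow> ('u, 'u, 'u lset, 'u \<Rightarrow> 'u) monfctr" where
  "hom_lset_functor A p = \<lparr>
     FOb = hom_lset A,
     FArr = FArr (hom_functor A p),
     FTen = FTen (hom_functor A p),
     FUnit = FUnit (hom_functor A p)\<rparr>"

end

theory Submission
  imports Defs
begin

text \<open>
  Every arrow \<open>s : u \<rightarrow> \<delta>\<close> is \<open>Q(a) u\<close> for the unique coordinate \<open>a = \<epsilon> s\<close>. In coordinates the right
  action of \<open>c\<close> is \<open>a \<mapsto> a \<epsilon> T(c) u\<close> and the structure map \<open>\<mu> \<circ> (s \<otimes> t)\<close> is
  \<open>(a, b) \<mapsto> a \<epsilon> T(b) u\<close>, which is bijective because \<open>t = b \<cdot> v\<close> can be moved across the tensor sign to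
  give \<open>s \<otimes> t = (s \<cdot> b) \<otimes> v\<close>. Since \<open>F = Q(A) \<delta>\<close>, a map of bisets is \<open>F\<close>-linear as soon as it commutes
  with \<open>\<delta>\<close>, and \<open>\<Delta>(\<delta>) = Q(\<mu>) \<delta> \<otimes> \<delta>\<close>. A source-regular module is \<open>Q(A) x\<close> for some generator \<open>x\<close>;
  writing \<open>\<delta> x = Q(u) x\<close>, the module axioms say that \<open>u\<close> is an object of \<open>\<A>\<^sub>Q\<close>, and the module is
  \<open>\<A>\<^sub>Q(u, \<delta>)\<close>.
\<close>

section \<open>Tensor products of bisets\<close>

text \<open>The laws of the bialgebroid \<open>F\<close> enter only through their effect on modules.
  Extensionality of the structure maps makes the biset underlying a tensor product of
  \<open>F\<close>-sets equal to the tensor product of the underlying bisets, so the coherence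
  equations of \<open>F\<close>-sets are those of bisets. What remains are a few identities of the
  monoid on \<open>\<delta>\<close>: \<open>mu_S\<close> makes the action on a tensor product well
  defined, \<open>delta_mu\<close> (\<open>\<mu>\<close> is an arrow) makes it multiplicative,
  associativity \<open>mu_mu\<close> makes the associator linear, the unit law \<open>mu_eta\<close>
  the left unit constraint, and the very definition of \<open>\<S>\<close> the right one. Closure of
  source-regularity under tensor products is hard to see on generators of arbitrary modules. It is
  deduced after each such module has been represented by a comodule, from the structure isomorphisms
  of the functor itself.\<close>

definition balanced :: "('u, 'z) monoid_scheme \<Rightarrow> 'u biset \<Rightarrow> 'u biset \<Rightarrow> ('u \<Rightarrow> 'u \<Rightarrow> 'v) \<Rightarrow> bool" where
  "balanced A X Y h \<longleftrightarrow> (\<forall>x \<in> carrier X. \<forall>a \<in> carrier A. \<forall>y \<in> carrier Y.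
     h (ract X x a) y = h x (lact Y a y))"

lemma balancedI:
  "(\<And>x a y. \<lbrakk>x \<in> carrier X; a \<in> carrier A; y \<in> carrier Y\<rbrakk> \<Longrightarrow> h (ract X x a) y = h x (lact Y a y))
    \<Longrightarrow> balanced A X Y h"
  by (simp add: balanced_def)

section \<open>Laws of bisets and of their maps\<close>

lemma biset_closed [simp]:
  assumes "is_biset A X" "a \<in> carrier A" "x \<in> carrier X"
  shows "lact X a x \<in> carrier X" "ract X x a \<in> carrier X"
  using assms unfolding is_biset_def by (metis PiE_mem)+

lemma biset_laws:
  assumes "is_biset A X" "x \<in> carrier X"
  shows biset_lact_one: "lact X \<one>\<^bsub>A\<^esub> x = x" and biset_ract_one: "ract X x \<one>\<^bsub>A\<^esub> = x"
    and biset_lact_mult: "\<lbrakk>a \<in> carrier A; b \<in> carrier A\<rbrakk> \<Longrightarrow> lact X (a \<otimes>\<^bsub>A\<^esub> b) x = lact X a (lact X b x)"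
    and biset_ract_mult: "\<lbrakk>a \<in> carrier A; b \<in> carrier A\<rbrakk> \<Longrightarrow> ract X x (a \<otimes>\<^bsub>A\<^esub> b) = ract X (ract X x a) b"
    and biset_ract_lact: "\<lbrakk>a \<in> carrier A; b \<in> carrier A\<rbrakk> \<Longrightarrow> ract X (lact X a x) b = lact X a (ract X x b)"
  using assms unfolding is_biset_def by blast+

lemma biset_homD:
  assumes "f \<in> biset_hom A X Y"
  shows biset_hom_extensional: "f \<in> extensional (carrier X)"
    and biset_hom_closed: "x \<in> carrier X \<Longrightarrow> f x \<in> carrier Y"
    and biset_hom_lact: "\<lbrakk>a \<in> carrier A; x \<in> carrier X\<rbrakk> \<Longrightarrow> f (lact X a x) = lact Y a (f x)"
    and biset_hom_ract: "\<lbrakk>a \<in> carrier A; x \<in> carrier X\<rbrakk> \<Longrightarrow> f (ract X x a) = ract Y (f x) a"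
  using assms unfolding biset_hom_def by (auto simp: PiE_iff)

lemma biset_homI:
  assumes "f \<in> extensional (carrier X)" "\<And>x. x \<in> carrier X \<Longrightarrow> f x \<in> carrier Y"
    and "\<And>a x. \<lbrakk>a \<in> carrier A; x \<in> carrier X\<rbrakk> \<Longrightarrow> f (lact X a x) = lact Y a (f x)"
    and "\<And>a x. \<lbrakk>a \<in> carrier A; x \<in> carrier X\<rbrakk> \<Longrightarrow> f (ract X x a) = ract Y (f x) a"
  shows "f \<in> biset_hom A X Y"
  using assms unfolding biset_hom_def by (auto simp: PiE_iff)

lemma biset_hom_Id [simp]: "is_biset A X \<Longrightarrow> (\<lambda>x \<in> carrier X. x) \<in> biset_hom A X X"
  by (rule biset_homI) auto

lemma biset_hom_compose:
  assumes "is_biset A X" "f \<in> biset_hom A X Y" "g \<in> biset_hom A Y Z"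
  shows "compose (carrier X) g f \<in> biset_hom A X Z"
  using assms
  by (intro biset_homI) (auto simp: compose_eq biset_hom_closed biset_hom_lact biset_hom_ract
      biset_hom_closed[OF assms(2)] biset_hom_lact[OF assms(2)] biset_hom_ract[OF assms(2)])

lemma biset_unit_simps [simp]:
  "carrier (biset_unit A) = carrier A"
  "\<lbrakk>a \<in> carrier A; x \<in> carrier A\<rbrakk> \<Longrightarrow> lact (biset_unit A) a x = a \<otimes>\<^bsub>A\<^esub> x"
  "\<lbrakk>a \<in> carrier A; x \<in> carrier A\<rbrakk> \<Longrightarrow> ract (biset_unit A) x a = x \<otimes>\<^bsub>A\<^esub> a"
  by (simp_all add: biset_unit_def)

lemma (in monoid) is_biset_unit [simp]: "is_biset G (biset_unit G)"
  by (auto simp: is_biset_def m_assoc) (auto simp: biset_unit_def)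

lemma (in monoid) biset_hom_Id_unit [simp]: "(\<lambda>x \<in> carrier G. x) \<in> biset_hom G (biset_unit G) (biset_unit G)"
  using biset_hom_Id[OF is_biset_unit] by simp

locale biset_tensor = monoid A for A :: "('u, 'z) monoid_scheme" (structure) +
  fixes p :: "'u \<times> 'u \<Rightarrow> 'u"
  assumes inj_p: "inj p"
begin

abbreviation tensor_el :: "'u biset \<Rightarrow> 'u biset \<Rightarrow> 'u \<Rightarrow> 'u \<Rightarrow> 'u" where
  "tensor_el \<equiv> tens A p"

abbreviation tensor :: "'u biset \<Rightarrow> 'u biset \<Rightarrow> 'u biset"  (infixl "\<odot>" 70) where
  "X \<odot> Y \<equiv> biset_tens A p X Y"

section \<open>The balancing equivalence and maps out of the quotient\<close>

lemma tens_rel_sym: "(q, q') \<in> tens_rel A X Y \<Longrightarrow> (q', q) \<in> tens_rel A X Y"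
  unfolding tens_rel_def by (rule symD[OF sym_rtrancl]) (auto intro: symI)

lemma tens_rel_trans: "\<lbrakk>(q, q') \<in> tens_rel A X Y; (q', q'') \<in> tens_rel A X Y\<rbrakk> \<Longrightarrow> (q, q'') \<in> tens_rel A X Y"
  unfolding tens_rel_def by (rule rtrancl_trans)

lemma tens_eqI: "((x, y), (x', y')) \<in> tens_rel A X Y \<Longrightarrow> tensor_el X Y x y = tensor_el X Y x' y'"
  unfolding tens_def
  by (rule arg_cong[where f = "\<lambda>S. p (SOME q. q \<in> S)"])
     (auto intro: tens_rel_trans tens_rel_sym)

text \<open>Injectivity of \<open>p\<close> lets \<open>the_inv p\<close> recover the representative
  hidden in the code. Nothing is known about the chosen pair except that it is related to
  \<open>(x, y)\<close>.\<close>

lemma tens_rep: "((x, y), the_inv p (tensor_el X Y x y)) \<in> tens_rel A X Y"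
proof -
  have "(x, y) \<in> tens_rel A X Y `` {(x, y)}"
    by (simp add: tens_rel_def)
  then have "(SOME q. q \<in> tens_rel A X Y `` {(x, y)}) \<in> tens_rel A X Y `` {(x, y)}"
    by (metis someI)
  then show ?thesis
    by (simp add: tens_def the_inv_f_f[OF inj_p])
qed

lemma tens_balance [simp]:
  assumes "x \<in> carrier X" "a \<in> carrier A" "y \<in> carrier Y"
  shows "tensor_el X Y (ract X x a) y = tensor_el X Y x (lact Y a y)"
proof (rule tens_eqI)
  have "((ract X x a, y), (x, lact Y a y)) \<in> balance A X Y"
    using assms by (auto simp: balance_def)
  then show "((ract X x a, y), (x, lact Y a y)) \<in> tens_rel A X Y"
    by (auto simp: tens_rel_def)
qed

text \<open>\<open>tens_rel\<close> is reflexive on all pairs, so membership in the carriers is part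
  of the invariant. Both directions of a balancing step preserve it, because the actions stay inside
  the carriers.\<close>

lemma tens_rel_invariant:
  assumes "is_biset A X" "is_biset A Y" "(q, q') \<in> tens_rel A X Y" "fst q \<in> carrier X" "snd q \<in> carrier Y"
  shows "fst q' \<in> carrier X \<and> snd q' \<in> carrier Y \<and>
    (balanced A X Y h \<longrightarrow> h (fst q') (snd q') = h (fst q) (snd q))"
  using assms(3) unfolding tens_rel_def
proof (induction rule: rtrancl_induct)
  case base
  then show ?case using assms by simp
next
  case (step q' q'')
  then show ?case using assms(1,2) by (auto simp: balance_def balanced_def)
qed

lemma tens_carrier_mem [simp]:
  "\<lbrakk>x \<in> carrier X; y \<in> carrier Y\<rbrakk> \<Longrightarrow> tensor_el X Y x y \<in> tens_carrier A p X Y"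
  by (auto simp: tens_carrier_def)

lemma carrier_tensor [simp]: "carrier (X \<odot> Y) = tens_carrier A p X Y"
  by (simp add: biset_tens_def)

lemma tens_cases:
  assumes "z \<in> tens_carrier A p X Y"
  obtains x y where "x \<in> carrier X" "y \<in> carrier Y" "z = tensor_el X Y x y"
  using assms by (auto simp: tens_carrier_def)

lemma tens_rep_invariant:
  assumes "is_biset A X" "is_biset A Y" "balanced A X Y h" "x \<in> carrier X" "y \<in> carrier Y"
  shows "(case the_inv p (tensor_el X Y x y) of (x', y') \<Rightarrow> h x' y') = h x y"
  using tens_rel_invariant[OF assms(1,2) tens_rep, of x y h] assms(3-5)
  by (auto simp: case_prod_unfold)

text \<open>The universal property of the tensor product: \<open>tens_map\<close> evaluates
  \<open>h\<close> at an unknown representative, and balancedness makes the value agree with the one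
  at \<open>(x, y)\<close>.\<close>

lemma tens_map_apply:
  assumes "is_biset A X" "is_biset A Y" "balanced A X Y h" "x \<in> carrier X" "y \<in> carrier Y"
  shows "tens_map A p X Y h (tensor_el X Y x y) = h x y"
  using tens_rep_invariant[OF assms] assms(4,5) by (simp add: tens_map_def)

lemma tens_map_extensional [simp]: "tens_map A p X Y h \<in> extensional (tens_carrier A p X Y)"
  by (simp add: tens_map_def)

text \<open>Every element is the class of a pair, so the naturality and coherence equations of
  bisets reduce to pure tensors through this lemma.\<close>

lemma tens_ext:
  assumes "f \<in> extensional (tens_carrier A p X Y)" "g \<in> extensional (tens_carrier A p X Y)"
    and "\<And>x y. \<lbrakk>x \<in> carrier X; y \<in> carrier Y\<rbrakk> \<Longrightarrow> f (tensor_el X Y x y) = g (tensor_el X Y x y)"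
  shows "f = g"
  using assms(1,2) by (rule extensionalityI) (use assms(3) in \<open>auto elim!: tens_cases\<close>)

text \<open>Rests on the chosen representative lying in the carriers. Hence the function behind the
  \<open>F\<close>-action on a tensor product can be rewritten before it is known to be
  balanced.\<close>

lemma tens_map_cong:
  assumes "is_biset A X" "is_biset A Y"
    and "\<And>x y. \<lbrakk>x \<in> carrier X; y \<in> carrier Y\<rbrakk> \<Longrightarrow> h x y = h' x y"
  shows "tens_map A p X Y h = tens_map A p X Y h'"
proof (rule tens_ext)
  fix x y assume xy: "x \<in> carrier X" "y \<in> carrier Y"
  obtain x' y' where e: "the_inv p (tensor_el X Y x y) = (x', y')" by fastforce
  then have "x' \<in> carrier X" "y' \<in> carrier Y"
    using tens_rel_invariant[OF assms(1,2) tens_rep, of x y] xy by auto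
  then show "tens_map A p X Y h (tensor_el X Y x y) = tens_map A p X Y h' (tensor_el X Y x y)"
    using xy e assms(3) by (simp add: tens_map_def)
qed simp_all

section \<open>The biset structure of the tensor product\<close>

lemma lact_tensor [simp]:
  assumes "is_biset A X" "is_biset A Y" "a \<in> carrier A" "x \<in> carrier X" "y \<in> carrier Y"
  shows "lact (X \<odot> Y) a (tensor_el X Y x y) = tensor_el X Y (lact X a x) y"
  unfolding biset_tens_def using assms
  by (subst biset.simps, subst restrict_apply', simp, subst tens_map_apply)
     (auto intro!: balancedI simp flip: biset_ract_lact)

lemma ract_tensor [simp]:
  assumes "is_biset A X" "is_biset A Y" "a \<in> carrier A" "x \<in> carrier X" "y \<in> carrier Y"
  shows "ract (X \<odot> Y) (tensor_el X Y x y) a = tensor_el X Y x (ract Y y a)"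
  unfolding biset_tens_def using assms
  by (simp, subst tens_map_apply)
     (auto intro!: balancedI simp: biset_ract_lact)

lemma is_biset_tensor [simp]:
  assumes "is_biset A X" "is_biset A Y"
  shows "is_biset A (X \<odot> Y)"
proof -
  have "lact (X \<odot> Y) \<in> carrier A \<rightarrow>\<^sub>E tens_carrier A p X Y \<rightarrow>\<^sub>E tens_carrier A p X Y"
    using assms by (auto intro!: PiE_I elim!: tens_cases) (auto simp: biset_tens_def tens_map_def)
  moreover have "ract (X \<odot> Y) \<in> tens_carrier A p X Y \<rightarrow>\<^sub>E carrier A \<rightarrow>\<^sub>E tens_carrier A p X Y"
    using assms by (auto intro!: PiE_I elim!: tens_cases) (auto simp: biset_tens_def tens_map_def)
  ultimately show ?thesis
    using assms unfolding is_biset_def[of A "X \<odot> Y"]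
    by (auto elim!: tens_cases simp: biset_laws[OF assms(1)] biset_laws[OF assms(2)])
qed

lemma biset_hom_tensorI:
  assumes "is_biset A X" "is_biset A Y" "f \<in> extensional (tens_carrier A p X Y)"
    and "\<And>x y. \<lbrakk>x \<in> carrier X; y \<in> carrier Y\<rbrakk> \<Longrightarrow> f (tensor_el X Y x y) \<in> carrier Z"
    and "\<And>a x y. \<lbrakk>a \<in> carrier A; x \<in> carrier X; y \<in> carrier Y\<rbrakk> \<Longrightarrow>
      f (tensor_el X Y (lact X a x) y) = lact Z a (f (tensor_el X Y x y))"
    and "\<And>a x y. \<lbrakk>a \<in> carrier A; x \<in> carrier X; y \<in> carrier Y\<rbrakk> \<Longrightarrow>
      f (tensor_el X Y x (ract Y y a)) = ract Z (f (tensor_el X Y x y)) a"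
  shows "f \<in> biset_hom A (X \<odot> Y) Z"
  using assms by (intro biset_homI) (auto elim!: tens_cases)

section \<open>The monoidal category of bisets\<close>

abbreviation bisets :: "('u biset, 'u \<Rightarrow> 'u) moncat" where
  "bisets \<equiv> biset_cat A p"

lemma biset_cat_simps [simp]:
  "Ob bisets = {X. is_biset A X}" "Hom bisets = biset_hom A"
  "Id bisets X = (\<lambda>x \<in> carrier X. x)" "Cmp bisets X Y Z g f = compose (carrier X) g f"
  "TenO bisets = biset_tens A p" "Unit bisets = biset_unit A"
  by (simp_all add: biset_cat_def)

lemma TenA_extensional [simp]: "TenA bisets X X' Y Y' f g \<in> extensional (tens_carrier A p X Y)"
  and Assoc_extensional [simp]: "Assoc bisets X Y Z \<in> extensional (tens_carrier A p (X \<odot> Y) Z)"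
  and LUnit_extensional [simp]: "LUnit bisets X \<in> extensional (tens_carrier A p (biset_unit A) X)"
  and RUnit_extensional [simp]: "RUnit bisets X \<in> extensional (tens_carrier A p X (biset_unit A))"
  by (simp_all add: biset_cat_def)

lemma TenA_apply:
  assumes "is_biset A X" "is_biset A Y" "f \<in> biset_hom A X X'" "g \<in> biset_hom A Y Y'"
    "x \<in> carrier X" "y \<in> carrier Y"
  shows "TenA bisets X X' Y Y' f g (tensor_el X Y x y) = tensor_el X' Y' (f x) (g y)"
  unfolding biset_cat_def using assms
  by (simp, subst tens_map_apply)
     (auto intro!: balancedI simp: biset_homD[OF assms(3)] biset_homD[OF assms(4)])

lemma TenA_biset_hom:
  assumes "is_biset A X" "is_biset A Y" "is_biset A X'" "is_biset A Y'"
    "f \<in> biset_hom A X X'" "g \<in> biset_hom A Y Y'"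
  shows "TenA bisets X X' Y Y' f g \<in> biset_hom A (X \<odot> Y) (X' \<odot> Y')"
  using assms
  by (intro biset_hom_tensorI)
     (auto simp: TenA_apply biset_homD[OF assms(5)] biset_homD[OF assms(6)])

lemma Assoc_apply:
  assumes "is_biset A X" "is_biset A Y" "is_biset A Z" "x \<in> carrier X" "y \<in> carrier Y" "z \<in> carrier Z"
  shows "Assoc bisets X Y Z (tensor_el (X \<odot> Y) Z (tensor_el X Y x y) z) =
    tensor_el X (Y \<odot> Z) x (tensor_el Y Z y z)"
proof -
  \<comment> \<open>For fixed \<open>z\<close> the inner map has to be balanced on its own; only
    then can the outer map, which applies it to a class, be evaluated and shown to be
    balanced.\<close>
  have inner: "tens_map A p X Y (\<lambda>x y. tensor_el X (Y \<odot> Z) x (tensor_el Y Z y z)) (tensor_el X Y x y)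
    = tensor_el X (Y \<odot> Z) x (tensor_el Y Z y z)"
    if "x \<in> carrier X" "y \<in> carrier Y" "z \<in> carrier Z" for x y z
    using assms(1-3) that
    by (subst tens_map_apply) (auto intro!: balancedI simp flip: lact_tensor)
  show ?thesis
    unfolding biset_cat_def using assms
    by (simp, subst tens_map_apply)
       (auto intro!: balancedI elim!: tens_cases simp: inner)
qed

lemma LUnit_apply:
  assumes "is_biset A X" "a \<in> carrier A" "x \<in> carrier X"
  shows "LUnit bisets X (tensor_el (biset_unit A) X a x) = lact X a x"
  unfolding biset_cat_def using assms
  by (simp, subst tens_map_apply) (auto intro!: balancedI simp: biset_laws)

lemma RUnit_apply:
  assumes "is_biset A X" "a \<in> carrier A" "x \<in> carrier X"
  shows "RUnit bisets X (tensor_el X (biset_unit A) x a) = ract X x a"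
  unfolding biset_cat_def using assms
  by (simp, subst tens_map_apply) (auto intro!: balancedI simp: biset_laws)

lemma LUnit_biset_hom: "is_biset A X \<Longrightarrow> LUnit bisets X \<in> biset_hom A (biset_unit A \<odot> X) X"
  by (intro biset_hom_tensorI) (auto simp: LUnit_apply biset_laws)

lemma RUnit_biset_hom: "is_biset A X \<Longrightarrow> RUnit bisets X \<in> biset_hom A (X \<odot> biset_unit A) X"
  by (intro biset_hom_tensorI) (auto simp: RUnit_apply biset_laws)

lemma Assoc_biset_hom:
  assumes "is_biset A X" "is_biset A Y" "is_biset A Z"
  shows "Assoc bisets X Y Z \<in> biset_hom A ((X \<odot> Y) \<odot> Z) (X \<odot> (Y \<odot> Z))"
  using assms by (intro biset_hom_tensorI) (auto elim!: tens_cases simp: Assoc_apply)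

text \<open>The inverse of a bijective biset map commutes with the actions automatically, so the
  isomorphism claims below reduce to bijectivity.\<close>

lemma biset_iso_iff:
  assumes "is_biset A X" "is_biset A Y"
  shows "is_iso_arrow bisets X Y f \<longleftrightarrow> f \<in> biset_hom A X Y \<and> bij_betw f (carrier X) (carrier Y)"
proof
  assume "is_iso_arrow bisets X Y f"
  then obtain g where f: "f \<in> biset_hom A X Y" and g: "g \<in> biset_hom A Y X"
    and "compose (carrier X) g f = (\<lambda>x\<in>carrier X. x)" "compose (carrier Y) f g = (\<lambda>x\<in>carrier Y. x)"
    by (auto simp: is_iso_arrow_def inverse_arrows_def)
  then have "\<And>x. x \<in> carrier X \<Longrightarrow> g (f x) = x" "\<And>y. y \<in> carrier Y \<Longrightarrow> f (g y) = y"
    by (metis compose_eq restrict_apply')+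
  then have "bij_betw f (carrier X) (carrier Y)"
    by (intro bij_betwI[where g = g]) (auto intro: biset_hom_closed f g)
  with f show "f \<in> biset_hom A X Y \<and> bij_betw f (carrier X) (carrier Y)" ..
next
  assume "f \<in> biset_hom A X Y \<and> bij_betw f (carrier X) (carrier Y)"
  then have f: "f \<in> biset_hom A X Y" and bij: "bij_betw f (carrier X) (carrier Y)" by auto
  \<comment> \<open>The restriction is needed because arrows are extensional functions.\<close>
  define g where "g = restrict (inv_into (carrier X) f) (carrier Y)"
  have g_mem: "g y \<in> carrier X" if "y \<in> carrier Y" for y
    using bij that by (simp add: g_def bij_betw_imp_surj_on inv_into_into)
  have fg: "f (g y) = y" if "y \<in> carrier Y" for y
    using bij that by (simp add: g_def bij_betw_inv_into_right)
  have gf: "g (f x) = x" if "x \<in> carrier X" for x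
    using bij that by (simp add: g_def bij_betw_inv_into_left biset_hom_closed[OF f])
  have "g \<in> biset_hom A Y X"
  proof (rule biset_homI)
    fix a y assume "a \<in> carrier A" "y \<in> carrier Y"
    then show "g (lact Y a y) = lact X a (g y)" "g (ract Y y a) = ract X (g y) a"
      using biset_homD(3,4)[OF f, of a "g y"] assms by (metis biset_closed fg gf g_mem)+
  qed (simp_all add: g_mem, simp add: g_def)
  moreover have "compose (carrier X) g f = (\<lambda>x\<in>carrier X. x)" "compose (carrier Y) f g = (\<lambda>x\<in>carrier Y. x)"
    by (auto simp: compose_def fg gf intro!: restrict_ext)
  ultimately show "is_iso_arrow bisets X Y f"
    using f by (auto simp: is_iso_arrow_def inverse_arrows_def)
qed

text \<open>The inverse sends \<open>x\<close> to the class of \<open>(\<one>, x)\<close>: a scalar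
  in the left factor is \<open>\<one>\<close> acted on from the right, and so it passes across the
  tensor sign.\<close>

lemma LUnit_bij: "is_biset A X \<Longrightarrow> bij_betw (LUnit bisets X) (tens_carrier A p (biset_unit A) X) (carrier X)"
proof (rule bij_betwI[where g = "tensor_el (biset_unit A) X \<one>"])
  assume X: "is_biset A X"
  show "tensor_el (biset_unit A) X \<one> (LUnit bisets X z) = z" if "z \<in> tens_carrier A p (biset_unit A) X" for z
    using that X by (auto elim!: tens_cases simp: LUnit_apply simp flip: tens_balance)
qed (auto elim!: tens_cases simp: LUnit_apply biset_laws)

lemma RUnit_bij: "is_biset A X \<Longrightarrow> bij_betw (RUnit bisets X) (tens_carrier A p X (biset_unit A)) (carrier X)"
proof (rule bij_betwI[where g = "\<lambda>x. tensor_el X (biset_unit A) x \<one>"])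
  assume X: "is_biset A X"
  show "tensor_el X (biset_unit A) (RUnit bisets X z) \<one> = z" if "z \<in> tens_carrier A p X (biset_unit A)" for z
    using that X by (auto elim!: tens_cases simp: RUnit_apply)
qed (auto elim!: tens_cases simp: RUnit_apply biset_laws)

lemma Assoc_bij:
  assumes "is_biset A X" "is_biset A Y" "is_biset A Z"
  shows "bij_betw (Assoc bisets X Y Z) (tens_carrier A p (X \<odot> Y) Z) (tens_carrier A p X (Y \<odot> Z))"
proof -
  \<comment> \<open>The inverse is the mirror image of the associator, again in two stages.\<close>
  define g where "g = tens_map A p X (Y \<odot> Z)
    (\<lambda>x w. tens_map A p Y Z (\<lambda>y z. tensor_el (X \<odot> Y) Z (tensor_el X Y x y) z) w)"
  have inner: "tens_map A p Y Z (\<lambda>y z. tensor_el (X \<odot> Y) Z (tensor_el X Y x y) z) (tensor_el Y Z y z)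
    = tensor_el (X \<odot> Y) Z (tensor_el X Y x y) z"
    if "x \<in> carrier X" "y \<in> carrier Y" "z \<in> carrier Z" for x y z
    using assms(1-3) that
    by (subst tens_map_apply) (auto intro!: balancedI simp flip: ract_tensor)
  have g: "g (tensor_el X (Y \<odot> Z) x (tensor_el Y Z y z)) = tensor_el (X \<odot> Y) Z (tensor_el X Y x y) z"
    if "x \<in> carrier X" "y \<in> carrier Y" "z \<in> carrier Z" for x y z
    unfolding g_def using assms that
    by (subst tens_map_apply) (auto intro!: balancedI elim!: tens_cases simp: inner)
  show ?thesis
    using assms by (intro bij_betwI[where g = g]) (auto elim!: tens_cases simp: Assoc_apply g)
qed

lemma TenA_compose:
  assumes "is_biset A X" "is_biset A X'" "is_biset A Y" "is_biset A Y'"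
    "f \<in> biset_hom A X X'" "f' \<in> biset_hom A X' X''" "g \<in> biset_hom A Y Y'" "g' \<in> biset_hom A Y' Y''"
  shows "TenA bisets X X'' Y Y'' (compose (carrier X) f' f) (compose (carrier Y) g' g) =
    compose (tens_carrier A p X Y) (TenA bisets X' X'' Y' Y'' f' g') (TenA bisets X X' Y Y' f g)"
  using assms
  by (intro tens_ext[where X = X and Y = Y])
     (auto simp: TenA_apply compose_eq biset_hom_compose biset_hom_closed[OF assms(5)] biset_hom_closed[OF assms(7)])

theorem monoidal_category_bisets: "monoidal_category bisets"
proof (intro monoidal_category.intro category.intro monoidal_category_axioms.intro, goal_cases)
  case (3 X Y f)
  then show ?case
    by (auto simp: biset_hom_extensional compose_eq biset_hom_closed intro!: extensionalityI[where A = "carrier X"])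
next
  case (4 X Y f)
  then show ?case
    by (auto simp: biset_hom_extensional compose_eq intro!: extensionalityI[where A = "carrier X"])
next
  case (5 W X Y Z f g h)
  then show ?case
    by (auto simp: biset_hom_closed compose_eq intro!: extensionalityI[where A = "carrier W"])
next
  case (9 X Y)
  then show ?case
    by (auto simp: TenA_apply intro!: tens_ext[where X = X and Y = Y])
next
  case (10 X X' X'' Y Y' Y'' f f' g g')
  then show ?case by (simp add: TenA_compose)
next
  case (14 X X' Y Y' Z Z' f g h)
  then show ?case
    by (intro tens_ext[where X = "X \<odot> Y" and Y = Z])
       (auto simp: TenA_apply TenA_biset_hom Assoc_apply compose_eq biset_hom_closed elim!: tens_cases)
next
  case (15 X X' f)
  then show ?case
    by (intro tens_ext[where X = "biset_unit A" and Y = X])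
       (auto simp: TenA_apply LUnit_apply biset_hom_lact compose_eq biset_hom_closed)
next
  case (16 X X' f)
  then show ?case
    by (intro tens_ext[where X = X and Y = "biset_unit A"])
       (auto simp: TenA_apply RUnit_apply biset_hom_ract compose_eq biset_hom_closed)
next
  case (17 W X Y Z)
  then show ?case
    by (intro tens_ext[where X = "W \<odot> X \<odot> Y" and Y = Z])
       (auto simp: TenA_apply Assoc_biset_hom Assoc_apply compose_eq elim!: tens_cases)
next
  case (18 X Y)
  then show ?case
    by (intro tens_ext[where X = "X \<odot> biset_unit A" and Y = Y])
       (auto simp: TenA_apply Assoc_apply compose_eq LUnit_biset_hom RUnit_biset_hom LUnit_apply RUnit_apply
         elim!: tens_cases)
qed (auto simp: biset_hom_compose TenA_biset_hom biset_iso_iff LUnit_biset_hom RUnit_biset_hom Assoc_biset_hom LUnit_bij RUnit_bij Assoc_bij)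

end


section \<open>Skew monoidal monoids and their comodules\<close>

context skew_monoidal_monoid
begin

section \<open>Exchange rules in the monoid\<close>

lemma T_closed [simp]: "a \<in> carrier A \<Longrightarrow> \<T> a \<in> carrier A"
  and Q_closed [simp]: "a \<in> carrier A \<Longrightarrow> \<Q> a \<in> carrier A"
  using T_hom Q_hom by (auto simp: hom_def)

lemma T_mult: "\<lbrakk>a \<in> carrier A; b \<in> carrier A\<rbrakk> \<Longrightarrow> \<T> (a \<otimes> b) = \<T> a \<otimes> \<T> b"
  and Q_mult: "\<lbrakk>a \<in> carrier A; b \<in> carrier A\<rbrakk> \<Longrightarrow> \<Q> (a \<otimes> b) = \<Q> a \<otimes> \<Q> b"
  using T_hom Q_hom by (auto simp: hom_def)

lemmas [simp] = T_one Q_one gamma_closed eta_closed eps_closed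

lemma mu_closed [simp]: "\<mu> \<in> carrier A" and delta_closed [simp]: "\<delta> \<in> carrier A"
  by (simp_all add: mu_el_def delta_el_def)

lemma S_closed [simp]: "a \<in> carrier A \<Longrightarrow> \<S> a \<in> carrier A"
  by (simp add: S_map_def)

text \<open>Normalising products to the right by \<open>m_assoc\<close> hides a two-factor redex
  inside a longer word. This lemma and the next give the exchange rules a form with a trailing
  factor, marked by the suffix \<open>_left\<close>.\<close>

lemma left_assoc2:
  "\<lbrakk>a \<otimes> b = c \<otimes> d; a \<in> carrier A; b \<in> carrier A; c \<in> carrier A; d \<in> carrier A; x \<in> carrier A\<rbrakk>
    \<Longrightarrow> a \<otimes> (b \<otimes> x) = c \<otimes> (d \<otimes> x)"
  by (simp flip: m_assoc)

lemma left_assoc1: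
  "\<lbrakk>a \<otimes> b = c; a \<in> carrier A; b \<in> carrier A; x \<in> carrier A\<rbrakk> \<Longrightarrow> a \<otimes> (b \<otimes> x) = c \<otimes> x"
  by (simp flip: m_assoc)

lemma eps_gamma_left: "x \<in> carrier A \<Longrightarrow> \<epsilon> \<otimes> (\<gamma> \<otimes> x) = \<T> \<epsilon> \<otimes> x"
  by (rule left_assoc1[OF eps_gamma]) simp_all

lemma eps_Q_left: "\<lbrakk>a \<in> carrier A; x \<in> carrier A\<rbrakk> \<Longrightarrow> a \<otimes> (\<epsilon> \<otimes> x) = \<epsilon> \<otimes> (\<Q> a \<otimes> x)"
  by (rule left_assoc2[OF eps_Q]) simp_all

lemma TQ_commute_left:
  "\<lbrakk>a \<in> carrier A; b \<in> carrier A; x \<in> carrier A\<rbrakk> \<Longrightarrow> \<T> a \<otimes> (\<Q> b \<otimes> x) = \<Q> b \<otimes> (\<T> a \<otimes> x)"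
  by (rule left_assoc2[OF TQ_commute]) simp_all

lemma gamma_TT_left: "\<lbrakk>a \<in> carrier A; x \<in> carrier A\<rbrakk> \<Longrightarrow> \<gamma> \<otimes> (\<T> (\<T> a) \<otimes> x) = \<T> a \<otimes> (\<gamma> \<otimes> x)"
  and gamma_TQ_left: "\<lbrakk>a \<in> carrier A; x \<in> carrier A\<rbrakk> \<Longrightarrow> \<gamma> \<otimes> (\<T> (\<Q> a) \<otimes> x) = \<Q> (\<T> a) \<otimes> (\<gamma> \<otimes> x)"
  and gamma_Q_left: "\<lbrakk>a \<in> carrier A; x \<in> carrier A\<rbrakk> \<Longrightarrow> \<gamma> \<otimes> (\<Q> a \<otimes> x) = \<Q> (\<Q> a) \<otimes> (\<gamma> \<otimes> x)"
  by (auto intro: left_assoc2 simp: gamma_TT gamma_TQ gamma_Q)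

lemma gamma_gamma: "\<gamma> \<otimes> \<gamma> = \<Q> \<gamma> \<otimes> (\<gamma> \<otimes> \<T> \<gamma>)"
  using gamma_pentagon by (simp add: m_assoc)

lemma gamma_gamma_left: "x \<in> carrier A \<Longrightarrow> \<gamma> \<otimes> (\<gamma> \<otimes> x) = \<Q> \<gamma> \<otimes> (\<gamma> \<otimes> (\<T> \<gamma> \<otimes> x))"
  using left_assoc1[OF gamma_gamma] by (simp add: m_assoc)

lemma Q_eps_gamma_T_eta: "\<Q> \<epsilon> \<otimes> (\<gamma> \<otimes> \<T> \<eta>) = \<one>"
  using eps_gamma_eta by (simp add: m_assoc)

lemma Q_eps_Q: "a \<in> carrier A \<Longrightarrow> \<Q> \<epsilon> \<otimes> \<Q> (\<Q> a) = \<Q> a \<otimes> \<Q> \<epsilon>"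
  by (metis Q_mult eps_Q eps_closed Q_closed)

lemma Q_eps_Q_left:
  "\<lbrakk>a \<in> carrier A; x \<in> carrier A\<rbrakk> \<Longrightarrow> \<Q> \<epsilon> \<otimes> (\<Q> (\<Q> a) \<otimes> x) = \<Q> a \<otimes> (\<Q> \<epsilon> \<otimes> x)"
  by (rule left_assoc2[OF Q_eps_Q]) simp_all

section \<open>Identities of \<open>\<mu>\<close> and \<open>\<delta>\<close>\<close>

lemma mu_Q: "a \<in> carrier A \<Longrightarrow> \<mu> \<otimes> \<Q> a = \<Q> a \<otimes> \<mu>"
  by (simp add: mu_el_def m_assoc gamma_Q Q_eps_Q_left)

lemma mu_Q_left: "\<lbrakk>a \<in> carrier A; x \<in> carrier A\<rbrakk> \<Longrightarrow> \<mu> \<otimes> (\<Q> a \<otimes> x) = \<Q> a \<otimes> (\<mu> \<otimes> x)"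
  by (rule left_assoc2[OF mu_Q]) simp_all

lemma mu_TT: "a \<in> carrier A \<Longrightarrow> \<mu> \<otimes> \<T> (\<T> a) = \<T> a \<otimes> \<mu>"
  by (simp add: mu_el_def m_assoc gamma_TT TQ_commute_left)

lemma mu_TT_left: "\<lbrakk>a \<in> carrier A; x \<in> carrier A\<rbrakk> \<Longrightarrow> \<mu> \<otimes> (\<T> (\<T> a) \<otimes> x) = \<T> a \<otimes> (\<mu> \<otimes> x)"
  by (rule left_assoc2[OF mu_TT]) simp_all

lemma mu_TQ: "a \<in> carrier A \<Longrightarrow> \<mu> \<otimes> \<T> (\<Q> a) = \<Q> (\<epsilon> \<otimes> \<T> a) \<otimes> \<gamma>"
  by (simp add: mu_el_def m_assoc gamma_TQ Q_mult)

text \<open>With \<open>mu_eta\<close>, the two unit laws of the monoid on \<open>\<delta>\<close>.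
  This one is the axiom \<open>eps_gamma_eta\<close>; the other comes from \<open>gamma_eta\<close>
  and \<open>eps_eta\<close>.\<close>

lemma mu_T_eta: "\<mu> \<otimes> \<T> \<eta> = \<one>"
  by (simp add: mu_el_def m_assoc Q_eps_gamma_T_eta)

lemma mu_eta: "\<mu> \<otimes> \<eta> = \<one>"
  by (simp add: mu_el_def m_assoc gamma_eta eps_eta flip: Q_mult)

lemma eps_mu: "\<epsilon> \<otimes> \<mu> = \<epsilon> \<otimes> \<T> \<epsilon>"
  using eps_Q_left[of \<epsilon> \<gamma>] by (simp add: mu_el_def eps_gamma)

lemma delta_T: "a \<in> carrier A \<Longrightarrow> \<delta> \<otimes> \<T> a = \<T> a \<otimes> \<delta>"
  by (simp add: delta_el_def m_assoc eta_T T_mult gamma_TT_left flip: T_mult)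
     (simp add: T_mult gamma_TT_left)

lemma delta_Q: "a \<in> carrier A \<Longrightarrow> \<delta> \<otimes> \<Q> a = \<Q> (\<Q> a) \<otimes> \<delta>"
  by (simp add: delta_el_def m_assoc TQ_commute gamma_Q_left)

lemma delta_T_left: "\<lbrakk>a \<in> carrier A; x \<in> carrier A\<rbrakk> \<Longrightarrow> \<delta> \<otimes> (\<T> a \<otimes> x) = \<T> a \<otimes> (\<delta> \<otimes> x)"
  and delta_Q_left: "\<lbrakk>a \<in> carrier A; x \<in> carrier A\<rbrakk> \<Longrightarrow> \<delta> \<otimes> (\<Q> a \<otimes> x) = \<Q> (\<Q> a) \<otimes> (\<delta> \<otimes> x)"
  by (auto intro: left_assoc2 simp: delta_T delta_Q)

text \<open>With \<open>\<delta>\<close> moved to the front,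
  \<open>\<epsilon> \<otimes> \<gamma>\<close> becomes \<open>\<T> \<epsilon>\<close>; everything
  then lies under \<open>\<T>\<close>, where \<open>\<epsilon> \<otimes> \<eta>\<close>
  cancels.\<close>

lemma eps_T_delta: "a \<in> carrier A \<Longrightarrow> \<epsilon> \<otimes> (\<T> a \<otimes> \<delta>) = \<T> a"
proof -
  assume a: "a \<in> carrier A"
  then have "\<epsilon> \<otimes> (\<T> a \<otimes> \<delta>) = \<T> (\<epsilon> \<otimes> \<eta> \<otimes> a)"
    by (simp flip: delta_T) (simp add: delta_el_def eps_gamma_left m_assoc T_mult)
  then show ?thesis using a by (simp add: eps_eta)
qed

lemma eps_T_delta_left: "\<lbrakk>a \<in> carrier A; x \<in> carrier A\<rbrakk> \<Longrightarrow> \<epsilon> \<otimes> (\<T> a \<otimes> (\<delta> \<otimes> x)) = \<T> a \<otimes> x"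
  by (simp add: eps_T_delta flip: m_assoc) (simp add: eps_T_delta m_assoc)

lemma eps_delta: "\<epsilon> \<otimes> \<delta> = \<one>"
  using eps_T_delta[of \<one>] by simp

lemma Q_eps_delta: "\<Q> \<epsilon> \<otimes> \<delta> = \<one>"
  by (simp add: delta_el_def Q_eps_gamma_T_eta)

text \<open>Coassociativity, which makes \<open>\<delta>\<close> itself a comodule. Collecting both
  \<open>\<eta>\<close> under \<open>\<T>\<close> brings the two \<open>\<gamma>\<close> together,
  so that the pentagon applies.\<close>

lemma delta_delta: "\<delta> \<otimes> \<delta> = \<Q> \<delta> \<otimes> \<delta>"
proof -
  have e: "\<T> \<gamma> \<otimes> \<T> (\<eta> \<otimes> \<eta>) = \<T> (\<Q> \<eta>) \<otimes> \<T> \<eta>"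
    by (simp add: gamma_eta flip: T_mult m_assoc)
  have "\<delta> \<otimes> \<delta> = \<gamma> \<otimes> (\<gamma> \<otimes> \<T> (\<eta> \<otimes> \<eta>))"
    by (simp add: delta_el_def m_assoc eta_T T_mult) (simp add: gamma_TT_left)
  also have "\<dots> = \<Q> \<delta> \<otimes> \<delta>"
    by (simp add: gamma_gamma_left e gamma_TQ_left) (simp add: delta_el_def Q_mult m_assoc)
  finally show ?thesis .
qed

text \<open>The pentagon rewrites the inner \<open>\<gamma> \<otimes> \<gamma>\<close>; then
  \<open>eps_gamma\<close> and \<open>gamma_eta\<close> absorb the outer \<open>\<epsilon>\<close>
  and \<open>\<eta>\<close>, which meet under \<open>\<T>\<close> and \<open>\<Q>\<close> and
  cancel.\<close>

lemma mu_delta: "\<mu> \<otimes> \<delta> = \<gamma>"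
proof -
  have e: "\<Q> \<epsilon> \<otimes> (\<Q> \<gamma> \<otimes> x) = \<Q> (\<T> \<epsilon>) \<otimes> x" if "x \<in> carrier A" for x
    using that by (simp add: eps_gamma flip: Q_mult m_assoc)
  have "\<mu> \<otimes> \<delta> = \<Q> (\<T> \<epsilon>) \<otimes> (\<gamma> \<otimes> \<T> (\<Q> \<eta>))"
    by (simp add: mu_el_def delta_el_def m_assoc gamma_gamma_left e gamma_eta flip: T_mult)
  also have "\<dots> = \<gamma> \<otimes> \<T> (\<Q> (\<epsilon> \<otimes> \<eta>))"
    by (simp add: Q_mult T_mult gamma_TQ_left)
  finally show ?thesis by (simp add: eps_eta)
qed

text \<open>Associativity of the monoid on \<open>\<delta>\<close>: tensoring \<open>\<mu>\<close>
  with the identity of \<open>\<delta>\<close> gives \<open>\<mu>\<close> on one side and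
  \<open>\<T> \<mu>\<close> on the other.\<close>

lemma mu_mu: "\<mu> \<otimes> \<mu> = \<mu> \<otimes> \<T> \<mu>"
proof -
  have e: "\<Q> \<epsilon> \<otimes> (\<Q> \<gamma> \<otimes> x) = \<Q> (\<T> \<epsilon>) \<otimes> x" if "x \<in> carrier A" for x
    using that by (simp add: eps_gamma flip: Q_mult m_assoc)
  have "\<mu> \<otimes> \<mu> = \<Q> \<epsilon> \<otimes> (\<Q> (\<Q> \<epsilon>) \<otimes> (\<gamma> \<otimes> \<gamma>))"
    by (simp add: mu_el_def m_assoc gamma_Q_left)
  also have "\<dots> = \<Q> \<epsilon> \<otimes> (\<Q> (\<T> \<epsilon>) \<otimes> (\<gamma> \<otimes> \<T> \<gamma>))"
    by (simp add: Q_eps_Q_left gamma_gamma e)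
  also have "\<dots> = \<mu> \<otimes> \<T> \<mu>"
    by (simp add: mu_el_def m_assoc T_mult gamma_TQ_left)
  finally show ?thesis .
qed

text \<open>By \<open>mu_delta\<close> and \<open>delta_T\<close> the right side is
  \<open>\<Q> \<mu>\<close> times the vertical tensor square of \<open>\<delta>\<close>, so this is
  the condition for \<open>\<mu>\<close> to be an arrow from that square to
  \<open>\<delta>\<close>.\<close>

lemma delta_mu: "\<delta> \<otimes> \<mu> = \<Q> \<mu> \<otimes> (\<gamma> \<otimes> \<T> \<delta>)"
proof -
  have "\<Q> \<mu> \<otimes> (\<gamma> \<otimes> \<T> \<delta>) = \<Q> (\<Q> \<epsilon>) \<otimes> (\<gamma> \<otimes> \<gamma> \<otimes> \<T> (\<T> \<eta>))"
    by (simp add: mu_el_def delta_el_def Q_mult T_mult m_assoc gamma_gamma_left)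
  also have "\<dots> = \<delta> \<otimes> \<mu>"
    by (simp add: m_assoc gamma_TT) (simp add: delta_el_def mu_el_def m_assoc TQ_commute_left gamma_Q_left)
  finally show ?thesis ..
qed

lemma eps_T_mu_T_delta:
  assumes "a \<in> carrier A" "b \<in> carrier A"
  shows "\<epsilon> \<otimes> (\<T> a \<otimes> (\<mu> \<otimes> (\<T> b \<otimes> \<delta>))) = \<T> (\<epsilon> \<otimes> (\<T> a \<otimes> b))"
proof -
  have "\<epsilon> \<otimes> (\<T> a \<otimes> (\<mu> \<otimes> (\<T> b \<otimes> \<delta>))) = \<epsilon> \<otimes> (\<T> a \<otimes> (\<gamma> \<otimes> \<T> b))"
    using assms by (simp add: left_assoc1 mu_delta flip: delta_T)
  also have "\<dots> = \<T> \<epsilon> \<otimes> (\<T> (\<T> a) \<otimes> \<T> b)"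
    using assms by (simp add: eps_gamma_left flip: gamma_TT_left)
  finally show ?thesis using assms by (simp add: T_mult)
qed

section \<open>The target map and its coordinate \<open>\<epsilon> \<otimes> \<T> a\<close>\<close>

lemma S_alt: "a \<in> carrier A \<Longrightarrow> \<S> a = \<Q> (\<epsilon> \<otimes> \<T> a) \<otimes> \<delta>"
  by (simp add: S_map_def mu_TQ delta_el_def T_mult left_assoc2[OF mu_TQ] m_assoc Q_mult)

lemma S_one: "\<S> \<one> = \<one>"
  by (simp add: S_alt Q_eps_delta)

lemma S_Q_commute:
  assumes "a \<in> carrier A" "b \<in> carrier A"
  shows "\<S> a \<otimes> \<Q> b = \<Q> b \<otimes> \<S> a"
proof -
  have "\<epsilon> \<otimes> \<T> a \<otimes> \<Q> b = b \<otimes> (\<epsilon> \<otimes> \<T> a)"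
    using assms by (simp add: m_assoc TQ_commute eps_Q_left)
  then have "\<Q> (\<epsilon> \<otimes> \<T> a) \<otimes> (\<Q> (\<Q> b) \<otimes> \<delta>) = \<Q> b \<otimes> (\<Q> (\<epsilon> \<otimes> \<T> a) \<otimes> \<delta>)"
    using assms by (simp flip: m_assoc Q_mult)
  then show ?thesis
    using assms by (simp only: S_alt delta_Q m_assoc Q_closed T_closed delta_closed m_closed eps_closed)
qed

lemma Q_delta_Q_delta: "\<lbrakk>a \<in> carrier A; b \<in> carrier A\<rbrakk> \<Longrightarrow>
    \<Q> a \<otimes> \<delta> \<otimes> (\<Q> b \<otimes> \<delta>) = \<Q> (a \<otimes> (\<Q> b \<otimes> \<delta>)) \<otimes> \<delta>"
  by (simp add: m_assoc delta_Q_left delta_delta Q_mult)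

text \<open>To the left of \<open>\<delta>\<close> a target element can be exchanged for a source
  element; later computations in modules eliminate \<open>\<S>\<close> this way.\<close>

lemma S_delta: "a \<in> carrier A \<Longrightarrow> \<S> a \<otimes> \<delta> = \<Q> (\<T> a) \<otimes> \<delta>"
  using Q_delta_Q_delta[of "\<epsilon> \<otimes> \<T> a" \<one>] by (simp add: S_alt m_assoc eps_T_delta)

lemma delta_S: "a \<in> carrier A \<Longrightarrow> \<delta> \<otimes> \<S> a = \<Q> (\<S> a) \<otimes> \<delta>"
  by (simp add: S_alt delta_Q_left delta_delta Q_mult m_assoc)

text \<open>Associativity moves one \<open>\<mu>\<close> under \<open>\<T>\<close>, where it meets
  \<open>\<eta>\<close> and cancels. The identity is what makes the \<open>F\<close>-action on a
  tensor product well defined.\<close>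

lemma mu_S: "a \<in> carrier A \<Longrightarrow> \<mu> \<otimes> \<S> a = \<mu> \<otimes> \<T> (\<Q> a)"
proof -
  assume a: "a \<in> carrier A"
  then have "\<mu> \<otimes> \<S> a = \<mu> \<otimes> \<T> (\<mu> \<otimes> (\<Q> a \<otimes> \<eta>))"
    by (simp add: S_map_def left_assoc2[OF mu_mu] T_mult)
  also have "\<mu> \<otimes> (\<Q> a \<otimes> \<eta>) = \<Q> a"
    using a by (simp add: mu_Q_left mu_eta)
  finally show ?thesis .
qed

lemma eps_S: "a \<in> carrier A \<Longrightarrow> \<epsilon> \<otimes> \<S> a = \<epsilon> \<otimes> \<T> a"
  using eps_Q_left[of "\<epsilon> \<otimes> \<T> a" \<delta>] by (simp add: S_alt eps_delta)

lemma S_mult: "\<lbrakk>a \<in> carrier A; b \<in> carrier A\<rbrakk> \<Longrightarrow> \<S> (a \<otimes> b) = \<S> b \<otimes> \<S> a"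
proof -
  assume ab: "a \<in> carrier A" "b \<in> carrier A"
  have "\<S> b \<otimes> \<S> a = \<Q> (\<epsilon> \<otimes> (\<T> b \<otimes> \<Q> (\<epsilon> \<otimes> \<T> a)) \<otimes> \<delta>) \<otimes> \<delta>"
    using ab Q_delta_Q_delta[of "\<epsilon> \<otimes> \<T> b" "\<epsilon> \<otimes> \<T> a"] by (simp add: S_alt m_assoc)
  also have "\<epsilon> \<otimes> (\<T> b \<otimes> \<Q> (\<epsilon> \<otimes> \<T> a)) \<otimes> \<delta> = \<epsilon> \<otimes> \<T> (a \<otimes> b)"
    using ab eps_Q_left[of "\<epsilon> \<otimes> \<T> a" "\<T> b \<otimes> \<delta>"]
    by (simp add: TQ_commute m_assoc TQ_commute_left eps_T_delta T_mult)
  finally show ?thesis using ab by (simp add: S_alt)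
qed

section \<open>Comodules and the vertical tensor product\<close>

definition comodule :: "'u \<Rightarrow> bool" where
  "comodule u \<longleftrightarrow> u \<in> carrier A \<and> \<Q> u \<otimes> u = \<delta> \<otimes> u \<and> \<epsilon> \<otimes> u = \<one>"

definition vtens :: "'u \<Rightarrow> 'u \<Rightarrow> 'u"  (infixl "\<circledcirc>" 70) where
  "u \<circledcirc> v = \<mu> \<otimes> \<T> v \<otimes> u"

lemma comodule_closed [simp]: "comodule u \<Longrightarrow> u \<in> carrier A"
  by (simp add: comodule_def)

lemma Q_comodule: "comodule u \<Longrightarrow> \<Q> u \<otimes> u = \<delta> \<otimes> u"
  and eps_comodule: "comodule u \<Longrightarrow> \<epsilon> \<otimes> u = \<one>"
  by (simp_all add: comodule_def)

lemma comodule_delta [simp]: "comodule \<delta>"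
  by (simp add: comodule_def delta_delta eps_delta)

lemma comodule_eta [simp]: "comodule \<eta>"
proof -
  have "\<Q> \<eta> \<otimes> \<eta> = \<gamma> \<otimes> (\<eta> \<otimes> \<eta>)"
    using left_assoc1[OF gamma_eta, of \<eta>] by simp
  also have "\<dots> = \<delta> \<otimes> \<eta>"
    by (subst eta_T) (simp_all add: delta_el_def m_assoc)
  finally show ?thesis
    by (simp add: comodule_def eps_eta)
qed

text \<open>Passing \<open>u\<close> through \<open>\<epsilon>\<close> turns it into
  \<open>\<Q> u\<close>, which commutes with \<open>\<T> a\<close>; the comodule law then yields a
  \<open>\<delta>\<close> that \<open>eps_T_delta_left\<close> absorbs. The effect is to cancel the
  \<open>u \<otimes> \<epsilon>\<close> that arises when tensor products of arrows are
  composed.\<close>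

lemma comodule_slide:
  assumes "comodule u" "a \<in> carrier A"
  shows "u \<otimes> (\<epsilon> \<otimes> (\<T> a \<otimes> u)) = \<T> a \<otimes> u"
proof -
  have "u \<otimes> (\<epsilon> \<otimes> (\<T> a \<otimes> u)) = \<epsilon> \<otimes> (\<T> a \<otimes> (\<Q> u \<otimes> u))"
    using assms by (subst eps_Q_left) (simp_all add: TQ_commute_left)
  then show ?thesis
    using assms by (simp add: Q_comodule eps_T_delta_left)
qed

lemma comodule_slide_mu:
  assumes "comodule u" "a \<in> carrier A" "b \<in> carrier A"
  shows "u \<otimes> (\<epsilon> \<otimes> (\<T> a \<otimes> (\<mu> \<otimes> (\<T> b \<otimes> u)))) = \<T> (\<epsilon> \<otimes> (\<T> a \<otimes> b)) \<otimes> u"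
proof -
  have "u \<otimes> (\<epsilon> \<otimes> (\<T> a \<otimes> (\<mu> \<otimes> (\<T> b \<otimes> u)))) = \<epsilon> \<otimes> (\<T> a \<otimes> (\<mu> \<otimes> (\<T> b \<otimes> (\<Q> u \<otimes> u))))"
    using assms by (subst eps_Q_left) (simp_all add: TQ_commute_left mu_Q_left)
  also have "\<dots> = \<epsilon> \<otimes> (\<T> a \<otimes> (\<mu> \<otimes> (\<T> b \<otimes> \<delta>))) \<otimes> u"
    using assms by (simp add: Q_comodule m_assoc)
  finally show ?thesis
    using assms by (simp add: eps_T_mu_T_delta)
qed

text \<open>Splitting \<open>\<gamma>\<close> as \<open>\<mu> \<otimes> \<delta>\<close> brings in
  the comodule law of \<open>u\<close>, and the resulting \<open>\<Q> u\<close> moves to the front.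
  This links the coaction of \<open>u\<close> with that of a vertical tensor product.\<close>

lemma gamma_T_comodule:
  assumes "comodule u" "a \<in> carrier A"
  shows "\<gamma> \<otimes> (\<T> a \<otimes> u) = \<Q> u \<otimes> (\<mu> \<otimes> (\<T> a \<otimes> u))"
proof -
  have "\<gamma> \<otimes> (\<T> a \<otimes> u) = \<mu> \<otimes> (\<T> a \<otimes> (\<Q> u \<otimes> u))"
    using assms by (simp add: m_assoc Q_comodule flip: mu_delta) (simp add: delta_T_left)
  then show ?thesis
    using assms by (simp add: TQ_commute_left mu_Q_left)
qed

lemma comodule_vtens [simp]:
  assumes "comodule u" "comodule v"
  shows "comodule (u \<circledcirc> v)"
proof -
  have "\<delta> \<otimes> (u \<circledcirc> v) = \<Q> \<mu> \<otimes> (\<gamma> \<otimes> (\<T> (\<Q> v \<otimes> v) \<otimes> u))"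
    using assms by (simp add: vtens_def m_assoc left_assoc2[OF delta_mu] Q_comodule T_mult)
  also have "\<dots> = \<Q> (u \<circledcirc> v) \<otimes> (u \<circledcirc> v)"
    using assms by (simp add: T_mult Q_mult vtens_def m_assoc gamma_TQ_left gamma_T_comodule)
  finally have "\<Q> (u \<circledcirc> v) \<otimes> (u \<circledcirc> v) = \<delta> \<otimes> (u \<circledcirc> v)" ..
  moreover have "\<epsilon> \<otimes> (u \<circledcirc> v) = \<epsilon> \<otimes> (\<T> (\<epsilon> \<otimes> v) \<otimes> u)"
    using assms by (simp add: vtens_def m_assoc left_assoc2[OF eps_mu] T_mult)
  ultimately show ?thesis
    using assms by (simp add: comodule_def vtens_def)
qed

lemma comodule_slide_vtens:
  assumes "comodule u" "v \<in> carrier A" "a \<in> carrier A"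
  shows "u \<otimes> (\<epsilon> \<otimes> (\<T> a \<otimes> (u \<circledcirc> v))) = \<T> (\<epsilon> \<otimes> (\<T> a \<otimes> v)) \<otimes> u"
  using assms by (simp add: vtens_def m_assoc comodule_slide_mu)

text \<open>\<open>mu_TT\<close> gathers both \<open>\<mu>\<close> at the front, where associativity
  of the monoid on \<open>\<delta>\<close> applies.\<close>

lemma vtens_assoc:
  assumes "u \<in> carrier A" "v \<in> carrier A" "w \<in> carrier A"
  shows "u \<circledcirc> v \<circledcirc> w = u \<circledcirc> (v \<circledcirc> w)"
  using assms by (simp add: vtens_def m_assoc T_mult left_assoc2[OF mu_mu] flip: mu_TT_left)

lemma vtens_eta: "u \<in> carrier A \<Longrightarrow> u \<circledcirc> \<eta> = u"
  by (simp add: vtens_def mu_T_eta)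

lemma eta_vtens: "u \<in> carrier A \<Longrightarrow> \<eta> \<circledcirc> u = u"
  by (simp add: vtens_def m_assoc left_assoc1[OF mu_eta] flip: eta_T)

lemma comod_hom_closed: "s \<in> comod_hom A u v \<Longrightarrow> s \<in> carrier A"
  by (simp add: comod_hom_def)

lemma comod_hom_comp:
  assumes "s \<in> comod_hom A u v" "t \<in> comod_hom A v w" "u \<in> carrier A" "v \<in> carrier A" "w \<in> carrier A"
  shows "t \<otimes> s \<in> comod_hom A u w"
proof -
  have [simp]: "s \<in> carrier A" "t \<in> carrier A"
    and s: "\<Q> s \<otimes> u = v \<otimes> s" and t: "\<Q> t \<otimes> v = w \<otimes> t"
    using assms(1,2) by (auto simp: comod_hom_def)
  show ?thesis
    using assms(3-5) left_assoc2[OF t, of s] by (simp add: comod_hom_def Q_mult m_assoc s)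
qed

lemma comod_hom_one: "u \<in> carrier A \<Longrightarrow> \<one> \<in> comod_hom A u u"
  by (simp add: comod_hom_def)

lemma comod_hom_tens:
  assumes "comodule u" "comodule u'" "comodule v" "comodule v'"
    and s: "s \<in> comod_hom A u u'" and t: "t \<in> comod_hom A v v'"
  shows "s \<otimes> \<epsilon> \<otimes> \<T> t \<otimes> u \<in> comod_hom A (u \<circledcirc> v) (u' \<circledcirc> v')"
proof -
  have st [simp]: "s \<in> carrier A" "t \<in> carrier A"
    using s t by (auto simp: comod_hom_def)
  have "\<Q> (s \<otimes> \<epsilon> \<otimes> \<T> t \<otimes> u) \<otimes> (u \<circledcirc> v) = \<Q> (s \<otimes> \<epsilon> \<otimes> \<T> t) \<otimes> (\<gamma> \<otimes> (\<T> v \<otimes> u))"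
    using assms by (simp add: gamma_T_comodule Q_mult vtens_def m_assoc)
  also have "\<dots> = \<Q> s \<otimes> (\<mu> \<otimes> (\<T> (\<Q> t \<otimes> v) \<otimes> u))"
    using assms by (simp add: Q_mult T_mult vtens_def m_assoc left_assoc2[OF mu_TQ])
  also have "\<Q> t \<otimes> v = v' \<otimes> t"
    using t by (simp add: comod_hom_def)
  \<comment> \<open>\<open>comodule_slide\<close> accounts for the inserted
    \<open>u \<otimes> \<epsilon>\<close>; it creates the factor \<open>\<Q> s \<otimes> u\<close>
    to which the arrow equation of \<open>s\<close> applies.\<close>
  also have "\<Q> s \<otimes> (\<mu> \<otimes> (\<T> (v' \<otimes> t) \<otimes> u)) = \<mu> \<otimes> (\<T> v' \<otimes> (\<Q> s \<otimes> u \<otimes> (\<epsilon> \<otimes> (\<T> t \<otimes> u))))"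
    using assms by (simp add: T_mult vtens_def m_assoc comodule_slide TQ_commute_left mu_Q_left)
  also have "\<Q> s \<otimes> u = u' \<otimes> s"
    using s by (simp add: comod_hom_def)
  finally show ?thesis
    using assms by (simp add: comod_hom_def vtens_def m_assoc)
qed

text \<open>The interchange law: the arrow equation turns the inner \<open>u' \<otimes> s\<close>
  into \<open>\<Q> s \<otimes> u\<close>, \<open>comodule_slide\<close> removes
  \<open>u \<otimes> \<epsilon>\<close>, and \<open>s\<close> returns through the remaining
  \<open>\<epsilon>\<close>.\<close>

lemma comod_tens_comp:
  assumes "comodule u" "comodule u'" "t \<in> carrier A" "s' \<in> carrier A" "t' \<in> carrier A"
    and s: "s \<in> comod_hom A u u'"
  shows "(s' \<otimes> s) \<otimes> \<epsilon> \<otimes> \<T> (t' \<otimes> t) \<otimes> u = (s' \<otimes> \<epsilon> \<otimes> \<T> t' \<otimes> u') \<otimes> (s \<otimes> \<epsilon> \<otimes> \<T> t \<otimes> u)"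
proof -
  have su: "s \<in> carrier A" "u' \<otimes> s = \<Q> s \<otimes> u"
    using s by (auto simp: comod_hom_def)
  have "(s' \<otimes> \<epsilon> \<otimes> \<T> t' \<otimes> u') \<otimes> (s \<otimes> \<epsilon> \<otimes> \<T> t \<otimes> u)
    = s' \<otimes> (\<epsilon> \<otimes> (\<T> t' \<otimes> (u' \<otimes> s \<otimes> (\<epsilon> \<otimes> (\<T> t \<otimes> u)))))"
    using assms su(1) by (simp add: m_assoc)
  also have "\<dots> = s' \<otimes> (\<epsilon> \<otimes> (\<Q> s \<otimes> (\<T> t' \<otimes> (\<T> t \<otimes> u))))"
    using assms su by (simp add: m_assoc comodule_slide TQ_commute_left)
  also have "\<dots> = s' \<otimes> (s \<otimes> (\<epsilon> \<otimes> (\<T> t' \<otimes> (\<T> t \<otimes> u))))"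
    using assms su(1) by (subst eps_Q_left[of s]) simp_all
  finally show ?thesis
    using assms su(1) by (simp add: m_assoc T_mult)
qed

lemma comod_tens_assoc:
  assumes "comodule u" "comodule v" "f \<in> carrier A" "g \<in> carrier A" "h \<in> carrier A"
  shows "(f \<otimes> \<epsilon> \<otimes> \<T> g \<otimes> u) \<otimes> \<epsilon> \<otimes> \<T> h \<otimes> (u \<circledcirc> v) = f \<otimes> \<epsilon> \<otimes> \<T> (g \<otimes> \<epsilon> \<otimes> \<T> h \<otimes> v) \<otimes> u"
  using assms by (simp add: vtens_def m_assoc comodule_slide_mu T_mult)

section \<open>The opposite of the comodule category\<close>

lemma comod_cat_simps [simp]:
  "Ob (comod_cat A) = {u. comodule u}" "Hom (comod_cat A) = comod_hom A"
  "Id (comod_cat A) u = \<one>" "Cmp (comod_cat A) u v w t s = t \<otimes> s"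
  "TenO (comod_cat A) u v = u \<circledcirc> v" "TenA (comod_cat A) u u' v v' s t = s \<otimes> \<epsilon> \<otimes> \<T> t \<otimes> u"
  "Unit (comod_cat A) = \<eta>" "Assoc (comod_cat A) u v w = \<one>"
  "LUnit (comod_cat A) u = \<one>" "RUnit (comod_cat A) u = \<one>"
  by (auto simp: comod_cat_def comodule_def vtens_def)

text \<open>\<open>op_moncat\<close> inverts the constraints by a definite description. Strictness
  makes source and target equal, so only the inverse of \<open>\<one>\<close> is ever
  needed.\<close>

lemma comod_arrow_inv_one: "u \<in> carrier A \<Longrightarrow> arrow_inv (comod_cat A) u u \<one> = \<one>"
  unfolding arrow_inv_def
  by (rule the_equality) (auto simp: inverse_arrows_def comod_hom_def)

lemma op_comod_cat_simps [simp]: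
  "Ob (op_moncat (comod_cat A)) = {u. comodule u}"
  "Hom (op_moncat (comod_cat A)) u v = comod_hom A v u"
  "Id (op_moncat (comod_cat A)) u = \<one>"
  "Cmp (op_moncat (comod_cat A)) u v w t s = s \<otimes> t"
  "TenO (op_moncat (comod_cat A)) u v = u \<circledcirc> v"
  "TenA (op_moncat (comod_cat A)) u u' v v' s t = s \<otimes> \<epsilon> \<otimes> \<T> t \<otimes> u'"
  "Unit (op_moncat (comod_cat A)) = \<eta>"
  "\<lbrakk>comodule u; comodule v; comodule w\<rbrakk> \<Longrightarrow> Assoc (op_moncat (comod_cat A)) u v w = \<one>"
  "comodule u \<Longrightarrow> LUnit (op_moncat (comod_cat A)) u = \<one>"
  "comodule u \<Longrightarrow> RUnit (op_moncat (comod_cat A)) u = \<one>"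
  by (simp_all add: op_moncat_def comod_arrow_inv_one vtens_assoc eta_vtens vtens_eta)

lemma op_comod_is_iso_one: "u \<in> carrier A \<Longrightarrow> is_iso_arrow (op_moncat (comod_cat A)) u u \<one>"
  by (auto simp: is_iso_arrow_def inverse_arrows_def comod_hom_def)

theorem monoidal_category_op_comod: "monoidal_category (op_moncat (comod_cat A))"
proof (intro monoidal_category.intro category.intro monoidal_category_axioms.intro, goal_cases)
  case (5 W X Y Z f g h)
  then show ?case by (simp add: comod_hom_closed m_assoc)
next
  case (10 X X' X'' Y Y' Y'' f f' g g')
  \<comment> \<open>The arrows run from \<open>X''\<close> through \<open>X'\<close> to
    \<open>X\<close> in the original category, which explains the exchanged roles of primed and
    unprimed arguments.\<close>
  then show ?case using comod_tens_comp[of X'' X' g' f g f'] by (simp add: comod_hom_closed)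
next
  case (14 X X' Y Y' Z Z' f g h)
  then show ?case by (simp add: comod_hom_closed comod_tens_assoc)
next
  case (15 X X' f)
  then show ?case by (simp add: comod_hom_closed m_assoc left_assoc1[OF eps_eta] flip: eta_T)
next
  case (16 X X' f)
  then show ?case by (simp add: comod_hom_closed m_assoc eps_comodule)
qed (auto simp: comod_hom_closed comod_hom_comp comod_hom_one comod_hom_tens vtens_assoc vtens_eta eta_vtens
    op_comod_is_iso_one eps_comodule)

section \<open>Coordinates of arrows into \<open>\<delta>\<close>\<close>

lemma Q_comodule_hom:
  assumes "comodule u" "a \<in> carrier A"
  shows "\<Q> a \<otimes> u \<in> comod_hom A u \<delta>"
  using assms by (simp add: comod_hom_def Q_mult m_assoc Q_comodule delta_Q_left)

text \<open>The arrow equation turns \<open>\<Q> s \<otimes> u\<close> into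
  \<open>\<delta> \<otimes> s\<close>, and \<open>\<Q> \<epsilon>\<close> is a left inverse of
  \<open>\<delta>\<close>.\<close>

lemma comod_hom_coord:
  assumes "comodule u" "s \<in> comod_hom A u \<delta>"
  shows "s = \<Q> (\<epsilon> \<otimes> s) \<otimes> u"
proof -
  have "\<Q> (\<epsilon> \<otimes> s) \<otimes> u = \<Q> \<epsilon> \<otimes> \<delta> \<otimes> s"
    using assms by (auto simp: comod_hom_def Q_mult m_assoc)
  then show ?thesis
    using assms by (simp add: Q_eps_delta comod_hom_def)
qed

lemma comod_hom_cases:
  assumes "s \<in> comod_hom A u \<delta>" "comodule u"
  obtains a where "a \<in> carrier A" "s = \<Q> a \<otimes> u"
  using comod_hom_coord[OF assms(2,1)] comod_hom_closed[OF assms(1)] by (metis eps_closed m_closed)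

lemma eps_Q_comodule: "\<lbrakk>comodule u; a \<in> carrier A\<rbrakk> \<Longrightarrow> \<epsilon> \<otimes> (\<Q> a \<otimes> u) = a"
  using eps_Q_left[of a u] by (simp add: eps_comodule)

lemma Q_comodule_inj:
  assumes "comodule u" "a \<in> carrier A" "b \<in> carrier A"
  shows "\<Q> a \<otimes> u = \<Q> b \<otimes> u \<longleftrightarrow> a = b"
  using assms eps_Q_comodule by metis

lemma S_Q_comodule:
  assumes "comodule u" "a \<in> carrier A" "b \<in> carrier A"
  shows "\<S> a \<otimes> (\<Q> b \<otimes> u) = \<Q> (b \<otimes> (\<epsilon> \<otimes> (\<T> a \<otimes> u))) \<otimes> u"
proof -
  have "\<S> a \<otimes> (\<Q> b \<otimes> u) = \<Q> b \<otimes> (\<S> a \<otimes> u)"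
    using assms by (intro left_assoc2[OF S_Q_commute]) simp_all
  then show ?thesis
    using assms by (simp add: S_alt m_assoc Q_mult Q_comodule)
qed

lemma Q_delta_Q_comodule:
  assumes "comodule u" "a \<in> carrier A" "b \<in> carrier A"
  shows "\<Q> a \<otimes> \<delta> \<otimes> (\<Q> b \<otimes> u) = \<Q> (a \<otimes> (\<Q> b \<otimes> u)) \<otimes> u"
  using assms by (simp add: m_assoc delta_Q_left Q_mult Q_comodule)

text \<open>\<open>comodule_slide\<close> cancels the \<open>u \<otimes> \<epsilon>\<close> in the
  tensor product of arrows, and \<open>gamma_T_comodule\<close> assembles
  \<open>u \<circledcirc> v\<close> from what is left.\<close>

lemma mu_tens_coord:
  assumes "comodule u" "comodule v" "a \<in> carrier A" "b \<in> carrier A"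
  shows "\<mu> \<otimes> (\<Q> a \<otimes> u \<otimes> \<epsilon> \<otimes> \<T> (\<Q> b \<otimes> v) \<otimes> u) = \<Q> (a \<otimes> (\<epsilon> \<otimes> (\<T> b \<otimes> u))) \<otimes> (u \<circledcirc> v)"
proof -
  have "\<mu> \<otimes> (\<Q> a \<otimes> u \<otimes> \<epsilon> \<otimes> \<T> (\<Q> b \<otimes> v) \<otimes> u) = \<Q> a \<otimes> (\<mu> \<otimes> (\<T> (\<Q> b \<otimes> v) \<otimes> u))"
    using assms by (simp add: m_assoc comodule_slide mu_Q_left)
  also have "\<dots> = \<Q> a \<otimes> (\<Q> (\<epsilon> \<otimes> \<T> b) \<otimes> (\<gamma> \<otimes> (\<T> v \<otimes> u)))"
    using assms by (simp add: T_mult m_assoc left_assoc2[OF mu_TQ])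
  finally show ?thesis
    using assms by (simp add: gamma_T_comodule Q_mult vtens_def m_assoc)
qed

end


section \<open>The functor to bisets\<close>

locale skew_biset_tensor = skew_monoidal_monoid A + biset_tensor A p
  for A :: "('u, 'z) skew_monoid_scheme" (structure) and p :: "'u \<times> 'u \<Rightarrow> 'u"
begin

abbreviation H :: "'u \<Rightarrow> 'u biset" where
  "H \<equiv> hom_biset A"

abbreviation hom_ten :: "'u \<Rightarrow> 'u \<Rightarrow> 'u \<Rightarrow> 'u" where
  "hom_ten \<equiv> FTen (hom_functor A p)"

declare Q_comodule_hom [simp] Q_comodule_inj [simp]

section \<open>Hom-bisets and structure maps in coordinates\<close>

lemma carrier_hom_biset [simp]: "carrier (H u) = comod_hom A u \<delta>"
  by (simp add: hom_biset_def)

lemma lact_hom_biset [simp]: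
  "\<lbrakk>comodule u; a \<in> carrier A; b \<in> carrier A\<rbrakk> \<Longrightarrow> lact (H u) a (\<Q> b \<otimes> u) = \<Q> (a \<otimes> b) \<otimes> u"
  by (simp add: hom_biset_def Q_mult m_assoc)

lemma ract_hom_biset [simp]:
  "\<lbrakk>comodule u; a \<in> carrier A; b \<in> carrier A\<rbrakk> \<Longrightarrow>
    ract (H u) (\<Q> b \<otimes> u) a = \<Q> (b \<otimes> (\<epsilon> \<otimes> (\<T> a \<otimes> u))) \<otimes> u"
  by (simp add: hom_biset_def S_Q_comodule)

lemma is_biset_hom [simp]:
  assumes u: "comodule u"
  shows "is_biset A (H u)"
proof -
  have "lact (H u) \<in> carrier A \<rightarrow>\<^sub>E comod_hom A u \<delta> \<rightarrow>\<^sub>E comod_hom A u \<delta>"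
    using u by (auto intro!: PiE_I elim!: comod_hom_cases) (auto simp: hom_biset_def)
  moreover have "ract (H u) \<in> comod_hom A u \<delta> \<rightarrow>\<^sub>E carrier A \<rightarrow>\<^sub>E comod_hom A u \<delta>"
    using u by (auto intro!: PiE_I elim!: comod_hom_cases) (auto simp: hom_biset_def)
  ultimately show ?thesis
    using u unfolding is_biset_def
    by (auto elim!: comod_hom_cases simp: m_assoc eps_comodule T_mult comodule_slide)
qed

lemma biset_hom_Id_hom [simp]:
  "comodule u \<Longrightarrow> (\<lambda>s \<in> comod_hom A u \<delta>. s) \<in> biset_hom A (H u) (H u)"
  using biset_hom_Id[OF is_biset_hom] by simp

lemma hom_functor_simps [simp]:
  "FOb (hom_functor A p) = H" "FArr (hom_functor A p) u v s = (\<lambda>t \<in> comod_hom A u \<delta>. t \<otimes> s)"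
  "FUnit (hom_functor A p) = (\<lambda>a \<in> carrier A. \<Q> a \<otimes> \<eta>)"
  by (simp_all add: hom_functor_def)

lemma hom_ten_extensional [simp]: "hom_ten u v \<in> extensional (tens_carrier A p (H u) (H v))"
  by (simp add: hom_functor_def)

lemma hom_ten_apply [simp]:
  assumes "comodule u" "comodule v" "a \<in> carrier A" "b \<in> carrier A"
  shows "hom_ten u v (tensor_el (H u) (H v) (\<Q> a \<otimes> u) (\<Q> b \<otimes> v)) =
    \<Q> (a \<otimes> (\<epsilon> \<otimes> (\<T> b \<otimes> u))) \<otimes> (u \<circledcirc> v)"
proof -
  have "balanced A (H u) (H v) (\<lambda>s t. \<mu> \<otimes> (s \<otimes> \<epsilon> \<otimes> \<T> t \<otimes> u))"
    using assms
    by (intro balancedI)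
       (auto elim!: comod_hom_cases simp: mu_tens_coord, simp add: T_mult m_assoc comodule_slide)
  then show ?thesis
    using assms by (simp add: hom_functor_def tens_map_apply mu_tens_coord)
qed

lemma hom_ten_biset_hom:
  assumes "comodule u" "comodule v"
  shows "hom_ten u v \<in> biset_hom A (H u \<odot> H v) (H (u \<circledcirc> v))"
  using assms
  by (intro biset_hom_tensorI)
     (auto elim!: comod_hom_cases simp: m_assoc T_mult comodule_slide_vtens)

lemma hom_tens_cases:
  assumes "z \<in> tens_carrier A p (H u) (H v)" "comodule u" "comodule v"
  obtains a where "a \<in> carrier A" "z = tensor_el (H u) (H v) (\<Q> a \<otimes> u) v"
proof -
  obtain a b where ab: "a \<in> carrier A" "b \<in> carrier A"
    and z: "z = tensor_el (H u) (H v) (\<Q> a \<otimes> u) (\<Q> b \<otimes> v)"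
    using assms by (auto elim!: tens_cases comod_hom_cases)
  \<comment> \<open>\<open>v\<close> is written as \<open>\<Q> \<one> \<otimes> v\<close> so that
    the coordinate formulas for the actions apply to it.\<close>
  have "z = tensor_el (H u) (H v) (\<Q> (a \<otimes> (\<epsilon> \<otimes> (\<T> b \<otimes> u))) \<otimes> u) (\<Q> \<one> \<otimes> v)"
    using tens_balance[of "\<Q> a \<otimes> u" "H u" b "\<Q> \<one> \<otimes> v" "H v"] ab z assms(2,3)
      Q_comodule_hom[of v \<one>] lact_hom_biset[of v b \<one>]
    by simp
  then show thesis
    using that[of "a \<otimes> (\<epsilon> \<otimes> (\<T> b \<otimes> u))"] ab assms by simp
qed

lemma hom_ten_bij:
  assumes "comodule u" "comodule v"
  shows "bij_betw (hom_ten u v) (tens_carrier A p (H u) (H v)) (comod_hom A (u \<circledcirc> v) \<delta>)"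
proof (rule bij_betwI[where g = "\<lambda>w. tensor_el (H u) (H v) (\<Q> (\<epsilon> \<otimes> w) \<otimes> u) v"])
  have v: "v \<in> comod_hom A v \<delta>"
    using Q_comodule_hom[of v \<one>] assms by simp
  \<comment> \<open>With right factor \<open>v\<close> the structure map keeps the coordinate,
    because \<open>\<epsilon> \<otimes> u = \<one>\<close>. Bijectivity is then existence and
    uniqueness of coordinates.\<close>
  have ten: "hom_ten u v (tensor_el (H u) (H v) (\<Q> a \<otimes> u) v) = \<Q> a \<otimes> (u \<circledcirc> v)" if "a \<in> carrier A" for a
    using hom_ten_apply[of u v a \<one>] that assms by (simp add: eps_comodule)
  show "hom_ten u v \<in> tens_carrier A p (H u) (H v) \<rightarrow> comod_hom A (u \<circledcirc> v) \<delta>"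
    using assms by (auto elim!: hom_tens_cases simp: ten)
  show "(\<lambda>w. tensor_el (H u) (H v) (\<Q> (\<epsilon> \<otimes> w) \<otimes> u) v) \<in> comod_hom A (u \<circledcirc> v) \<delta> \<rightarrow> tens_carrier A p (H u) (H v)"
    using assms v by (auto simp: comod_hom_closed)
  show "tensor_el (H u) (H v) (\<Q> (\<epsilon> \<otimes> hom_ten u v z) \<otimes> u) v = z" if "z \<in> tens_carrier A p (H u) (H v)" for z
    using that assms by (auto elim!: hom_tens_cases simp: ten eps_Q_comodule)
  show "hom_ten u v (tensor_el (H u) (H v) (\<Q> (\<epsilon> \<otimes> w) \<otimes> u) v) = w" if "w \<in> comod_hom A (u \<circledcirc> v) \<delta>" for w
    using that assms comod_hom_coord[of "u \<circledcirc> v" w] by (simp add: ten comod_hom_closed)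
qed

text \<open>In coordinates, precomposition is right multiplication by \<open>s\<close>, since the
  arrow equation trades \<open>u \<otimes> s\<close> for \<open>\<Q> s \<otimes> v\<close>.\<close>

lemma comod_hom_precomp:
  assumes "comodule u" "comodule v" "s \<in> comod_hom A v u" "a \<in> carrier A"
  shows "\<Q> a \<otimes> u \<otimes> s = \<Q> (a \<otimes> s) \<otimes> v"
proof -
  have "s \<in> carrier A" "u \<otimes> s = \<Q> s \<otimes> v"
    using assms by (auto simp: comod_hom_def)
  then show ?thesis
    using assms by (simp add: Q_mult m_assoc)
qed

lemma precomp_biset_hom:
  assumes "comodule u" "comodule v" "s \<in> comod_hom A v u"
  shows "(\<lambda>t \<in> comod_hom A u \<delta>. t \<otimes> s) \<in> biset_hom A (H u) (H v)"
proof -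
  have s: "s \<in> carrier A" "u \<otimes> s = \<Q> s \<otimes> v"
    using assms(3) by (auto simp: comod_hom_def)
  \<comment> \<open>Needed for right linearity: \<open>s\<close> leaves the coefficient of the right
    action, first as \<open>\<Q> s\<close> across \<open>\<T> a\<close> and then through
    \<open>\<epsilon>\<close>.\<close>
  have slide: "\<epsilon> \<otimes> (\<T> a \<otimes> (u \<otimes> s)) = s \<otimes> (\<epsilon> \<otimes> (\<T> a \<otimes> v))" if "a \<in> carrier A" for a
    using that assms s eps_Q_left[of s "\<T> a \<otimes> v"] by (simp add: TQ_commute_left)
  show ?thesis
    using assms s(1)
    by (intro biset_homI)
       (auto elim!: comod_hom_cases simp: comod_hom_precomp, simp_all add: m_assoc slide)
qed

lemma cat_functor_hom: "cat_functor (op_moncat (comod_cat A)) bisets (hom_functor A p)"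
proof (intro cat_functor.intro cat_functor_axioms.intro)
  show "category (op_moncat (comod_cat A))" "category bisets"
    using monoidal_category_op_comod monoidal_category_bisets by (simp_all add: monoidal_category_def)
qed (auto simp: precomp_biset_hom compose_def comod_hom_closed m_assoc comod_hom_comp intro!: restrict_ext)

lemma hom_unit_biset_hom: "(\<lambda>a \<in> carrier A. \<Q> a \<otimes> \<eta>) \<in> biset_hom A (biset_unit A) (H \<eta>)"
  by (rule biset_homI) (auto simp: eps_eta left_assoc1[OF eps_eta] simp flip: eta_T)

lemma hom_unit_bij: "bij_betw (\<lambda>a \<in> carrier A. \<Q> a \<otimes> \<eta>) (carrier A) (comod_hom A \<eta> \<delta>)"
  by (rule bij_betwI[where g = "\<lambda>s. \<epsilon> \<otimes> s"])
     (auto simp: comod_hom_closed eps_Q_comodule simp flip: comod_hom_coord)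

theorem strong_monoidal_hom_functor:
  "strong_monoidal_functor (op_moncat (comod_cat A)) bisets (hom_functor A p)"
proof (intro strong_monoidal_functor.intro strong_monoidal_functor_axioms.intro monoidal_category_op_comod
    monoidal_category_bisets cat_functor_hom, goal_cases)
  case (1 X Y)
  then show ?case by (simp add: biset_iso_iff hom_ten_biset_hom hom_ten_bij)
next
  case 2
  show ?case using hom_unit_bij hom_unit_biset_hom by (simp add: biset_iso_iff)
next
  case (3 X X' Y Y' f g)
  \<comment> \<open>In coordinates, naturality of the structure map is the interchange law, with
    \<open>a\<close> and \<open>b\<close> in place of the outer arrows.\<close>
  then have "a \<otimes> f \<otimes> (\<epsilon> \<otimes> (\<T> (b \<otimes> g) \<otimes> X')) = a \<otimes> (\<epsilon> \<otimes> (\<T> b \<otimes> X)) \<otimes> (f \<otimes> \<epsilon> \<otimes> \<T> g \<otimes> X')"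
    if "a \<in> carrier A" "b \<in> carrier A" for a b
    using that comod_tens_comp[of X' X g a b f] by (simp add: comod_hom_closed m_assoc)
  with 3 show ?case
    by (intro tens_ext[where X = "H X" and Y = "H Y"])
       (auto elim!: comod_hom_cases simp: compose_eq TenA_apply precomp_biset_hom comod_hom_precomp comod_hom_closed
      comod_hom_tens comod_hom_precomp[of "X \<circledcirc> Y" "X' \<circledcirc> Y'"])
next
  case (4 X Y Z)
  then show ?case
    by (intro tens_ext[where X = "H X \<odot> H Y" and Y = "H Z"])
       (auto elim!: tens_cases comod_hom_cases simp: compose_eq TenA_apply Assoc_apply hom_ten_biset_hom
      comodule_slide_vtens T_mult m_assoc vtens_assoc)
next
  case (5 X)
  then show ?case
    by (intro tens_ext[where X = "biset_unit A" and Y = "H X"])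
       (auto elim!: comod_hom_cases simp: compose_eq TenA_apply LUnit_apply hom_unit_biset_hom eta_vtens left_assoc1[OF eps_eta]
       simp flip: eta_T)
next
  case (6 X)
  then show ?case
    by (intro tens_ext[where X = "H X" and Y = "biset_unit A"])
       (auto elim!: comod_hom_cases simp: compose_eq TenA_apply RUnit_apply hom_unit_biset_hom vtens_eta)
qed

end


section \<open>Modules over the bialgebroid\<close>

lemma is_lset_laws:
  assumes "is_lset B X" "x \<in> carrier X"
  shows lset_closed: "f \<in> carrier B \<Longrightarrow> act X f x \<in> carrier X"
    and lset_one: "act X \<one>\<^bsub>B\<^esub> x = x"
    and lset_mult: "\<lbrakk>f \<in> carrier B; g \<in> carrier B\<rbrakk> \<Longrightarrow> act X (f \<otimes>\<^bsub>B\<^esub> g) x = act X f (act X g x)"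
  using assms unfolding is_lset_def by (blast dest: PiE_mem)+

text \<open>Extensionality fixes the actions off the carriers, so agreement on elements gives
  equality of records rather than an isomorphism. Underlying bisets can then be replaced by equals
  in tensor products and hom-sets.\<close>

lemma biset_eqI:
  assumes "is_biset A X" "is_biset A Y" "carrier X = carrier Y"
    and "\<And>a x. \<lbrakk>a \<in> carrier A; x \<in> carrier Y\<rbrakk> \<Longrightarrow> lact X a x = lact Y a x"
    and "\<And>a x. \<lbrakk>a \<in> carrier A; x \<in> carrier Y\<rbrakk> \<Longrightarrow> ract X x a = ract Y x a"
  shows "X = Y"
proof (rule biset.equality)
  have ext: "lact Z \<in> extensional (carrier A)" "a \<in> carrier A \<Longrightarrow> lact Z a \<in> extensional (carrier Z)"
    "ract Z \<in> extensional (carrier Z)" "z \<in> carrier Z \<Longrightarrow> ract Z z \<in> extensional (carrier A)"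
    if "is_biset A Z" for Z :: "'a biset" and a z
    using that unfolding is_biset_def by (auto simp: PiE_iff)
  show "lact X = lact Y"
  proof (rule extensionalityI[OF ext(1)[OF assms(1)] ext(1)[OF assms(2)]])
    show "lact X a = lact Y a" if "a \<in> carrier A" for a
      using ext(2)[OF assms(1) that] ext(2)[OF assms(2) that] assms(3,4) that
      by (intro extensionalityI[where A = "carrier Y"]) simp_all
  qed
  show "ract X = ract Y"
  proof (rule extensionalityI[where A = "carrier Y"])
    show "ract X x = ract Y x" if "x \<in> carrier Y" for x
      using ext(4)[OF assms(1), of x] ext(4)[OF assms(2) that] assms(3,5) that
      by (intro extensionalityI[where A = "carrier A"]) simp_all
  qed (use ext(3)[OF assms(1)] ext(3)[OF assms(2)] assms(3) in simp_all)
qed (use assms in simp_all)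

context skew_biset_tensor
begin

abbreviation B :: "'u bialgebroid" where
  "B \<equiv> assoc_bialgebroid A p"

abbreviation U :: "'u lset \<Rightarrow> 'u biset" where
  "U \<equiv> lset_biset A B"

abbreviation ltens :: "'u lset \<Rightarrow> 'u lset \<Rightarrow> 'u lset"  (infixl "\<boxdot>" 70) where
  "X \<boxdot> Y \<equiv> lset_tens A p B X Y"

abbreviation I :: "'u lset" where
  "I \<equiv> lset_unit A B"

section \<open>The monoid \<open>F\<close> and its action on modules\<close>

lemma bialgebroid_simps [simp]:
  "carrier B = comod_hom A \<delta> \<delta>" "f \<otimes>\<^bsub>B\<^esub> g = f \<otimes> g" "\<one>\<^bsub>B\<^esub> = \<one>" "source B = \<Q>" "target B = \<S>"
  "counit B f = \<epsilon> \<otimes> f \<otimes> \<eta>"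
  by (simp_all add: assoc_bialgebroid_def)

lemma Q_mem_bialgebroid [simp]: "a \<in> carrier A \<Longrightarrow> \<Q> a \<in> comod_hom A \<delta> \<delta>"
  and S_mem_bialgebroid [simp]: "a \<in> carrier A \<Longrightarrow> \<S> a \<in> comod_hom A \<delta> \<delta>"
  and delta_mem_bialgebroid [simp]: "\<delta> \<in> comod_hom A \<delta> \<delta>"
  by (simp_all add: comod_hom_def delta_Q delta_S delta_delta)

lemma act_closed [simp]:
  "\<lbrakk>is_lset B X; f \<in> comod_hom A \<delta> \<delta>; x \<in> carrier X\<rbrakk> \<Longrightarrow> act X f x \<in> carrier X"
  using lset_closed by fastforce

lemma act_one [simp]: "\<lbrakk>is_lset B X; x \<in> carrier X\<rbrakk> \<Longrightarrow> act X \<one> x = x"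
  using lset_one by fastforce

lemma act_mult:
  "\<lbrakk>is_lset B X; f \<in> comod_hom A \<delta> \<delta>; g \<in> comod_hom A \<delta> \<delta>; x \<in> carrier X\<rbrakk>
    \<Longrightarrow> act X (f \<otimes> g) x = act X f (act X g x)"
  using lset_mult[of B X x f g] by simp

text \<open>The relations of \<open>F\<close> read on a module. The exchange rules move source
  elements outwards, and \<open>act_S_delta\<close> removes \<open>\<S>\<close> in front of
  \<open>\<delta>\<close>, so that different words reach comparable forms.\<close>

lemma act_rules:
  assumes "is_lset B X" "x \<in> carrier X"
  shows act_Q_delta: "a \<in> carrier A \<Longrightarrow> act X (\<Q> a \<otimes> \<delta>) x = act X (\<Q> a) (act X \<delta> x)"
    and act_S_delta: "a \<in> carrier A \<Longrightarrow> act X (\<S> a) (act X \<delta> x) = act X (\<Q> (\<T> a)) (act X \<delta> x)"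
    and act_delta_S: "a \<in> carrier A \<Longrightarrow> act X \<delta> (act X (\<S> a) x) = act X (\<Q> (\<S> a)) (act X \<delta> x)"
    and act_delta_Q: "a \<in> carrier A \<Longrightarrow> act X \<delta> (act X (\<Q> a) x) = act X (\<Q> (\<Q> a)) (act X \<delta> x)"
    and act_S_Q: "\<lbrakk>a \<in> carrier A; b \<in> carrier A\<rbrakk> \<Longrightarrow> act X (\<S> a) (act X (\<Q> b) x) = act X (\<Q> b) (act X (\<S> a) x)"
    and act_Q_Q: "\<lbrakk>a \<in> carrier A; b \<in> carrier A\<rbrakk> \<Longrightarrow> act X (\<Q> a) (act X (\<Q> b) x) = act X (\<Q> (a \<otimes> b)) x"
    and act_S_S: "\<lbrakk>a \<in> carrier A; b \<in> carrier A\<rbrakk> \<Longrightarrow> act X (\<S> a) (act X (\<S> b) x) = act X (\<S> (b \<otimes> a)) x"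
    and act_delta_delta: "act X \<delta> (act X \<delta> x) = act X (\<Q> \<delta>) (act X \<delta> x)"
    and act_S: "a \<in> carrier A \<Longrightarrow> act X (\<S> a) x = act X (\<Q> (\<epsilon> \<otimes> \<T> a)) (act X \<delta> x)"
    and act_Q_eps_delta: "act X (\<Q> \<epsilon>) (act X \<delta> x) = x"
proof -
  show "act X (\<S> a) x = act X (\<Q> (\<epsilon> \<otimes> \<T> a)) (act X \<delta> x)" if "a \<in> carrier A"
    using assms that by (simp add: S_alt act_mult)
qed (use assms in \<open>simp_all add: S_delta delta_S delta_Q S_Q_commute Q_mult S_mult delta_delta Q_eps_delta
    flip: act_mult\<close>)

lemma bialgebroid_cases:
  assumes "f \<in> comod_hom A \<delta> \<delta>"
  obtains a where "a \<in> carrier A" "f = \<Q> a \<otimes> \<delta>"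
  using comod_hom_cases[OF assms] by auto

lemma lset_biset_simps [simp]:
  "carrier (U X) = carrier X"
  "\<lbrakk>a \<in> carrier A; x \<in> carrier X\<rbrakk> \<Longrightarrow> lact (U X) a x = act X (\<Q> a) x"
  "\<lbrakk>a \<in> carrier A; x \<in> carrier X\<rbrakk> \<Longrightarrow> ract (U X) x a = act X (\<S> a) x"
  by (simp_all add: lset_biset_def)

lemma is_biset_lset [simp]:
  assumes "is_lset B X"
  shows "is_biset A (U X)"
proof -
  have "lact (U X) \<in> carrier A \<rightarrow>\<^sub>E carrier X \<rightarrow>\<^sub>E carrier X" "ract (U X) \<in> carrier X \<rightarrow>\<^sub>E carrier A \<rightarrow>\<^sub>E carrier X"
    using assms by (auto intro!: PiE_I) (auto simp: lset_biset_def)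
  then show ?thesis
    using assms unfolding is_biset_def by (auto simp: S_one act_Q_Q act_S_S act_S_Q)
qed

section \<open>Tensor products of \<open>F\<close>-sets\<close>

lemma tens_slide:
  assumes "is_lset B X" "is_lset B Y" "x \<in> carrier X" "y \<in> carrier Y" "a \<in> carrier A"
  shows "tensor_el (U X) (U Y) x (act Y (\<Q> a) y) = tensor_el (U X) (U Y) (act X (\<S> a) x) y"
  using assms tens_balance[of x "U X" a y "U Y"] by simp

text \<open>Decoding the comultiplication yields only some representative. Balancedness in the two
  Sweedler factors permits using the intended one,
  \<open>\<Q> (a \<otimes> \<mu>) \<otimes> \<delta>\<close> and \<open>\<delta>\<close>.\<close>

lemma comult_rep:
  assumes "is_lset B X" "is_lset B Y" "x \<in> carrier X" "y \<in> carrier Y" "a \<in> carrier A"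
  shows "(case the_inv p (comult B (\<Q> a \<otimes> \<delta>)) of (f1, f2) \<Rightarrow>
      tensor_el (U X) (U Y) (act X f1 x) (act Y f2 y)) =
    tensor_el (U X) (U Y) (act X (\<Q> (a \<otimes> \<mu>)) (act X \<delta> x)) (act Y \<delta> y)"
proof -
  have "comult B (\<Q> a \<otimes> \<delta>) = tensor_el (H \<delta>) (H \<delta>) (\<Q> (a \<otimes> \<mu>) \<otimes> \<delta>) \<delta>"
    using assms(5) by (simp add: assoc_bialgebroid_def eps_Q_comodule)
  moreover have "balanced A (H \<delta>) (H \<delta>) (\<lambda>f1 f2. tensor_el (U X) (U Y) (act X f1 x) (act Y f2 y))"
    using assms by (intro balancedI) (simp add: hom_biset_def act_mult tens_slide)
  ultimately show ?thesis
    using assms by (simp add: tens_rep_invariant act_Q_delta)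
qed

text \<open>Well-definedness over the tensor sign is the Takeuchi condition for the
  comultiplication. Comparing the coefficients of the left factor, with a scalar \<open>c\<close> on
  either side of the sign, leaves
  \<open>\<mu> \<otimes> \<S> c = \<mu> \<otimes> \<T> (\<Q> c)\<close>, which is
  \<open>mu_S\<close>.\<close>

lemma act_tensor:
  assumes "is_lset B X" "is_lset B Y" "x \<in> carrier X" "y \<in> carrier Y" "a \<in> carrier A"
  shows "act (X \<boxdot> Y) (\<Q> a \<otimes> \<delta>) (tensor_el (U X) (U Y) x y) =
    tensor_el (U X) (U Y) (act X (\<Q> (a \<otimes> \<mu>)) (act X \<delta> x)) (act Y \<delta> y)"
proof -
  let ?h = "\<lambda>x y. tensor_el (U X) (U Y) (act X (\<Q> (a \<otimes> \<mu>)) (act X \<delta> x)) (act Y \<delta> y)"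
  have "act (X \<boxdot> Y) (\<Q> a \<otimes> \<delta>) = tens_map A p (U X) (U Y) ?h"
    using assms by (simp add: lset_tens_def, intro tens_map_cong) (simp_all add: comult_rep)
  moreover have "balanced A (U X) (U Y) ?h"
    using assms
    by (intro balancedI) (simp add: act_delta_S act_delta_Q tens_slide act_S_Q act_S_delta act_Q_Q m_assoc mu_S)
  ultimately show ?thesis
    using assms by (simp add: tens_map_apply)
qed

lemma carrier_ltens [simp]: "carrier (X \<boxdot> Y) = tens_carrier A p (U X) (U Y)"
  by (simp add: lset_tens_def)

lemma act_tensor_delta:
  assumes "is_lset B X" "is_lset B Y" "U X = V" "U Y = W" "x \<in> carrier X" "y \<in> carrier Y"
  shows "act (X \<boxdot> Y) \<delta> (tensor_el V W x y) = tensor_el V W (act X (\<Q> \<mu>) (act X \<delta> x)) (act Y \<delta> y)"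
  using act_tensor[of X Y x y \<one>] assms by auto

lemma act_tensor_Q:
  assumes "is_lset B X" "is_lset B Y" "x \<in> carrier X" "y \<in> carrier Y" "a \<in> carrier A"
  shows "act (X \<boxdot> Y) (\<Q> a) (tensor_el (U X) (U Y) x y) = tensor_el (U X) (U Y) (act X (\<Q> a) x) y"
proof -
  have "\<Q> (a \<otimes> \<epsilon>) \<otimes> \<delta> = \<Q> a"
    using assms(5) by (simp add: Q_mult m_assoc Q_eps_delta)
  then have "act (X \<boxdot> Y) (\<Q> a) (tensor_el (U X) (U Y) x y) =
      tensor_el (U X) (U Y) (act X (\<Q> (a \<otimes> (\<epsilon> \<otimes> \<mu>))) (act X \<delta> x)) (act Y \<delta> y)"
    using act_tensor[OF assms(1-4), of "a \<otimes> \<epsilon>"] assms(5) by (simp add: m_assoc)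
  \<comment> \<open>By \<open>eps_mu\<close> the coefficient contains
    \<open>\<epsilon> \<otimes> \<T> \<epsilon>\<close>, so \<open>\<S> \<epsilon>\<close> acts on
    \<open>x\<close>. It crosses the tensor sign as \<open>\<Q> \<epsilon>\<close> and there cancels
    the \<open>\<delta>\<close> on \<open>y\<close>.\<close>
  also have "\<dots> = tensor_el (U X) (U Y) (act X (\<Q> a) x) (act Y (\<Q> \<epsilon>) (act Y \<delta> y))"
    using assms by (simp add: tens_slide act_S_Q) (simp add: act_S act_Q_Q eps_mu)
  finally show ?thesis
    using assms by (simp add: act_Q_eps_delta)
qed

lemma act_tensor_S:
  assumes "is_lset B X" "is_lset B Y" "x \<in> carrier X" "y \<in> carrier Y" "a \<in> carrier A"
  shows "act (X \<boxdot> Y) (\<S> a) (tensor_el (U X) (U Y) x y) = tensor_el (U X) (U Y) x (act Y (\<S> a) y)"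
proof -
  have "act (X \<boxdot> Y) (\<S> a) (tensor_el (U X) (U Y) x y) =
      tensor_el (U X) (U Y) (act X (\<Q> (\<epsilon> \<otimes> \<T> a \<otimes> \<mu>)) (act X \<delta> x)) (act Y \<delta> y)"
    using act_tensor[OF assms(1-4), of "\<epsilon> \<otimes> \<T> a"] assms(5) by (simp add: S_alt)
  \<comment> \<open>The coefficient is again of the form \<open>\<epsilon> \<otimes> \<T> c\<close>,
    now with \<open>c = \<epsilon> \<otimes> \<T> a\<close>. Hence \<open>\<S> c\<close> acts on
    \<open>x\<close>, and sliding it across rebuilds \<open>\<S> a\<close> on
    \<open>y\<close>.\<close>
  also have "\<epsilon> \<otimes> \<T> a \<otimes> \<mu> = \<epsilon> \<otimes> \<T> (\<epsilon> \<otimes> \<T> a)"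
    using assms(5) by (simp add: m_assoc T_mult left_assoc2[OF eps_mu] flip: mu_TT)
  finally show ?thesis
    using assms by (simp add: act_S[of Y] act_S[of X] tens_slide)
qed

lemma is_lset_ltens [simp]:
  assumes "is_lset B X" "is_lset B Y"
  shows "is_lset B (X \<boxdot> Y)"
proof -
  have "act (X \<boxdot> Y) \<in> comod_hom A \<delta> \<delta> \<rightarrow>\<^sub>E tens_carrier A p (U X) (U Y) \<rightarrow>\<^sub>E tens_carrier A p (U X) (U Y)"
  proof (intro PiE_I)
    show "act (X \<boxdot> Y) f z \<in> tens_carrier A p (U X) (U Y)"
      if "f \<in> comod_hom A \<delta> \<delta>" "z \<in> tens_carrier A p (U X) (U Y)" for f z
      using that assms by (auto elim!: tens_cases bialgebroid_cases simp: act_tensor)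
  qed (auto simp: lset_tens_def tens_map_def)
  moreover have "act (X \<boxdot> Y) \<one> z = z" if "z \<in> tens_carrier A p (U X) (U Y)" for z
    using that assms act_tensor_Q[of X Y _ _ \<one>] by (auto elim!: tens_cases)
  moreover have "act (X \<boxdot> Y) (f \<otimes> g) z = act (X \<boxdot> Y) f (act (X \<boxdot> Y) g z)"
    if fg: "f \<in> comod_hom A \<delta> \<delta>" "g \<in> comod_hom A \<delta> \<delta>" and z: "z \<in> tens_carrier A p (U X) (U Y)" for f g z
  proof -
    obtain a b where ab [simp]: "a \<in> carrier A" "b \<in> carrier A" and f: "f = \<Q> a \<otimes> \<delta>" and g: "g = \<Q> b \<otimes> \<delta>"
      using fg by (auto elim!: bialgebroid_cases)
    \<comment> \<open>Multiplicativity of the comultiplication, read on the left factor: this is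
      \<open>delta_mu\<close> with \<open>\<gamma>\<close> split as
      \<open>\<mu> \<otimes> \<delta>\<close>. The factor \<open>\<T> \<delta>\<close> arises from
      \<open>\<Q> \<delta>\<close> sliding over from the right factor.\<close>
    have coeff: "a \<otimes> (\<Q> b \<otimes> (\<delta> \<otimes> \<mu>)) = a \<otimes> (\<mu> \<otimes> (\<Q> b \<otimes> (\<Q> \<mu> \<otimes> (\<delta> \<otimes> \<T> \<delta>))))"
      by (simp add: delta_mu mu_Q_left left_assoc1[OF mu_delta])
    obtain x y where "x \<in> carrier X" "y \<in> carrier Y" "z = tensor_el (U X) (U Y) x y"
      using z by (auto elim!: tens_cases)
    then show ?thesis
      using assms
      by (simp add: f g Q_delta_Q_delta act_tensor act_delta_Q act_delta_delta tens_slide act_S_Q act_S_delta act_Q_Q)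
         (simp add: Q_mult m_assoc coeff)
  qed
  ultimately show ?thesis
    by (simp add: is_lset_def)
qed

lemma lset_biset_ltens [simp]:
  assumes "is_lset B X" "is_lset B Y"
  shows "U (X \<boxdot> Y) = U X \<odot> U Y"
  using assms
  by (intro biset_eqI[of A]) (auto elim!: tens_cases simp: act_tensor_Q act_tensor_S)

section \<open>The unit \<open>F\<close>-set\<close>

lemma lset_unit_simps [simp]:
  "carrier I = carrier A"
  "\<lbrakk>f \<in> comod_hom A \<delta> \<delta>; a \<in> carrier A\<rbrakk> \<Longrightarrow> act I f a = \<epsilon> \<otimes> (f \<otimes> \<Q> a) \<otimes> \<eta>"
  by (simp_all add: lset_unit_def)

lemma act_unit_Q: "\<lbrakk>a \<in> carrier A; b \<in> carrier A\<rbrakk> \<Longrightarrow> act I (\<Q> a) b = a \<otimes> b"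
  using eps_Q_comodule[of \<eta> "a \<otimes> b"] by (simp add: Q_mult m_assoc)

lemma act_unit_delta: "a \<in> carrier A \<Longrightarrow> act I \<delta> a = \<Q> a \<otimes> \<eta>"
  by (simp add: m_assoc left_assoc1[OF eps_delta])

text \<open>Source and target elements commute, so \<open>b\<close> leaves through
  \<open>\<epsilon>\<close>; what remains is
  \<open>\<epsilon> \<otimes> \<S> a \<otimes> \<eta>\<close>, which collapses to \<open>a\<close>
  by \<open>eps_S\<close>, \<open>eta_T\<close> and \<open>eps_eta\<close>.\<close>

lemma act_unit_S: "\<lbrakk>a \<in> carrier A; b \<in> carrier A\<rbrakk> \<Longrightarrow> act I (\<S> a) b = b \<otimes> a"
proof -
  assume ab: "a \<in> carrier A" "b \<in> carrier A"
  then have "act I (\<S> a) b = b \<otimes> (\<epsilon> \<otimes> \<S> a \<otimes> \<eta>)"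
    using eps_Q_left[of b "\<S> a \<otimes> \<eta>"] by (simp add: S_Q_commute m_assoc)
  then show ?thesis
    using ab by (simp add: eps_S m_assoc left_assoc1[OF eps_eta] flip: eta_T)
qed

lemma is_lset_unit [simp]: "is_lset B I"
proof -
  have ext: "act I \<in> comod_hom A \<delta> \<delta> \<rightarrow>\<^sub>E carrier A \<rightarrow>\<^sub>E carrier A"
    by (auto simp: lset_unit_def comod_hom_closed)
  \<comment> \<open>\<open>a\<close> passes out through \<open>\<epsilon>\<close>, which then
    cancels \<open>\<delta>\<close>. In this form iterated actions can be compared with the product
    of coordinates in \<open>F\<close>.\<close>
  have coord: "act I (\<Q> a \<otimes> \<delta>) b = a \<otimes> (\<Q> b \<otimes> \<eta>)" if "a \<in> carrier A" "b \<in> carrier A" for a b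
    using that eps_Q_left[of a "\<delta> \<otimes> (\<Q> b \<otimes> \<eta>)"] by (simp add: m_assoc left_assoc1[OF eps_delta])
  have "act I (f \<otimes> g) c = act I f (act I g c)"
    if "f \<in> comod_hom A \<delta> \<delta>" "g \<in> comod_hom A \<delta> \<delta>" "c \<in> carrier A" for f g c
  proof -
    obtain a b where "a \<in> carrier A" "b \<in> carrier A" "f = \<Q> a \<otimes> \<delta>" "g = \<Q> b \<otimes> \<delta>"
      using \<open>f \<in> _\<close> \<open>g \<in> _\<close> by (auto elim!: bialgebroid_cases)
    then show ?thesis
      using \<open>c \<in> _\<close> by (simp add: Q_delta_Q_delta coord del: lset_unit_simps(2))
        (simp add: Q_mult m_assoc delta_Q_left Q_comodule)
  qed
  then show ?thesis
    using ext act_unit_Q[of \<one>] unfolding is_lset_def by (simp del: lset_unit_simps(2) add: lset_unit_simps(1))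
qed

lemma lset_biset_unit [simp]: "U I = biset_unit A"
  by (rule biset_eqI[of A]) (simp_all add: act_unit_Q act_unit_S del: lset_unit_simps(2))

declare lset_unit_simps(2) [simp del]

section \<open>The monoidal category of \<open>F\<close>-sets\<close>

abbreviation lsets :: "('u lset, 'u \<Rightarrow> 'u) moncat" where
  "lsets \<equiv> lset_cat A p B"

lemma lset_cat_simps [simp]:
  "Ob lsets = {X. is_lset B X}" "Hom lsets = lset_hom B" "Id lsets X = (\<lambda>x \<in> carrier X. x)"
  "Cmp lsets X Y Z g f = compose (carrier X) g f" "TenO lsets = lset_tens A p B"
  "TenA lsets X X' Y Y' f g = TenA bisets (U X) (U X') (U Y) (U Y') f g" "Unit lsets = I"
  "Assoc lsets X Y Z = Assoc bisets (U X) (U Y) (U Z)"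
  "LUnit lsets X = LUnit bisets (U X)" "RUnit lsets X = RUnit bisets (U X)"
  by (simp_all add: lset_cat_def)

lemma lset_hom_iff:
  assumes X: "is_lset B X" and Y: "is_lset B Y"
  shows "h \<in> lset_hom B X Y \<longleftrightarrow>
    h \<in> biset_hom A (U X) (U Y) \<and> (\<forall>x \<in> carrier X. h (act X \<delta> x) = act Y \<delta> (h x))"
proof
  assume "h \<in> lset_hom B X Y"
  then show "h \<in> biset_hom A (U X) (U Y) \<and> (\<forall>x \<in> carrier X. h (act X \<delta> x) = act Y \<delta> (h x))"
    unfolding lset_hom_def by (auto simp: PiE_iff intro!: biset_homI)
next
  assume h: "h \<in> biset_hom A (U X) (U Y) \<and> (\<forall>x \<in> carrier X. h (act X \<delta> x) = act Y \<delta> (h x))"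
  then have Q: "h (act X (\<Q> a) x) = act Y (\<Q> a) (h x)" if "a \<in> carrier A" "x \<in> carrier X" for a x
    using biset_hom_lact[of h A "U X" "U Y" a x] biset_hom_closed[of h A "U X" "U Y" x] that by simp
  show "h \<in> lset_hom B X Y"
    using h biset_homD(1,2)[of h A "U X" "U Y"] assms unfolding lset_hom_def
    by (auto simp: PiE_iff act_Q_delta Q elim!: bialgebroid_cases)
qed

lemma lset_hom_biset_hom:
  "\<lbrakk>is_lset B X; is_lset B Y; h \<in> lset_hom B X Y\<rbrakk> \<Longrightarrow> h \<in> biset_hom A (U X) (U Y)"
  by (simp add: lset_hom_iff)

lemma lset_homD:
  assumes "h \<in> lset_hom B X Y"
  shows lset_hom_closed: "x \<in> carrier X \<Longrightarrow> h x \<in> carrier Y"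
    and lset_hom_act: "\<lbrakk>f \<in> comod_hom A \<delta> \<delta>; x \<in> carrier X\<rbrakk> \<Longrightarrow> h (act X f x) = act Y f (h x)"
  using assms by (auto simp: lset_hom_def PiE_iff)

lemma lset_hom_Id: "is_lset B X \<Longrightarrow> (\<lambda>x \<in> carrier X. x) \<in> lset_hom B X X"
  by (simp add: lset_hom_def)

lemma lset_hom_compose:
  assumes "is_lset B X" "f \<in> lset_hom B X Y" "g \<in> lset_hom B Y Z"
  shows "compose (carrier X) g f \<in> lset_hom B X Z"
  using assms unfolding lset_hom_def
  by (auto simp: PiE_iff compose_eq)

lemma lset_isoI:
  assumes X: "is_lset B X" and Y: "is_lset B Y" and f: "f \<in> lset_hom B X Y" and "bij_betw f (carrier X) (carrier Y)"
  shows "is_iso_arrow lsets X Y f"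
proof -
  have "is_iso_arrow bisets (U X) (U Y) f"
    using assms by (simp add: biset_iso_iff lset_hom_biset_hom)
  then obtain g where g: "g \<in> biset_hom A (U Y) (U X)"
    and gf: "compose (carrier X) g f = (\<lambda>x\<in>carrier X. x)" and fg: "compose (carrier Y) f g = (\<lambda>x\<in>carrier Y. x)"
    by (auto simp: is_iso_arrow_def inverse_arrows_def)
  have g_mem: "y \<in> carrier Y \<Longrightarrow> g y \<in> carrier X" for y
    using biset_hom_closed[OF g] by simp
  have gf': "g (f x) = x" if "x \<in> carrier X" for x
    using fun_cong[OF gf, of x] that by (simp add: compose_eq)
  have fg': "f (g y) = y" if "y \<in> carrier Y" for y
    using fun_cong[OF fg, of y] that by (simp add: compose_eq)
  have "g (act Y \<delta> y) = act X \<delta> (g y)" if y: "y \<in> carrier Y" for y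
    using lset_hom_act[OF f, of \<delta> "g y"] gf'[of "act X \<delta> (g y)"] y X by (simp add: g_mem fg')
  then have "g \<in> lset_hom B Y X"
    using g X Y by (simp add: lset_hom_iff)
  then show ?thesis
    using f gf fg by (auto simp: is_iso_arrow_def inverse_arrows_def)
qed

lemma TenA_lset_hom:
  assumes "is_lset B X" "is_lset B X'" "is_lset B Y" "is_lset B Y'" "f \<in> lset_hom B X X'" "g \<in> lset_hom B Y Y'"
  shows "TenA bisets (U X) (U X') (U Y) (U Y') f g \<in> lset_hom B (X \<boxdot> Y) (X' \<boxdot> Y')"
  using assms
  by (subst lset_hom_iff)
     (auto simp: lset_hom_biset_hom TenA_biset_hom act_tensor_delta TenA_apply lset_hom_closed lset_hom_act elim!: tens_cases)

text \<open>Coassociativity tested on \<open>\<delta>\<close>: one bracketing puts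
  \<open>\<mu> \<otimes> \<mu>\<close> on the factor \<open>x\<close>, the other, after sliding,
  \<open>\<mu> \<otimes> \<T> \<mu>\<close>; these agree by \<open>mu_mu\<close>.\<close>

lemma Assoc_lset_hom:
  assumes "is_lset B X" "is_lset B Y" "is_lset B Z"
  shows "Assoc bisets (U X) (U Y) (U Z) \<in> lset_hom B ((X \<boxdot> Y) \<boxdot> Z) (X \<boxdot> (Y \<boxdot> Z))"
proof -
  have "Assoc bisets (U X) (U Y) (U Z) (act (X \<boxdot> Y \<boxdot> Z) \<delta> w) =
      act (X \<boxdot> (Y \<boxdot> Z)) \<delta> (Assoc bisets (U X) (U Y) (U Z) w)"
    if "w \<in> tens_carrier A p (U X \<odot> U Y) (U Z)" for w
  proof -
    obtain x y z where "x \<in> carrier X" "y \<in> carrier Y" "z \<in> carrier Z"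
      "w = tensor_el (U X \<odot> U Y) (U Z) (tensor_el (U X) (U Y) x y) z"
      using \<open>w \<in> _\<close> by (auto elim!: tens_cases)
    then show ?thesis
      using assms tens_slide[of X "Y \<boxdot> Z" "act X (\<Q> \<mu>) (act X \<delta> x)"
          "tensor_el (U Y) (U Z) (act Y \<delta> y) (act Z \<delta> z)" \<mu>]
      by (simp add: Assoc_apply act_tensor_delta act_tensor_Q act_S_Q act_S_delta act_Q_Q mu_mu)
  qed
  then show ?thesis
    using assms by (simp add: lset_hom_iff Assoc_biset_hom)
qed

text \<open>Commutation with \<open>\<delta>\<close> comes down to the unit law
  \<open>mu_eta\<close>, once \<open>\<Q> a\<close> has moved past \<open>\<mu>\<close>.\<close>

lemma LUnit_lset_hom:
  assumes "is_lset B X"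
  shows "LUnit bisets (U X) \<in> lset_hom B (I \<boxdot> X) X"
proof -
  have "\<mu> \<otimes> (\<Q> a \<otimes> \<eta>) = \<Q> a" if "a \<in> carrier A" for a
    using that by (simp add: mu_Q_left mu_eta)
  then show ?thesis
    using assms
    by (auto simp: lset_hom_iff LUnit_biset_hom LUnit_apply act_tensor_delta act_unit_delta act_unit_Q act_delta_Q
        elim!: tens_cases)
qed

text \<open>This accounts for the formula defining \<open>\<S>\<close>: the action of
  \<open>\<delta>\<close> on the class of \<open>(x, a)\<close> produces the coefficient
  \<open>\<mu> \<otimes> \<T> (\<Q> a \<otimes> \<eta>)\<close>, which is
  \<open>\<S> a\<close>.\<close>

lemma RUnit_lset_hom:
  assumes "is_lset B X"
  shows "RUnit bisets (U X) \<in> lset_hom B (X \<boxdot> I) X"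
  using assms
  by (auto simp: lset_hom_iff RUnit_biset_hom RUnit_apply act_tensor_delta act_unit_delta act_S_Q act_S_delta
      act_Q_Q act_delta_S elim!: tens_cases simp flip: S_map_def)

text \<open>Since \<open>lset_biset_ltens\<close> and \<open>lset_biset_unit\<close> are equalities,
  the equations are those of the underlying bisets; the work specific to \<open>F\<close> is the
  linearity of the structure maps.\<close>

theorem monoidal_category_lsets: "monoidal_category lsets"
proof -
  interpret bisets: monoidal_category bisets by (rule monoidal_category_bisets)
  note hom = lset_hom_biset_hom
  show ?thesis
  proof (intro monoidal_category.intro category.intro monoidal_category_axioms.intro, goal_cases)
    case (1 X) then show ?case by (simp add: lset_hom_Id)
  next
    case 2 then show ?case by (simp add: lset_hom_compose)
  next
    case (3 X Y f) then show ?case using bisets.Cmp_Id_left[of "U X" "U Y" f] by (simp add: hom)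
  next
    case (4 X Y f) then show ?case using bisets.Cmp_Id_right[of "U X" "U Y" f] by (simp add: hom)
  next
    case (5 W X Y Z f g h)
    then show ?case using bisets.Cmp_assoc[of "U W" "U X" "U Y" "U Z" f g h] by (simp add: hom)
  next
    case 6 then show ?case by simp
  next
    case 7 then show ?case by simp
  next
    case 8 then show ?case by (simp add: TenA_lset_hom)
  next
    case (9 X Y) then show ?case using bisets.TenA_Id[of "U X" "U Y"] by simp
  next
    case (10 X X' X'' Y Y' Y'' f f' g g')
    then show ?case
      using bisets.TenA_Cmp[of "U X" "U X'" "U X''" "U Y" "U Y'" "U Y''" f f' g g'] by (simp add: hom)
  next
    case 11 then show ?case by (simp add: lset_isoI Assoc_lset_hom Assoc_bij)
  next
    case (12 X) then show ?case using LUnit_bij[of "U X"] by (simp add: lset_isoI LUnit_lset_hom)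
  next
    case (13 X) then show ?case using RUnit_bij[of "U X"] by (simp add: lset_isoI RUnit_lset_hom)
  next
    case (14 X X' Y Y' Z Z' f g h)
    then show ?case
      using bisets.Assoc_nat[of "U X" "U X'" "U Y" "U Y'" "U Z" "U Z'" f g h] by (simp add: hom)
  next
    case (15 X X' f) then show ?case using bisets.LUnit_nat[of "U X" "U X'" f] by (simp add: hom)
  next
    case (16 X X' f) then show ?case using bisets.RUnit_nat[of "U X" "U X'" f] by (simp add: hom)
  next
    case (17 W X Y Z) then show ?case using bisets.pentagon[of "U W" "U X" "U Y" "U Z"] by simp
  next
    case (18 X Y) then show ?case using bisets.triangle[of "U X" "U Y"] by simp
  qed
qed

section \<open>The forgetful functor\<close>

lemma forgetful_simps [simp]:
  "FOb (forgetful A p B) = U" "FArr (forgetful A p B) X Y h = h"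
  "FTen (forgetful A p B) X Y = (\<lambda>z \<in> tens_carrier A p (U X) (U Y). z)"
  "FUnit (forgetful A p B) = (\<lambda>a \<in> carrier A. a)"
  by (simp_all add: forgetful_def)

theorem strong_monoidal_forgetful: "strong_monoidal_functor lsets bisets (forgetful A p B)"
proof -
  interpret bisets: monoidal_category bisets by (rule monoidal_category_bisets)
  interpret lsets: monoidal_category lsets by (rule monoidal_category_lsets)
  show ?thesis
  proof (intro strong_monoidal_functor.intro strong_monoidal_functor_axioms.intro cat_functor.intro
      cat_functor_axioms.intro monoidal_category_bisets monoidal_category_lsets
      bisets.category_axioms lsets.category_axioms, goal_cases)
    case (1 X) then show ?case by simp
  next
    case 2 then show ?case by (simp add: lset_hom_biset_hom)
  next
    case 3 then show ?case by simp
  next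
    case 4 then show ?case by simp
  next
    case (5 X Y) then show ?case using biset_hom_Id[of A "U X \<odot> U Y"] by (simp add: biset_iso_iff bij_betw_def inj_on_def)
  next
    case 6 then show ?case by (simp add: biset_iso_iff bij_betw_def inj_on_def)
  next
    case (7 X X' Y Y' f g)
    then show ?case
    by (intro tens_ext[where X = "U X" and Y = "U Y"])
       (auto simp: compose_eq TenA_apply lset_hom_biset_hom lset_hom_closed)
  next
    case (8 X Y Z)
    then show ?case
      using biset_hom_Id[of A "U X \<odot> U Y"] biset_hom_Id[of A "U Y \<odot> U Z"] biset_hom_Id[of A "U X"] biset_hom_Id[of A "U Z"]
    by (intro tens_ext[where X = "U X \<odot> U Y" and Y = "U Z"])
       (auto simp: compose_eq TenA_apply Assoc_apply elim!: tens_cases)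
  next
    case (9 X)
    then show ?case
      using biset_hom_Id[of A "U X"]
      by (intro tens_ext[where X = "biset_unit A" and Y = "U X"]) (auto simp: compose_eq TenA_apply LUnit_apply)
  next
    case (10 X)
    then show ?case
      using biset_hom_Id[of A "U X"]
      by (intro tens_ext[where X = "U X" and Y = "biset_unit A"]) (auto simp: compose_eq TenA_apply RUnit_apply)
  qed
qed

end


section \<open>The equivalence\<close>

lemma full_subcat_simps [simp]:
  "Ob (full_subcat C P) = {X \<in> Ob C. P X}" "Hom (full_subcat C P) = Hom C" "Id (full_subcat C P) = Id C"
  "Cmp (full_subcat C P) = Cmp C" "TenO (full_subcat C P) = TenO C" "TenA (full_subcat C P) = TenA C"
  "Unit (full_subcat C P) = Unit C" "Assoc (full_subcat C P) = Assoc C"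
  "LUnit (full_subcat C P) = LUnit C" "RUnit (full_subcat C P) = RUnit C"
  "is_iso_arrow (full_subcat C P) X Y f = is_iso_arrow C X Y f"
  by (simp_all add: full_subcat_def is_iso_arrow_def inverse_arrows_def)

lemma monoidal_category_full_subcat:
  assumes "monoidal_category C" "P (Unit C)"
    and closed: "\<And>X Y. \<lbrakk>X \<in> Ob C; Y \<in> Ob C; P X; P Y\<rbrakk> \<Longrightarrow> P (TenO C X Y)"
  shows "monoidal_category (full_subcat C P)"
proof -
  interpret monoidal_category C by fact
  show ?thesis
    by (intro monoidal_category.intro category.intro monoidal_category_axioms.intro)
       (simp_all add: assms(2) closed Id_in Cmp_in Cmp_Id_left Cmp_Id_right Cmp_assoc Unit_ob TenO_ob TenA_in TenA_Id
         TenA_Cmp Assoc_iso LUnit_iso RUnit_iso Assoc_nat LUnit_nat RUnit_nat pentagon triangle)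
qed

lemma is_iso_arrow_sym: "inverse_arrows C X Y f g \<Longrightarrow> is_iso_arrow C Y X g"
  by (auto simp: is_iso_arrow_def inverse_arrows_def)

lemma (in monoidal_category) TenA_iso:
  assumes ob: "X \<in> Ob C" "X' \<in> Ob C" "Y \<in> Ob C" "Y' \<in> Ob C"
    and f: "is_iso_arrow C X X' f" and g: "is_iso_arrow C Y Y' g"
  shows "is_iso_arrow C (TenO C X Y) (TenO C X' Y') (TenA C X X' Y Y' f g)"
proof -
  obtain f' g' where "inverse_arrows C X X' f f'" "inverse_arrows C Y Y' g g'"
    using f g by (auto simp: is_iso_arrow_def)
  then have "inverse_arrows C (TenO C X Y) (TenO C X' Y') (TenA C X X' Y Y' f g) (TenA C X' X Y' Y f' g')"
    using ob TenA_Cmp[of X X' X Y Y' Y f f' g g'] TenA_Cmp[of X' X X' Y' Y Y' f' f g' g]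
    by (simp add: inverse_arrows_def TenA_in TenA_Id)
  then show ?thesis
    by (auto simp: is_iso_arrow_def)
qed

text \<open>The quasi-inverse conjugates an arrow with chosen isomorphisms \<open>\<psi> Y : F (g Y) \<rightarrow> Y\<close> and
  lifts the result along the fully faithful functor.\<close>

lemma cat_equivalenceI:
  fixes C :: "('o, 'm, 'y) cat_scheme" and D :: "('p, 'n, 'z) cat_scheme"
    and F :: "('o, 'm, 'p, 'n, 'v) fctr_scheme"
  assumes F: "cat_functor C D F"
    and fully_faithful: "\<And>X Y. \<lbrakk>X \<in> Ob C; Y \<in> Ob C\<rbrakk> \<Longrightarrow>
      bij_betw (FArr F X Y) (Hom C X Y) (Hom D (FOb F X) (FOb F Y))"
    and ess_surj: "\<And>Y. Y \<in> Ob D \<Longrightarrow> \<exists>X \<in> Ob C. \<exists>f. is_iso_arrow D (FOb F X) Y f"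
  shows "cat_equivalence C D F"
proof -
  interpret F: cat_functor C D F by (rule F)
  note F_simps [simp] = F.FOb_ob F.FArr_in F.src.Id_in F.src.Cmp_in F.tgt.Id_in F.tgt.Cmp_in
    F.tgt.Cmp_Id_left F.tgt.Cmp_Id_right F.src.Cmp_Id_left F.src.Cmp_Id_right
  have "\<forall>Y. \<exists>X f f'. Y \<in> Ob D \<longrightarrow> X \<in> Ob C \<and> inverse_arrows D (FOb F X) Y f f'"
    using ess_surj unfolding is_iso_arrow_def by blast
  then obtain g \<psi> \<psi>' where "\<And>Y. Y \<in> Ob D \<Longrightarrow> g Y \<in> Ob C \<and> inverse_arrows D (FOb F (g Y)) Y (\<psi> Y) (\<psi>' Y)"
    by metis
  then have g [simp]: "Y \<in> Ob D \<Longrightarrow> g Y \<in> Ob C"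
    and \<psi> [simp]: "Y \<in> Ob D \<Longrightarrow> \<psi> Y \<in> Hom D (FOb F (g Y)) Y"
    and \<psi>' [simp]: "Y \<in> Ob D \<Longrightarrow> \<psi>' Y \<in> Hom D Y (FOb F (g Y))"
    and inv1 [simp]: "Y \<in> Ob D \<Longrightarrow> Cmp D (FOb F (g Y)) Y (FOb F (g Y)) (\<psi>' Y) (\<psi> Y) = Id D (FOb F (g Y))"
    and inv2 [simp]: "Y \<in> Ob D \<Longrightarrow> Cmp D Y (FOb F (g Y)) Y (\<psi> Y) (\<psi>' Y) = Id D Y" for Y
    by (auto simp: inverse_arrows_def)
  define lift where "lift X Y = inv_into (Hom C X Y) (FArr F X Y)" for X Y
  have lift_in [simp]: "lift X Y h \<in> Hom C X Y" and F_lift [simp]: "FArr F X Y (lift X Y h) = h"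
    if "X \<in> Ob C" "Y \<in> Ob C" "h \<in> Hom D (FOb F X) (FOb F Y)" for X Y h
    using fully_faithful[OF that(1,2)] that(3) unfolding lift_def
    by (auto simp: bij_betw_def inv_into_into f_inv_into_f)
  have faithful: "f = f'"
    if "FArr F X Y f = FArr F X Y f'" "X \<in> Ob C" "Y \<in> Ob C" "f \<in> Hom C X Y" "f' \<in> Hom C X Y" for X Y f f'
    using fully_faithful[OF that(2,3)] that by (auto simp: bij_betw_def inj_on_def)
  define cj where "cj Y Z h = Cmp D (FOb F (g Y)) Z (FOb F (g Z)) (\<psi>' Z) (Cmp D (FOb F (g Y)) Y Z h (\<psi> Y))" for Y Z h
  have cj_in [simp]: "cj Y Z h \<in> Hom D (FOb F (g Y)) (FOb F (g Z))"
    if "Y \<in> Ob D" "Z \<in> Ob D" "h \<in> Hom D Y Z" for Y Z h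
    using that by (auto simp: cj_def intro!: F.tgt.Cmp_in[where Y = Z] F.tgt.Cmp_in[where Y = Y])
  have \<psi>_cj: "Cmp D (FOb F (g Y)) (FOb F (g Z)) Z (\<psi> Z) (cj Y Z h) = Cmp D (FOb F (g Y)) Y Z h (\<psi> Y)"
    if "Y \<in> Ob D" "Z \<in> Ob D" "h \<in> Hom D Y Z" for Y Z h
    using that F.tgt.Cmp_assoc[of "FOb F (g Y)" Z "FOb F (g Z)" Z "Cmp D (FOb F (g Y)) Y Z h (\<psi> Y)" "\<psi>' Z" "\<psi> Z"]
    by (simp add: cj_def F.tgt.Cmp_in[where Y = Y])
  \<comment> \<open>\<open>\<psi>' Z\<close> is a left inverse of \<open>\<psi> Z\<close>, so
    \<open>\<psi> Z\<close> can be cancelled. Functoriality of conjugation is tested after composing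
    with it.\<close>
  have \<psi>_mono: "k = k'"
    if "Cmp D X (FOb F (g Z)) Z (\<psi> Z) k = Cmp D X (FOb F (g Z)) Z (\<psi> Z) k'"
      "X \<in> Ob D" "Z \<in> Ob D" "k \<in> Hom D X (FOb F (g Z))" "k' \<in> Hom D X (FOb F (g Z))" for X Z k k'
    using F.tgt.Cmp_assoc[of X "FOb F (g Z)" Z "FOb F (g Z)" k "\<psi> Z" "\<psi>' Z"]
      F.tgt.Cmp_assoc[of X "FOb F (g Z)" Z "FOb F (g Z)" k' "\<psi> Z" "\<psi>' Z"] that
    by simp
  have cj_Id: "cj Y Y (Id D Y) = Id D (FOb F (g Y))" if "Y \<in> Ob D" for Y
    using that by (simp add: cj_def)
  have cj_Cmp: "cj X Z (Cmp D X Y Z k h) = Cmp D (FOb F (g X)) (FOb F (g Y)) (FOb F (g Z)) (cj Y Z k) (cj X Y h)"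
    if "X \<in> Ob D" "Y \<in> Ob D" "Z \<in> Ob D" "h \<in> Hom D X Y" "k \<in> Hom D Y Z" for X Y Z h k
  proof (rule \<psi>_mono[where X = "FOb F (g X)" and Z = Z])
    let ?X = "FOb F (g X)" and ?Y = "FOb F (g Y)" and ?Z = "FOb F (g Z)"
    have "Cmp D ?X ?Z Z (\<psi> Z) (Cmp D ?X ?Y ?Z (cj Y Z k) (cj X Y h)) =
        Cmp D ?X ?Y Z (Cmp D ?Y ?Z Z (\<psi> Z) (cj Y Z k)) (cj X Y h)"
      using that by (subst F.tgt.Cmp_assoc) auto
    also have "\<dots> = Cmp D ?X Y Z k (Cmp D ?X ?Y Y (\<psi> Y) (cj X Y h))"
      using that by (simp add: \<psi>_cj F.tgt.Cmp_assoc)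
    also have "\<dots> = Cmp D ?X ?Z Z (\<psi> Z) (cj X Z (Cmp D X Y Z k h))"
      using that F.tgt.Cmp_in[of X Y Z h k] by (simp add: \<psi>_cj F.tgt.Cmp_assoc)
    finally show "Cmp D ?X ?Z Z (\<psi> Z) (cj X Z (Cmp D X Y Z k h)) =
      Cmp D ?X ?Z Z (\<psi> Z) (Cmp D ?X ?Y ?Z (cj Y Z k) (cj X Y h))" ..
  qed (use that F.tgt.Cmp_in[of X Y Z h k]
      F.tgt.Cmp_in[of "FOb F (g X)" "FOb F (g Y)" "FOb F (g Z)" "cj X Y h" "cj Y Z k"] in simp_all)
  define G :: "('p, 'n, 'o, 'm) fctr" where
    "G = \<lparr>FOb = g, FArr = (\<lambda>Y Z h. lift (g Y) (g Z) (cj Y Z h))\<rparr>"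
  have G_simps [simp]: "FOb G Y = g Y" "FArr G Y Z h = lift (g Y) (g Z) (cj Y Z h)" for Y Z h
    by (simp_all add: G_def)
  have G: "cat_functor D C G"
  proof (intro cat_functor.intro cat_functor_axioms.intro F.src.category_axioms F.tgt.category_axioms)
    fix X assume X: "X \<in> Ob D"
    then show "FArr G X X (Id D X) = Id C (FOb G X)"
      by (intro faithful[where X = "g X" and Y = "g X"]) (simp_all add: cj_Id F.FArr_Id)
  next
    fix X Y Z h k assume "X \<in> Ob D" "Y \<in> Ob D" "Z \<in> Ob D" "h \<in> Hom D X Y" "k \<in> Hom D Y Z"
    then show "FArr G X Z (Cmp D X Y Z k h) = Cmp C (FOb G X) (FOb G Y) (FOb G Z) (FArr G Y Z k) (FArr G X Y h)"
      using F.tgt.Cmp_in[of X Y Z h k]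
        F.src.Cmp_in[of "g X" "g Y" "g Z" "lift (g X) (g Y) (cj X Y h)" "lift (g Y) (g Z) (cj Y Z k)"]
      by (intro faithful[where X = "g X" and Y = "g Z"]) (simp_all add: cj_Cmp F.FArr_Cmp)
  qed simp_all
  \<comment> \<open>\<open>F\<close> sends \<open>\<theta> X\<close> to
    \<open>\<psi> (FOb F X)\<close>, so invertibility and naturality of \<open>\<theta>\<close>
    follow from those of \<open>\<psi>\<close> by faithfulness.\<close>
  define \<theta> where "\<theta> X = lift (g (FOb F X)) X (\<psi> (FOb F X))" for X
  have \<theta>_iso: "is_iso_arrow C (g (FOb F X)) X (\<theta> X)" if X: "X \<in> Ob C" for X
  proof -
    let ?\<theta>' = "lift X (g (FOb F X)) (\<psi>' (FOb F X))"
    have "Cmp C (g (FOb F X)) X (g (FOb F X)) ?\<theta>' (\<theta> X) = Id C (g (FOb F X))"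
      using X F.src.Cmp_in[of "g (FOb F X)" X "g (FOb F X)" "\<theta> X" ?\<theta>']
      by (intro faithful[where X = "g (FOb F X)" and Y = "g (FOb F X)"]) (simp_all add: \<theta>_def F.FArr_Cmp F.FArr_Id)
    moreover have "Cmp C X (g (FOb F X)) X (\<theta> X) ?\<theta>' = Id C X"
      using X F.src.Cmp_in[of X "g (FOb F X)" X ?\<theta>' "\<theta> X"]
      by (intro faithful[where X = X and Y = X]) (simp_all add: \<theta>_def F.FArr_Cmp F.FArr_Id)
    ultimately show ?thesis
      unfolding is_iso_arrow_def inverse_arrows_def using X by (intro exI[of _ ?\<theta>']) (simp add: \<theta>_def)
  qed
  have "nat_iso C C (comp_fctr G F) id_fctr \<theta>"
    unfolding nat_iso_def
  proof (intro conjI ballI)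
    fix X Y f assume XY: "X \<in> Ob C" "Y \<in> Ob C" "f \<in> Hom C X Y"
    let ?X = "g (FOb F X)" and ?Y = "g (FOb F Y)" and ?f = "cj (FOb F X) (FOb F Y) (FArr F X Y f)"
    have "Cmp C ?X X Y f (\<theta> X) = Cmp C ?X ?Y Y (\<theta> Y) (lift ?X ?Y ?f)"
      using XY F.src.Cmp_in[of ?X X Y "\<theta> X" f] F.src.Cmp_in[of ?X ?Y Y "lift ?X ?Y ?f" "\<theta> Y"]
      by (intro faithful[where X = ?X and Y = Y]) (simp_all add: \<theta>_def F.FArr_Cmp \<psi>_cj)
    then show "Cmp C (FOb (comp_fctr G F) X) (FOb id_fctr X) (FOb id_fctr Y) (FArr id_fctr X Y f) (\<theta> X) =
        Cmp C (FOb (comp_fctr G F) X) (FOb (comp_fctr G F) Y) (FOb id_fctr Y) (\<theta> Y) (FArr (comp_fctr G F) X Y f)"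
      by (simp add: comp_fctr_def id_fctr_def)
  qed (simp add: comp_fctr_def id_fctr_def \<theta>_iso)
  moreover have "nat_iso D D (comp_fctr F G) id_fctr \<psi>"
    unfolding nat_iso_def
    by (auto simp: comp_fctr_def id_fctr_def \<psi>_cj is_iso_arrow_def inverse_arrows_def)
       (use \<psi>' inv1 inv2 in blast)
  ultimately show ?thesis
    unfolding cat_equivalence_def using F G by blast
qed

context skew_biset_tensor
begin

section \<open>The functor to \<open>F\<close>-sets\<close>

abbreviation L :: "'u \<Rightarrow> 'u lset" where
  "L \<equiv> hom_lset A"

lemma hom_lset_simps [simp]:
  "carrier (L u) = comod_hom A u \<delta>"
  "\<lbrakk>f \<in> comod_hom A \<delta> \<delta>; s \<in> comod_hom A u \<delta>\<rbrakk> \<Longrightarrow> act (L u) f s = f \<otimes> s"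
  by (simp_all add: hom_lset_def)

lemma is_lset_hom [simp]: "comodule u \<Longrightarrow> is_lset B (L u)"
  unfolding is_lset_def
  by (auto simp: comod_hom_one comod_hom_comp[where v = \<delta>] comod_hom_closed m_assoc)
     (auto simp: hom_lset_def comod_hom_comp[where v = \<delta>])

lemma lset_biset_hom [simp]: "comodule u \<Longrightarrow> U (L u) = H u"
  by (rule biset_eqI[of A]) (simp_all, simp_all add: hom_biset_def)

lemma act_delta_hom: "\<lbrakk>comodule u; a \<in> carrier A\<rbrakk> \<Longrightarrow> act (L u) \<delta> (\<Q> a \<otimes> u) = \<Q> (\<Q> a \<otimes> u) \<otimes> u"
  using Q_delta_Q_comodule[of u \<one> a] by simp

lemma precomp_lset_hom:
  assumes "comodule u" "comodule v" "s \<in> comod_hom A v u"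
  shows "(\<lambda>t \<in> comod_hom A u \<delta>. t \<otimes> s) \<in> lset_hom B (L u) (L v)"
  using assms comod_hom_comp[of _ \<delta> \<delta> u]
  by (auto simp: lset_hom_def comod_hom_comp[where v = u] comod_hom_comp[where v = \<delta>] comod_hom_closed m_assoc)

text \<open>By \<open>act_delta_hom\<close>, an arrow is the coordinate of its own image under
  \<open>\<delta>\<close>. Commuting with \<open>\<delta>\<close> is therefore
  \<open>mu_tens_coord\<close> once more, now as an identity between coefficients.\<close>

lemma hom_ten_lset_hom:
  assumes "comodule u" "comodule v"
  shows "hom_ten u v \<in> lset_hom B (L u \<boxdot> L v) (L (u \<circledcirc> v))"
proof -
  have coeff: "\<mu> \<otimes> (\<Q> a \<otimes> u) \<otimes> (\<epsilon> \<otimes> (\<T> (\<Q> b \<otimes> v) \<otimes> u)) = \<Q> (a \<otimes> (\<epsilon> \<otimes> (\<T> b \<otimes> u))) \<otimes> (u \<circledcirc> v)"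
    if "a \<in> carrier A" "b \<in> carrier A" for a b
    using mu_tens_coord[OF assms that] that assms by (simp add: m_assoc)
  have "hom_ten u v (act (L u \<boxdot> L v) \<delta> z) = act (L (u \<circledcirc> v)) \<delta> (hom_ten u v z)"
    if "z \<in> tens_carrier A p (H u) (H v)" for z
  proof -
    obtain a b where [simp]: "a \<in> carrier A" "b \<in> carrier A"
      and z: "z = tensor_el (H u) (H v) (\<Q> a \<otimes> u) (\<Q> b \<otimes> v)"
      using \<open>z \<in> _\<close> assms by (auto elim!: tens_cases comod_hom_cases)
    have "act (L u \<boxdot> L v) \<delta> z = tensor_el (H u) (H v) (\<Q> (\<mu> \<otimes> (\<Q> a \<otimes> u)) \<otimes> u) (\<Q> (\<Q> b \<otimes> v) \<otimes> v)"
      using assms by (simp add: z act_tensor_delta act_delta_hom del: hom_lset_simps(2))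
        (simp add: Q_mult[of \<mu>] m_assoc)
    then show ?thesis
      using assms by (simp add: z coeff act_delta_hom del: hom_lset_simps(2))
  qed
  then show ?thesis
    using assms by (simp add: lset_hom_iff hom_ten_biset_hom del: hom_lset_simps(2))
qed

lemma hom_ten_lset_iso:
  assumes "comodule u" "comodule v"
  shows "is_iso_arrow lsets (L u \<boxdot> L v) (L (u \<circledcirc> v)) (hom_ten u v)"
  using assms hom_ten_bij by (intro lset_isoI) (simp_all add: hom_ten_lset_hom)

lemma hom_unit_lset_iso: "is_iso_arrow lsets I (L \<eta>) (\<lambda>a \<in> carrier A. \<Q> a \<otimes> \<eta>)"
proof (rule lset_isoI)
  show "(\<lambda>a \<in> carrier A. \<Q> a \<otimes> \<eta>) \<in> lset_hom B I (L \<eta>)"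
    using hom_unit_biset_hom
    by (simp add: lset_hom_iff act_unit_delta act_delta_hom del: hom_lset_simps(2))
qed (use hom_unit_bij in simp_all)

section \<open>Source-regular \<open>F\<close>-sets\<close>

lemma source_regular_hom:
  assumes "comodule u"
  shows "source_regular A B (L u)"
  unfolding source_regular_def
proof (intro exI conjI ballI)
  show "bij_betw (\<lambda>a. \<Q> a \<otimes> u) (carrier A) (carrier (L u))"
    by (rule bij_betwI[where g = "\<lambda>s. \<epsilon> \<otimes> s"])
       (auto simp: assms comod_hom_closed eps_Q_comodule simp flip: comod_hom_coord)
qed (simp add: assms Q_mult m_assoc)

lemma source_regular_transfer:
  assumes "is_iso_arrow lsets X Y f" "is_lset B X" "is_lset B Y" "source_regular A B X"
  shows "source_regular A B Y"
proof -
  have f: "f \<in> lset_hom B X Y" and "is_iso_arrow bisets (U X) (U Y) f"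
    using assms(1-3) by (auto simp: is_iso_arrow_def inverse_arrows_def intro!: lset_hom_biset_hom)
  then have bij: "bij_betw f (carrier X) (carrier Y)"
    using assms(2,3) by (simp add: biset_iso_iff)
  obtain h where h: "bij_betw h (carrier A) (carrier X)"
    and lin: "\<And>a b. \<lbrakk>a \<in> carrier A; b \<in> carrier A\<rbrakk> \<Longrightarrow> h (a \<otimes> b) = act X (\<Q> a) (h b)"
    using assms(4) by (auto simp: source_regular_def)
  have "f (h (a \<otimes> b)) = act Y (\<Q> a) (f (h b))" if "a \<in> carrier A" "b \<in> carrier A" for a b
    using lset_hom_act[OF f, of "\<Q> a" "h b"] that lin bij_betwE[OF h] by simp
  then show ?thesis
    unfolding source_regular_def using bij_betw_trans[OF h bij] by (intro exI[of _ "f \<circ> h"]) simp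
qed

lemma source_regular_ess_surj:
  assumes X: "is_lset B X" and "source_regular A B X"
  obtains u f where "comodule u" "is_iso_arrow lsets (L u) X f"
proof -
  obtain h where h: "bij_betw h (carrier A) (carrier X)"
    and lin: "\<And>a b. \<lbrakk>a \<in> carrier A; b \<in> carrier A\<rbrakk> \<Longrightarrow> h (a \<otimes> b) = act X (\<Q> a) (h b)"
    using assms(2) by (auto simp: source_regular_def)
  define x where "x = h \<one>"
  have x [simp]: "x \<in> carrier X"
    using bij_betwE[OF h] by (simp add: x_def)
  have hx: "h a = act X (\<Q> a) x" if "a \<in> carrier A" for a
    using lin[of a \<one>] that by (simp add: x_def)
  \<comment> \<open>Freeness on \<open>x\<close> turns equations in \<open>X\<close> into equations
    in \<open>A\<close>. Both comodule laws below are obtained so, from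
    \<open>\<Q> \<epsilon> \<otimes> \<delta> = \<one>\<close> and \<open>\<delta> \<otimes>
    \<delta> = \<Q> \<delta> \<otimes> \<delta>\<close> acting on \<open>x\<close>.\<close>
  have inj: "a = b" if "act X (\<Q> a) x = act X (\<Q> b) x" "a \<in> carrier A" "b \<in> carrier A" for a b
    using that h by (auto simp: bij_betw_def inj_on_def hx)
  obtain u where u [simp]: "u \<in> carrier A" and \<delta>x: "act X \<delta> x = act X (\<Q> u) x"
  proof -
    have "act X \<delta> x \<in> h ` carrier A"
      using X by (simp add: bij_betw_imp_surj_on[OF h])
    then show ?thesis
      using that hx by auto
  qed
  have "\<epsilon> \<otimes> u = \<one>"
    using X act_Q_eps_delta[OF X x] by - (rule inj, simp_all add: \<delta>x act_Q_Q)
  moreover have "\<Q> u \<otimes> u = \<delta> \<otimes> u"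
    using X act_delta_delta[OF X x] by - (rule inj, simp_all add: \<delta>x act_delta_Q act_Q_Q)
  ultimately have cu [simp]: "comodule u"
    by (simp add: comodule_def)
  define f where "f = (\<lambda>s \<in> comod_hom A u \<delta>. act X (\<Q> (\<epsilon> \<otimes> s)) x)"
  have f: "f (\<Q> a \<otimes> u) = act X (\<Q> a) x" if "a \<in> carrier A" for a
    using that by (simp add: f_def eps_Q_comodule)
  have "f \<in> biset_hom A (U (L u)) (U X)"
  proof (rule biset_homI)
    \<comment> \<open>The right action is forced: \<open>\<S> a\<close> is
      \<open>\<Q> (\<epsilon> \<otimes> \<T> a) \<otimes> \<delta>\<close>, and the effect of
      \<open>\<delta>\<close> on \<open>x\<close> is given by \<open>u\<close>.\<close>
    show "f (lact (U (L u)) a s) = lact (U X) a (f s)" "f (ract (U (L u)) s a) = ract (U X) (f s) a"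
      if "a \<in> carrier A" "s \<in> carrier (U (L u))" for a s
      using that X
      by (auto elim!: comod_hom_cases simp: f act_Q_Q act_S_Q, simp add: act_S \<delta>x act_Q_Q m_assoc)
  qed (use X in \<open>auto simp: f_def comod_hom_closed\<close>)
  then have "f \<in> lset_hom B (L u) X"
    using X by (auto elim!: comod_hom_cases
        simp: lset_hom_iff f act_delta_hom act_delta_Q \<delta>x act_Q_Q simp del: hom_lset_simps(2))
  moreover have "bij_betw f (carrier (L u)) (carrier X)"
  proof (rule bij_betwI[where g = "\<lambda>y. \<Q> (inv_into (carrier A) h y) \<otimes> u"])
    have inv: "inv_into (carrier A) h y \<in> carrier A" "act X (\<Q> (inv_into (carrier A) h y)) x = y" if "y \<in> carrier X" for y
      using h that hx[of "inv_into (carrier A) h y"] by (auto simp: bij_betw_def inv_into_into f_inv_into_f)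
    show "(\<lambda>y. \<Q> (inv_into (carrier A) h y) \<otimes> u) \<in> carrier X \<rightarrow> carrier (L u)"
      using inv by simp
    show "f (\<Q> (inv_into (carrier A) h y) \<otimes> u) = y" if "y \<in> carrier X" for y
      using that inv by (simp add: f)
    show "\<Q> (inv_into (carrier A) h (f s)) \<otimes> u = s" if "s \<in> carrier (L u)" for s
      using that h by (auto elim!: comod_hom_cases simp: f bij_betw_inv_into_left simp flip: hx)
  qed (use X in \<open>auto simp: f_def comod_hom_closed\<close>)
  ultimately show thesis
    using X that[of u f] by (simp add: lset_isoI)
qed

abbreviation reg_lsets :: "('u lset, 'u \<Rightarrow> 'u) moncat" where
  "reg_lsets \<equiv> reg_lset_cat A p B"

lemma source_regular_unit: "source_regular A B I"
proof -
  have "bij_betw (\<lambda>a. a) (carrier A) (carrier I)"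
    by (simp add: bij_betw_def)
  then show ?thesis
    unfolding source_regular_def by (intro exI[of _ "\<lambda>a. a"]) (simp add: act_unit_Q)
qed

text \<open>Replacing the modules by isomorphic ones of the form \<open>L u\<close> and
  \<open>L v\<close> makes the tensor product isomorphic to \<open>L (u \<circledcirc> v)\<close>,
  for which a generator is known.\<close>

lemma source_regular_ltens:
  assumes X: "is_lset B X" "source_regular A B X" and Y: "is_lset B Y" "source_regular A B Y"
  shows "source_regular A B (X \<boxdot> Y)"
proof -
  interpret lsets: monoidal_category lsets by (rule monoidal_category_lsets)
  obtain u f where u: "comodule u" and f: "is_iso_arrow lsets (L u) X f"
    using source_regular_ess_surj[OF X] .
  obtain v g where v: "comodule v" and g: "is_iso_arrow lsets (L v) Y g"
    using source_regular_ess_surj[OF Y] .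
  obtain k where "inverse_arrows lsets (L u \<boxdot> L v) (L (u \<circledcirc> v)) (hom_ten u v) k"
    using hom_ten_lset_iso[OF u v] by (auto simp: is_iso_arrow_def)
  then have "is_iso_arrow lsets (L (u \<circledcirc> v)) (L u \<boxdot> L v) k"
    by (rule is_iso_arrow_sym)
  then have "source_regular A B (L u \<boxdot> L v)"
    using u v source_regular_hom[of "u \<circledcirc> v"] by (intro source_regular_transfer[of "L (u \<circledcirc> v)" "L u \<boxdot> L v" k]) simp_all
  then show ?thesis
    using lsets.TenA_iso[OF _ _ _ _ f g] X Y u v source_regular_transfer[of "L u \<boxdot> L v" "X \<boxdot> Y"] by simp
qed

lemma reg_lset_cat_simps [simp]:
  "Ob reg_lsets = {X. is_lset B X \<and> source_regular A B X}" "Hom reg_lsets = lset_hom B"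
  "Id reg_lsets X = (\<lambda>x \<in> carrier X. x)"
  "Cmp reg_lsets X Y Z g f = compose (carrier X) g f" "TenO reg_lsets = lset_tens A p B"
  "TenA reg_lsets X X' Y Y' f g = TenA bisets (U X) (U X') (U Y) (U Y') f g" "Unit reg_lsets = I"
  "Assoc reg_lsets X Y Z = Assoc bisets (U X) (U Y) (U Z)"
  "LUnit reg_lsets X = LUnit bisets (U X)" "RUnit reg_lsets X = RUnit bisets (U X)"
  "is_iso_arrow reg_lsets X Y f = is_iso_arrow lsets X Y f"
  by (auto simp: reg_lset_cat_def)

lemma monoidal_category_reg_lsets: "monoidal_category reg_lsets"
  unfolding reg_lset_cat_def
  by (rule monoidal_category_full_subcat)
     (simp_all add: monoidal_category_lsets source_regular_unit source_regular_ltens)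

lemma hom_lset_functor_simps [simp]:
  "FOb (hom_lset_functor A p) = L" "FArr (hom_lset_functor A p) = FArr (hom_functor A p)"
  "FTen (hom_lset_functor A p) = hom_ten" "FUnit (hom_lset_functor A p) = FUnit (hom_functor A p)"
  by (simp_all add: hom_lset_functor_def)

lemma cat_functor_hom_lset: "cat_functor (op_moncat (comod_cat A)) reg_lsets (hom_lset_functor A p)"
proof (intro cat_functor.intro cat_functor_axioms.intro)
  show "category (op_moncat (comod_cat A))" "category reg_lsets"
    using monoidal_category_op_comod monoidal_category_reg_lsets by (simp_all add: monoidal_category_def)
qed (auto simp: source_regular_hom precomp_lset_hom compose_def comod_hom_closed m_assoc comod_hom_comp
    intro!: restrict_ext)

text \<open>As functions the structure maps are those of the functor to bisets, so its equations
  carry over; their invertibility is now required among \<open>F\<close>-linear maps.\<close>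

lemma strong_monoidal_hom_lset:
  "strong_monoidal_functor (op_moncat (comod_cat A)) reg_lsets (hom_lset_functor A p)"
proof -
  interpret H: strong_monoidal_functor "op_moncat (comod_cat A)" bisets "hom_functor A p"
    by (rule strong_monoidal_hom_functor)
  show ?thesis
  proof (intro strong_monoidal_functor.intro strong_monoidal_functor_axioms.intro monoidal_category_op_comod
      monoidal_category_reg_lsets cat_functor_hom_lset, goal_cases)
    case (1 X Y) then show ?case by (simp add: hom_ten_lset_iso)
  next
    case 2 show ?case by (simp add: hom_unit_lset_iso)
  next
    case (3 X X' Y Y' f g) then show ?case using H.FTen_nat[of X X' Y Y' f g] by simp
  next
    case (4 X Y Z) then show ?case using H.FTen_assoc[of X Y Z] by simp
  next
    case (5 X) then show ?case using H.FTen_LUnit[of X] by simp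
  next
    case (6 X) then show ?case using H.FTen_RUnit[of X] by simp
  qed
qed

text \<open>A Yoneda argument: \<open>u\<close> generates \<open>L u\<close> over the source
  elements, so a linear \<open>h\<close> is determined by \<open>h u\<close>, and the arrow it comes
  from is the coordinate of that value.\<close>

lemma hom_lset_fully_faithful:
  assumes u: "comodule u" and v: "comodule v"
  shows "bij_betw (\<lambda>s. \<lambda>t \<in> comod_hom A u \<delta>. t \<otimes> s) (comod_hom A v u) (lset_hom B (L u) (L v))"
proof -
  have u_mem: "u \<in> comod_hom A u \<delta>"
    using Q_comodule_hom[of u \<one>] u by simp
  have coord: "\<epsilon> \<otimes> h u \<in> carrier A" "h u = \<Q> (\<epsilon> \<otimes> h u) \<otimes> v" if "h \<in> lset_hom B (L u) (L v)" for h
    using lset_hom_closed[OF that, of u] u_mem comod_hom_coord[OF v] by (auto simp: comod_hom_closed)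
  have arrow: "\<epsilon> \<otimes> h u \<in> comod_hom A v u" if h: "h \<in> lset_hom B (L u) (L v)" for h
  proof -
    define b where "b = \<epsilon> \<otimes> h u"
    have b [simp]: "b \<in> carrier A" and hu: "h u = \<Q> b \<otimes> v"
      using coord[OF h] by (simp_all add: b_def)
    \<comment> \<open>\<open>\<Q> u \<otimes> u\<close> equals \<open>\<delta> \<otimes> u\<close>,
      so linearity evaluates \<open>h\<close> there in two ways. Comparing coordinates gives the
      arrow equation for \<open>b\<close>.\<close>
    have "\<Q> (u \<otimes> b) \<otimes> v = h (\<Q> u \<otimes> u)"
      using lset_hom_act[OF h, of "\<Q> u" u] u_mem u v by (simp add: hu Q_mult m_assoc)
    also have "\<dots> = \<Q> (\<Q> b \<otimes> v) \<otimes> v"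
      using lset_hom_act[OF h, of \<delta> u] u_mem u v act_delta_hom[OF v b]
      by (simp add: hu Q_comodule)
    finally have "u \<otimes> b = \<Q> b \<otimes> v"
      using u v by simp
    then show ?thesis
      by (simp add: comod_hom_def flip: b_def)
  qed
  show ?thesis
  proof (rule bij_betwI[where g = "\<lambda>h. \<epsilon> \<otimes> h u"])
    show "(\<lambda>s. \<lambda>t \<in> comod_hom A u \<delta>. t \<otimes> s) \<in> comod_hom A v u \<rightarrow> lset_hom B (L u) (L v)"
      using u v by (simp add: precomp_lset_hom)
    show "(\<lambda>h. \<epsilon> \<otimes> h u) \<in> lset_hom B (L u) (L v) \<rightarrow> comod_hom A v u"
      by (simp add: arrow)
    show "\<epsilon> \<otimes> (\<lambda>t \<in> comod_hom A u \<delta>. t \<otimes> s) u = s" if "s \<in> comod_hom A v u" for s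
      using comod_hom_closed[OF that] u u_mem by (simp add: left_assoc1[OF eps_comodule])
    show "(\<lambda>t \<in> comod_hom A u \<delta>. t \<otimes> (\<epsilon> \<otimes> h u)) = h" if h: "h \<in> lset_hom B (L u) (L v)" for h
    proof (rule extensionalityI[where A = "comod_hom A u \<delta>"])
      show "h \<in> extensional (comod_hom A u \<delta>)"
        using h by (auto simp: lset_hom_def PiE_iff)
      fix t assume t: "t \<in> comod_hom A u \<delta>"
      then obtain a where a: "a \<in> carrier A" and ta: "t = \<Q> a \<otimes> u"
        using u by (auto elim!: comod_hom_cases)
      have "h t = \<Q> a \<otimes> (\<Q> (\<epsilon> \<otimes> h u) \<otimes> v)"
        using lset_hom_act[OF h, of "\<Q> a" u] lset_hom_closed[OF h, of u] u_mem a coord(2)[OF h] by (simp add: ta)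
      also have "\<dots> = t \<otimes> (\<epsilon> \<otimes> h u)"
        unfolding ta using comod_hom_precomp[OF u v arrow[OF h] a] coord(1)[OF h] a v by (simp add: Q_mult[of a] m_assoc)
      finally show "(\<lambda>t \<in> comod_hom A u \<delta>. t \<otimes> (\<epsilon> \<otimes> h u)) t = h t"
        using t by simp
    qed simp
  qed
qed

theorem monoidal_equivalence_hom_lset:
  "monoidal_equivalence (op_moncat (comod_cat A)) reg_lsets (hom_lset_functor A p)"
  unfolding monoidal_equivalence_def
proof (intro conjI strong_monoidal_hom_lset cat_equivalenceI cat_functor_hom_lset)
  show "bij_betw (FArr (hom_lset_functor A p) u v) (Hom (op_moncat (comod_cat A)) u v)
      (Hom reg_lsets (FOb (hom_lset_functor A p) u) (FOb (hom_lset_functor A p) v))"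
    if "u \<in> Ob (op_moncat (comod_cat A))" "v \<in> Ob (op_moncat (comod_cat A))" for u v
    using hom_lset_fully_faithful[of u v] that by (simp add: hom_functor_def)
  show "\<exists>u \<in> Ob (op_moncat (comod_cat A)). \<exists>f. is_iso_arrow reg_lsets (FOb (hom_lset_functor A p) u) X f"
    if "X \<in> Ob reg_lsets" for X
    using that source_regular_ess_surj[of X] by simp metis
qed

lemma hom_functor_factors:
  "monfctr_eq (op_moncat (comod_cat A))
    (comp_monfctr (op_moncat (comod_cat A)) lsets bisets (forgetful A p B) (hom_lset_functor A p))
    (hom_functor A p)"
proof -
  \<comment> \<open>The structure maps of the forgetful functor are identities restricted to
    carriers; composing with them gives back a function only if it is extensional.\<close>
  have "compose S h (\<lambda>z \<in> S. z) = h" if "h \<in> extensional S" for S and h :: "'u \<Rightarrow> 'u"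
    using that by (intro extensionalityI[where A = S]) (simp_all add: compose_eq)
  then show ?thesis
    unfolding monfctr_eq_def comp_monfctr_def by simp
qed

end

theorem theorem3p2:
  fixes A :: "('u, 'z) skew_monoid_scheme" and p :: "'u \<times> 'u \<Rightarrow> 'u"
  assumes "skew_monoidal_monoid A" and "inj p"
  shows "strong_monoidal_functor (op_moncat (comod_cat A)) (biset_cat A p) (hom_functor A p)
    \<and> strong_monoidal_functor (lset_cat A p (assoc_bialgebroid A p)) (biset_cat A p)
        (forgetful A p (assoc_bialgebroid A p))
    \<and> monoidal_equivalence (op_moncat (comod_cat A)) (reg_lset_cat A p (assoc_bialgebroid A p))
        (hom_lset_functor A p)
    \<and> monfctr_eq (op_moncat (comod_cat A))
        (comp_monfctr (op_moncat (comod_cat A)) (lset_cat A p (assoc_bialgebroid A p)) (biset_cat A p)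
          (forgetful A p (assoc_bialgebroid A p)) (hom_lset_functor A p))
        (hom_functor A p)"
proof -
  interpret skew_monoidal_monoid A by fact
  interpret skew_biset_tensor A p
    by unfold_locales (rule assms)
  show ?thesis
    using strong_monoidal_hom_functor strong_monoidal_forgetful monoidal_equivalence_hom_lset hom_functor_factors
    by blast
qed

end
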